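(* Let $n\ge 2$ and let $V\in L^\infty_{loc}(\mathbb R^n)$ be real-valued. Assume that there exist constants $R>1$, $C>0$ and $M\in\mathbb R$ such that on $\{x\in\mathbb R^n: |x|>R\}$ the function $V$ is locally Lipschitz, $|V(x)|\le C|x|^M$, and, in polar coordinates $(r,\theta)$, $r>0$, $\theta\in S^{n-1}$, $$\frac{\partial}{\partial r}\left(r^2V\right)\ge 0 .$$ Let $\lambda\ge 0$ be a constant and let $u\in L^2_{loc}(\mathbb R^n)$ be a real-valued weak solution to $-\Delta u-Vu=\lambda u$ on $\mathbb R^n$. If $\lim_{r\to\infty} r^m\int_{|x|>r}|u|^2=0$ for every $m\ge 0$, then $u\equiv 0$.
   Context: A weak solution is a solution in the sense of distributions. The derivative $\frac{\partial}{\partial r}(r^2V)$ is understood almost everywhere (where it exists, $V$ being locally Lipschitz for $|x|>R$). Equality $u\equiv 0$ is understood almost everywhere. *)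

theory Defs
  imports "HOL-Analysis.Analysis"
begin

definition locally_lipschitz_on ::
    "'a::metric_space set \<Rightarrow> ('a \<Rightarrow> 'b::metric_space) \<Rightarrow> bool" where
  "locally_lipschitz_on U f \<longleftrightarrow>
     (\<forall>x\<in>U. \<exists>e>0. \<exists>L. L-lipschitz_on (ball x e \<inter> U) f)"

definition Linf_loc :: "('a::euclidean_space \<Rightarrow> real) \<Rightarrow> bool" where
  "Linf_loc f \<longleftrightarrow> f \<in> borel_measurable lebesgue \<and>
     (\<forall>K. compact K \<longrightarrow> (\<exists>B. AE x in lebesgue. x \<in> K \<longrightarrow> \<bar>f x\<bar> \<le> B))"

definition L2_loc :: "('a::euclidean_space \<Rightarrow> real) \<Rightarrow> bool" where
  "L2_loc f \<longleftrightarrow> f \<in> borel_measurable lebesgue \<and>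
     (\<forall>K. compact K \<longrightarrow> set_integrable lebesgue K (\<lambda>x. \<bar>f x\<bar>\<^sup>2))"

definition partial_deriv :: "'n::finite \<Rightarrow> (real ^ 'n \<Rightarrow> real) \<Rightarrow> real ^ 'n \<Rightarrow> real" where
  "partial_deriv i f x = frechet_derivative f (at x) (axis i 1)"

definition laplacian :: "(real ^ 'n::finite \<Rightarrow> real) \<Rightarrow> real ^ 'n \<Rightarrow> real" where
  "laplacian f x = (\<Sum>i\<in>UNIV. partial_deriv i (partial_deriv i f) x)"

primrec Ck :: "nat \<Rightarrow> (real ^ 'n::finite \<Rightarrow> real) \<Rightarrow> bool" where
  "Ck 0 f \<longleftrightarrow> continuous_on UNIV f"
| "Ck (Suc k) f \<longleftrightarrow> (\<forall>x. f differentiable (at x)) \<and> (\<forall>i. Ck k (partial_deriv i f))"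

definition test_function :: "(real ^ 'n::finite \<Rightarrow> real) \<Rightarrow> bool" where
  "test_function \<phi> \<longleftrightarrow> (\<forall>k. Ck k \<phi>) \<and> compact (closure {x. \<phi> x \<noteq> 0})"

text \<open>
  The equation \<open>- \<Delta>u - V u = lam u\<close> in the sense of distributions, for real-valued \<open>u\<close>
  such that \<open>u\<close> and \<open>V u\<close> are locally integrable (in particular for \<open>V\<close> in \<open>Linf_loc\<close> and
  \<open>u\<close> in \<open>L2_loc\<close>), so that all integrals converge. As the equation is real, real-valued
  test functions suffice.
\<close>

definition weak_solution ::
    "(real ^ 'n::finite \<Rightarrow> real) \<Rightarrow> real \<Rightarrow> (real ^ 'n \<Rightarrow> real) \<Rightarrow> bool" where
  "weak_solution V lam u \<longleftrightarrow>
     (\<forall>\<phi>. test_function \<phi> \<longrightarrow>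
        (\<integral>x. u x * (- laplacian \<phi> x) \<partial>lebesgue) - (\<integral>x. V x * u x * \<phi> x \<partial>lebesgue)
          = lam * (\<integral>x. u x * \<phi> x \<partial>lebesgue))"

text \<open>
  \<open>\<partial>/\<partial>r (r\<^sup>2 V) \<ge> 0\<close> at almost every point \<open>x = r \<theta>\<close> with \<open>r = norm x > R\<close>, \<open>\<theta> = sgn x\<close>,
  at which this radial derivative exists. For \<open>V\<close> locally Lipschitz on \<open>norm x > R\<close> it exists
  almost everywhere there.
\<close>

definition radial_deriv_nonneg_ae :: "real \<Rightarrow> (real ^ 'n::finite \<Rightarrow> real) \<Rightarrow> bool" where
  "radial_deriv_nonneg_ae R V \<longleftrightarrow>
     (AE x in lebesgue. R < norm x \<longrightarrow>
        (\<forall>D. ((\<lambda>r. r\<^sup>2 * V (r *\<^sub>R sgn x)) has_real_derivative D) (at (norm x)) \<longrightarrow> 0 \<le> D))"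

text \<open>
  The mass of \<open>u\<close> outside the ball of radius \<open>r\<close>, with values in \<open>[0, \<infinity>]\<close>: the Bochner integral
  would wrongly be \<open>0\<close> when \<open>\<bar>u\<bar>\<^sup>2\<close> is not integrable at infinity.
\<close>

definition outer_mass :: "(real ^ 'n::finite \<Rightarrow> real) \<Rightarrow> real \<Rightarrow> ennreal" where
  "outer_mass u r = (\<integral>\<^sup>+x\<in>{x. r < norm x}. ennreal (\<bar>u x\<bar>\<^sup>2) \<partial>lebesgue)"

end

theory Submission
  imports Defs "HOL-Computational_Algebra.Polynomial"
begin

text \<open>
  The proof is a Carleman argument in the radial variable that needs no smallness of the potential.
  Write \<open>q = x \<bullet> x\<close>, let \<open>E = x \<bullet> grad\<close> be the Euler field and \<open>Y = V + lam\<close>.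
  The operator \<open>q \<Delta>\<close> is homogeneous of degree \<open>0\<close>, so it commutes with \<open>E\<close>. After conjugation with
  \<open>q ^ m\<close> it becomes a symmetric operator, namely \<open>div (q grad)\<close> up to a constant, minus
  \<open>(4 m + 2) (E + n / 2)\<close>, and \<open>E + n / 2\<close> is skew in \<open>L\<^sup>2(dx)\<close>. In the square of the norm
  of the conjugated \<open>q (\<Delta> + Y)\<close> the cross term of the symmetric and the skew part therefore vanishes for the
  Laplacian and has a good sign for \<open>q Y\<close>, precisely because \<open>r\<^sup>2 (V + lam)\<close> increases along
  rays. What remains is the large multiple \<open>(4 m + 2)\<^sup>2\<close> of the squared norm of \<open>(E + n / 2) z\<close>, which
  controls \<open>z\<close> by a Hardy inequality. This is \<open>carleman_estimate\<close>; it is uniform in \<open>Y\<close>.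

  A weak solution is only in \<open>L\<^sup>2\<close>. Mollification produces smooth functions that converge to it in
  \<open>L\<^sup>2\<close> on balls together with their Laplacians (\<open>smooth_approximation\<close>). The gradients
  produced by a cutoff are removed before the limit by the identity \<open>caccioppoli_identity\<close>, so that
  the inequality passes to the limit and its right-hand side involves \<open>u\<close> and \<open>\<Delta> u\<close> only
  (\<open>carleman_weak_solution\<close>).

  That \<open>r\<^sup>2 V\<close> increases along every ray does not follow from the sign of its derivative alone: one
  needs that a Lipschitz function on a line is differentiable almost everywhere. This is obtained from
  the theorems of Radon-Nikodym and Lebesgue, and is carried to \<open>n\<close> dimensions by Fubini's theorem for
  dilations and the continuity of \<open>V\<close> (\<open>radially_increasing\<close>).

  Two applications finish the proof. With \<open>Y = V + lam\<close> and a cutoff to an annulus, the decay of \<open>u\<close>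
  removes the contribution of the outer edge when the annulus grows, and \<open>m \<rightarrow> \<infinity>\<close> removes
  the one of the inner edge, because the weight is exponentially larger further out; hence \<open>u\<close> vanishes near
  infinity (\<open>vanishing_near_infinity\<close>). Now \<open>u\<close> has compact support, and \<open>\<bar>\<Delta> u\<bar> \<le> K \<bar>u\<bar>\<close>.
  Seen from an origin outside its support, the inequality with \<open>Y = 0\<close> needs no cutoff errors at
  all and gives \<open>u = 0\<close> as soon as \<open>(4 m + 2)\<^sup>2\<close> exceeds a constant
  (\<open>vanishing_of_compactly_supported\<close>).
\<close>

section \<open>Calculus of partial derivatives\<close>

lemma partial_deriv_eqI:
  "(f has_derivative f') (at x) \<Longrightarrow> partial_deriv i f x = f' (axis i 1)"
  unfolding partial_deriv_def using frechet_derivative_at by metis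

definition grad :: "(real ^ 'n::finite \<Rightarrow> real) \<Rightarrow> real ^ 'n \<Rightarrow> real ^ 'n" where
  "grad f x = (\<chi> i. partial_deriv i f x)"

lemma grad_nth [simp]: "grad f x $ i = partial_deriv i f x"
  by (simp add: grad_def)

text \<open>
  Only existence of the derivative is assumed: linearity then forces it to be the pairing with the
  vector of partial derivatives, which is what turns the coordinate definitions into vector calculus.
\<close>
lemma has_derivative_grad:
  assumes "f differentiable (at x)"
  shows "(f has_derivative (\<lambda>h. grad f x \<bullet> h)) (at x)"
proof -
  from assms obtain f' where f': "(f has_derivative f') (at x)"
    unfolding differentiable_def by blast
  then have lin: "linear f'"
    using has_derivative_linear by blast
  have "f' h = grad f x \<bullet> h" for h
  proof -
    have "f' h = f' (\<Sum>i\<in>UNIV. h $ i *\<^sub>R axis i 1)"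
      by (simp add: basis_expansion scalar_mult_eq_scaleR[symmetric])
    also have "\<dots> = (\<Sum>i\<in>UNIV. h $ i * partial_deriv i f x)"
      by (simp add: linear_sum[OF lin] linear_scale[OF lin] partial_deriv_eqI[OF f'])
    finally show ?thesis by (simp add: inner_vec_def mult.commute)
  qed
  then have "f' = (\<lambda>h. grad f x \<bullet> h)" by auto
  with f' show ?thesis by simp
qed

lemma partial_deriv_const [simp]: "partial_deriv i (\<lambda>x. c) = (\<lambda>x. 0)"
  by (rule ext) (simp add: partial_deriv_def)

lemma partial_deriv_nth: "partial_deriv i (\<lambda>x. x $ j) = (\<lambda>x. if i = j then 1 else 0)"
proof
  fix x :: "real^'a"
  have "((\<lambda>x::real^'a. x $ j) has_derivative (\<lambda>x. x $ j)) (at x)"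
    by (rule bounded_linear.has_derivative[OF bounded_linear_vec_nth]) simp
  from partial_deriv_eqI[OF this] show "partial_deriv i (\<lambda>x. x $ j) x = (if i = j then 1 else 0)"
    by (simp add: axis_def)
qed

lemma differentiable_nth: "(\<lambda>x::real^'n::finite. x $ j) differentiable (at x)"
  using bounded_linear.has_derivative[OF bounded_linear_vec_nth has_derivative_ident]
  unfolding differentiable_def by blast

lemma partial_deriv_add:
  assumes "f differentiable (at x)" "g differentiable (at x)"
  shows "partial_deriv i (\<lambda>x. f x + g x) x = partial_deriv i f x + partial_deriv i g x"
  using partial_deriv_eqI[OF has_derivative_add[OF has_derivative_grad[OF assms(1)] has_derivative_grad[OF assms(2)]], of i]
  by (simp add: inner_axis)

lemma partial_deriv_mult:
  assumes "f differentiable (at x)" "g differentiable (at x)"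
  shows "partial_deriv i (\<lambda>x. f x * g x) x = partial_deriv i f x * g x + f x * partial_deriv i g x"
  using partial_deriv_eqI[OF has_derivative_mult[OF has_derivative_grad[OF assms(1)] has_derivative_grad[OF assms(2)]], of i]
  by (simp add: inner_axis)

lemma partial_deriv_cmult:
  assumes "f differentiable (at x)"
  shows "partial_deriv i (\<lambda>x. c * f x) x = c * partial_deriv i f x"
  using partial_deriv_mult[of "\<lambda>x. c", OF _ assms] by simp

lemma partial_deriv_sum:
  assumes "finite I" "\<And>j. j \<in> I \<Longrightarrow> f j differentiable (at x)"
  shows "partial_deriv i (\<lambda>x. \<Sum>j\<in>I. f j x) x = (\<Sum>j\<in>I. partial_deriv i (f j) x)"
  using partial_deriv_eqI[OF has_derivative_sum[OF has_derivative_grad[OF assms(2)]], where i = i and I1 = I]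
  by (simp add: inner_axis)

lemma partial_deriv_compose:
  assumes "f differentiable (at x)" "(s has_real_derivative s') (at (f x))"
  shows "partial_deriv i (\<lambda>x. s (f x)) x = s' * partial_deriv i f x"
  using partial_deriv_eqI[OF has_derivative_compose[OF has_derivative_grad[OF assms(1)]
     assms(2)[unfolded has_field_derivative_def]], where i = i]
  by (simp add: inner_axis)

lemma Ck_imp_continuous: "Ck k f \<Longrightarrow> continuous_on UNIV f"
  by (cases k) (auto simp: continuous_on_eq_continuous_at intro: differentiable_imp_continuous_within)

lemma Ck_SucD: "Ck (Suc k) f \<Longrightarrow> Ck k f"
proof (induction k arbitrary: f)
  case 0
  then show ?case using Ck_imp_continuous[of "Suc 0" f] by simp
next
  case (Suc k)
  then show ?case by simp
qed

lemma Ck_mono: "Ck k f \<Longrightarrow> j \<le> k \<Longrightarrow> Ck j f"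
  by (induction k) (auto simp: le_Suc_eq simp del: Ck.simps dest: Ck_SucD)

lemma Ck_differentiable: "Ck k f \<Longrightarrow> 0 < k \<Longrightarrow> f differentiable (at x)"
  by (cases k) auto

lemma Ck_partial: "Ck (Suc k) f \<Longrightarrow> Ck k (partial_deriv i f)"
  by simp

lemma Ck_const [intro]: "Ck k (\<lambda>x. c)"
  by (induction k arbitrary: c) auto

lemma Ck_nth [intro]: "Ck k (\<lambda>x. x $ j)"
proof (cases k)
  case 0
  then show ?thesis by (auto intro!: continuous_intros)
next
  case (Suc m)
  then show ?thesis by (auto simp: partial_deriv_nth differentiable_nth)
qed

lemma Ck_add [intro]: "Ck k f \<Longrightarrow> Ck k g \<Longrightarrow> Ck k (\<lambda>x. f x + g x)"
proof (induction k arbitrary: f g)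
  case 0
  then show ?case by (auto intro!: continuous_intros)
next
  case (Suc k)
  then have "partial_deriv i (\<lambda>x. f x + g x) = (\<lambda>x. partial_deriv i f x + partial_deriv i g x)" for i
    by (auto simp: partial_deriv_add)
  with Suc show ?case by auto
qed

lemma Ck_mult [intro]: "Ck k f \<Longrightarrow> Ck k g \<Longrightarrow> Ck k (\<lambda>x. f x * g x)"
proof (induction k arbitrary: f g)
  case 0
  then show ?case by (auto intro!: continuous_intros)
next
  case (Suc k)
  then have "partial_deriv i (\<lambda>x. f x * g x) = (\<lambda>x. partial_deriv i f x * g x + f x * partial_deriv i g x)" for i
    by (auto simp: partial_deriv_mult)
  moreover have "Ck k f" "Ck k g" using Suc.prems by (auto simp del: Ck.simps dest: Ck_SucD)
  ultimately show ?case using Suc by (auto intro!: Ck_add)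
qed

lemma Ck_uminus [intro]: "Ck k f \<Longrightarrow> Ck k (\<lambda>x. - f x)"
  using Ck_mult[OF Ck_const, of k f "-1"] by simp

lemma Ck_diff [intro]: "Ck k f \<Longrightarrow> Ck k g \<Longrightarrow> Ck k (\<lambda>x. f x - g x)"
  using Ck_add[OF _ Ck_uminus, of k f g] by simp

lemma Ck_power [intro]: "Ck k f \<Longrightarrow> Ck k (\<lambda>x. f x ^ m)"
  by (induction m) auto

lemma Ck_sum [intro]: "(\<And>j. j \<in> I \<Longrightarrow> Ck k (f j)) \<Longrightarrow> Ck k (\<lambda>x. \<Sum>j\<in>I. f j x)"
  by (induction I rule: infinite_finite_induct) auto

lemma Ck_norm_sq [intro]: "Ck k (\<lambda>x. x \<bullet> x)"
  unfolding inner_vec_def inner_real_def by (intro Ck_sum Ck_mult Ck_nth)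

lemma partial_deriv_norm_sq: "partial_deriv i (\<lambda>x. x \<bullet> x) x = 2 * x $ i"
proof -
  have "((\<lambda>x. x \<bullet> x) has_derivative (\<lambda>h. 2 * (x \<bullet> h))) (at x)"
    by (auto intro!: derivative_eq_intros simp: inner_commute)
  from partial_deriv_eqI[OF this] show ?thesis by (simp add: inner_axis)
qed

text \<open>
  The one-dimensional counterpart of \<^const>\<open>Ck\<close>, for the profiles of radial functions. A derivative is
  asserted to exist rather than named, so that closed families of explicit functions can be treated by induction.
\<close>
primrec CkR :: "nat \<Rightarrow> (real \<Rightarrow> real) \<Rightarrow> bool" where
  "CkR 0 s \<longleftrightarrow> continuous_on UNIV s"
| "CkR (Suc k) s \<longleftrightarrow> (\<exists>s'. (\<forall>t. (s has_real_derivative s' t) (at t)) \<and> CkR k s')"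

lemma Ck_compose: "CkR k s \<Longrightarrow> Ck k f \<Longrightarrow> Ck k (\<lambda>x. s (f x))"
proof (induction k arbitrary: s)
  case 0
  then show ?case by (auto intro: continuous_on_compose2)
next
  case (Suc k)
  then obtain s' where s': "\<And>t. (s has_real_derivative s' t) (at t)" "CkR k s'" by auto
  have f: "\<And>x. f differentiable (at x)" "\<And>i. Ck k (partial_deriv i f)" "Ck k f"
    using Suc.prems Ck_SucD by auto
  have "partial_deriv i (\<lambda>x. s (f x)) = (\<lambda>x. s' (f x) * partial_deriv i f x)" for i
    using partial_deriv_compose[OF f(1) s'(1)] by auto
  moreover have "(\<lambda>x. s (f x)) differentiable (at x)" for x
    using has_derivative_compose[OF has_derivative_grad[OF f(1)] s'(1)[unfolded has_field_derivative_def]]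
    unfolding differentiable_def by blast
  ultimately show ?case
    using Suc.IH[OF s'(2) f(3)] f(2) by (auto intro!: Ck_mult)
qed

subsection \<open>Symmetry of second derivatives\<close>

lemma has_real_derivative_along:
  assumes "f differentiable (at (x + t *\<^sub>R v))"
  shows "((\<lambda>t. f (x + t *\<^sub>R v)) has_real_derivative grad f (x + t *\<^sub>R v) \<bullet> v) (at t)"
proof -
  have "((\<lambda>t. x + t *\<^sub>R v) has_derivative (\<lambda>h. h *\<^sub>R v)) (at t)"
    by (auto intro!: derivative_eq_intros)
  from has_derivative_compose[OF this has_derivative_grad[OF assms]]
  show ?thesis by (simp add: has_field_derivative_def mult.commute[of _ "grad f (x + t *\<^sub>R v) \<bullet> v"] mult_commute_abs)
qed

text \<open>
  Two applications of the mean value theorem, first in direction \<open>i\<close>, then in direction \<open>j\<close>. The second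
  difference on the left is symmetric in the two directions, the right-hand side is not: this gives the
  symmetry of second derivatives.
\<close>
lemma second_difference_mvt:
  fixes f :: "real ^ 'n::finite \<Rightarrow> real"
  assumes f: "Ck 2 f" and h: "0 < h"
  obtains y where "norm (y - x) \<le> 2 * h"
    "f (x + h *\<^sub>R axis i 1 + h *\<^sub>R axis j 1) - f (x + h *\<^sub>R axis i 1) - f (x + h *\<^sub>R axis j 1) + f x
      = h\<^sup>2 * partial_deriv j (partial_deriv i f) y"
proof -
  let ?a = "axis i 1 :: real^'n" and ?b = "axis j 1 :: real^'n"
  have d: "f differentiable (at y)" "partial_deriv i f differentiable (at y)" for y
    using f by (auto simp: numeral_2_eq_2)
  define g where "g t = f ((x + h *\<^sub>R ?b) + t *\<^sub>R ?a) - f (x + t *\<^sub>R ?a)" for t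
  define g' where "g' t = partial_deriv i f ((x + h *\<^sub>R ?b) + t *\<^sub>R ?a) - partial_deriv i f (x + t *\<^sub>R ?a)" for t
  have "(g has_real_derivative g' t) (at t)" for t
    unfolding g_def g'_def
    using DERIV_diff[OF has_real_derivative_along[OF d(1), where x = "x + h *\<^sub>R ?b" and t = t and v = ?a] has_real_derivative_along[OF d(1), where x = x and t = t and v = ?a]]
    by (simp add: inner_axis)
  from MVT2[OF h this] obtain t where t: "0 < t" "t < h" "g h - g 0 = h * g' t" by auto
  define k where "k s = partial_deriv i f ((x + t *\<^sub>R ?a) + s *\<^sub>R ?b)" for s
  have "(k has_real_derivative partial_deriv j (partial_deriv i f) ((x + t *\<^sub>R ?a) + s *\<^sub>R ?b)) (at s)" for s
    unfolding k_def using has_real_derivative_along[OF d(2), where x = "x + t *\<^sub>R ?a" and t = s and v = ?b] by (simp add: inner_axis)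
  from MVT2[OF h this] obtain s where s: "0 < s" "s < h"
    "k h - k 0 = h * partial_deriv j (partial_deriv i f) ((x + t *\<^sub>R ?a) + s *\<^sub>R ?b)" by auto
  have kg: "k h - k 0 = g' t" by (simp add: k_def g'_def algebra_simps)
  show ?thesis
  proof (rule that[of "(x + t *\<^sub>R ?a) + s *\<^sub>R ?b"])
    have "norm (t *\<^sub>R ?a + s *\<^sub>R ?b) \<le> norm (t *\<^sub>R ?a) + norm (s *\<^sub>R ?b)" by (rule norm_triangle_ineq)
    then show "norm ((x + t *\<^sub>R ?a) + s *\<^sub>R ?b - x) \<le> 2 * h" using t s by (simp add: algebra_simps)
    show "f (x + h *\<^sub>R ?a + h *\<^sub>R ?b) - f (x + h *\<^sub>R ?a) - f (x + h *\<^sub>R ?b) + f x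
      = h\<^sup>2 * partial_deriv j (partial_deriv i f) ((x + t *\<^sub>R ?a) + s *\<^sub>R ?b)"
      using t(3) kg s(3) unfolding g_def by (simp add: algebra_simps power2_eq_square)
  qed
qed

lemma partial_deriv_commute:
  fixes f :: "real ^ 'n::finite \<Rightarrow> real"
  assumes f: "Ck 2 f"
  shows "partial_deriv i (partial_deriv j f) x = partial_deriv j (partial_deriv i f) x"
proof -
  define h where "h n = inverse (real (Suc n))" for n
  have h0: "h \<longlonglongrightarrow> 0" and hp: "h n > 0" for n
    unfolding h_def by (rule LIMSEQ_inverse_real_of_nat) simp
  have c: "isCont (partial_deriv a (partial_deriv b f)) x" for a b
    using f by (auto simp: numeral_2_eq_2 continuous_on_eq_continuous_at)
  have "\<exists>y. norm (y - x) \<le> 2 * h n \<and>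
    f (x + h n *\<^sub>R axis i 1 + h n *\<^sub>R axis j 1) - f (x + h n *\<^sub>R axis i 1) - f (x + h n *\<^sub>R axis j 1) + f x
      = (h n)\<^sup>2 * partial_deriv j (partial_deriv i f) y" for n
    using second_difference_mvt[OF f hp[of n], of x i j] by metis
  then obtain y where y: "\<And>n. norm (y n - x) \<le> 2 * h n"
    "\<And>n. f (x + h n *\<^sub>R axis i 1 + h n *\<^sub>R axis j 1) - f (x + h n *\<^sub>R axis i 1) - f (x + h n *\<^sub>R axis j 1) + f x
      = (h n)\<^sup>2 * partial_deriv j (partial_deriv i f) (y n)" by metis
  have "\<exists>y. norm (y - x) \<le> 2 * h n \<and>
    f (x + h n *\<^sub>R axis j 1 + h n *\<^sub>R axis i 1) - f (x + h n *\<^sub>R axis j 1) - f (x + h n *\<^sub>R axis i 1) + f x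
      = (h n)\<^sup>2 * partial_deriv i (partial_deriv j f) y" for n
    using second_difference_mvt[OF f hp[of n], of x j i] by metis
  then obtain z where z: "\<And>n. norm (z n - x) \<le> 2 * h n"
    "\<And>n. f (x + h n *\<^sub>R axis j 1 + h n *\<^sub>R axis i 1) - f (x + h n *\<^sub>R axis j 1) - f (x + h n *\<^sub>R axis i 1) + f x
      = (h n)\<^sup>2 * partial_deriv i (partial_deriv j f) (z n)" by metis
  have eq: "partial_deriv j (partial_deriv i f) (y n) = partial_deriv i (partial_deriv j f) (z n)" for n
  proof -
    have "(h n)\<^sup>2 * partial_deriv j (partial_deriv i f) (y n) = (h n)\<^sup>2 * partial_deriv i (partial_deriv j f) (z n)"
      using y(2)[of n] z(2)[of n] by (simp add: algebra_simps)
    then show ?thesis using hp[of n] by simp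
  qed
  have lim: "w \<longlonglongrightarrow> x" if "\<And>n. norm (w n - x) \<le> 2 * h n" for w
  proof -
    have "(\<lambda>n. 2 * h n) \<longlonglongrightarrow> 0" using tendsto_mult_left[OF h0, of 2] by simp
    then have "(\<lambda>n. w n - x) \<longlonglongrightarrow> 0"
      by (rule Lim_null_comparison[rotated]) (use that in auto)
    then show ?thesis by (simp add: LIM_zero_cancel)
  qed
  have "(\<lambda>n. partial_deriv j (partial_deriv i f) (y n)) \<longlonglongrightarrow> partial_deriv j (partial_deriv i f) x"
    by (rule isCont_tendsto_compose[OF c lim[OF y(1)]])
  moreover have "(\<lambda>n. partial_deriv j (partial_deriv i f) (y n)) \<longlonglongrightarrow> partial_deriv i (partial_deriv j f) x"
    unfolding eq by (rule isCont_tendsto_compose[OF c lim[OF z(1)]])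
  ultimately show ?thesis using LIMSEQ_unique by blast
qed

subsection \<open>A smooth bump\<close>

text \<open>
  The family \<open>p(1/t) exp(-1/t)\<close>, extended by \<open>0\<close>, is closed under differentiation, with \<open>p\<close>
  replaced by \<open>x\<^sup>2 (p - p')\<close>. Smoothness of the bump function built from it is then immediate.
\<close>
definition flat_exp :: "real poly \<Rightarrow> real \<Rightarrow> real" where
  "flat_exp p t = (if 0 < t then poly p (1 / t) * exp (- (1 / t)) else 0)"

lemma poly_times_exp_minus_tendsto_0: "((\<lambda>x. poly p x * exp (- x)) \<longlongrightarrow> 0) (at_top::real filter)"
proof -
  have *: "((\<lambda>x. x ^ k * poly p x * exp (- x)) \<longlongrightarrow> 0) (at_top::real filter)" for k
  proof (induction p arbitrary: k)
    case 0
    then show ?case by simp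
  next
    case (pCons a p)
    have "((\<lambda>x. a * (x ^ k / exp x) + x ^ Suc k * poly p x * exp (- x)) \<longlongrightarrow> a * 0 + 0) (at_top::real filter)"
      by (intro tendsto_add tendsto_mult tendsto_const tendsto_power_div_exp_0 pCons.IH)
    then show ?case by (simp add: algebra_simps exp_minus field_simps)
  qed
  from *[of 0] show ?thesis by simp
qed

lemma flat_exp_has_derivative:
  "(flat_exp p has_real_derivative flat_exp ([:0,0,1:] * (p - pderiv p)) t) (at t)"
proof -
  consider "t > 0" | "t < 0" | "t = 0" by linarith
  then show ?thesis
  proof cases
    case 1
    have "((\<lambda>t. poly p (1 / t) * exp (- (1 / t))) has_real_derivative flat_exp ([:0,0,1:] * (p - pderiv p)) t) (at t)"
      using 1 by (auto intro!: derivative_eq_intros simp: flat_exp_def power2_eq_square algebra_simps divide_simps)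
    then show ?thesis
      by (rule has_field_derivative_transform_within_open[where S = "{0<..}"]) (use 1 in \<open>auto simp: flat_exp_def\<close>)
  next
    case 2
    have "((\<lambda>t. 0) has_real_derivative 0) (at t)" by simp
    then have "(flat_exp p has_real_derivative 0) (at t)"
      by (rule has_field_derivative_transform_within_open[where S = "{..<0}"]) (use 2 in \<open>auto simp: flat_exp_def\<close>)
    with 2 show ?thesis by (simp add: flat_exp_def)
  next
    case 3
    have "((\<lambda>y. (flat_exp p y - flat_exp p 0) / (y - 0)) \<longlongrightarrow> 0) (at 0)"
    proof (rule filterlim_split_at_real)
      show "((\<lambda>y. (flat_exp p y - flat_exp p 0) / (y - 0)) \<longlongrightarrow> 0) (at_left 0)"
        by (rule tendsto_eventually) (auto simp: flat_exp_def eventually_at_filter)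
      have "((\<lambda>y. poly ([:0,1:] * p) (inverse y) * exp (- inverse y)) \<longlongrightarrow> 0) (at_right (0::real))"
        by (rule filterlim_compose[OF poly_times_exp_minus_tendsto_0 filterlim_inverse_at_top_right])
      then show "((\<lambda>y. (flat_exp p y - flat_exp p 0) / (y - 0)) \<longlongrightarrow> 0) (at_right 0)"
        by (rule filterlim_cong[THEN iffD1, rotated 3])
           (auto simp: flat_exp_def eventually_at_filter divide_simps)
    qed
    with 3 show ?thesis by (simp add: has_field_derivative_iff flat_exp_def)
  qed
qed

lemma CkR_flat_exp: "CkR k (flat_exp p)"
proof (induction k arbitrary: p)
  case 0
  show ?case using flat_exp_has_derivative[THEN DERIV_isCont]
    by (simp add: continuous_on_eq_continuous_at)
next
  case (Suc k)
  then show ?case using flat_exp_has_derivative by auto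
qed

subsection \<open>Functions of bounded support\<close>

lemma partial_deriv_power:
  assumes "f differentiable (at x)"
  shows "partial_deriv i (\<lambda>x. f x ^ m) x = real m * f x ^ (m - 1) * partial_deriv i f x"
  by (rule partial_deriv_compose[OF assms]) (auto intro!: derivative_eq_intros)

lemma partial_deriv_uminus:
  assumes "f differentiable (at x)"
  shows "partial_deriv i (\<lambda>x. - f x) x = - partial_deriv i f x"
  using partial_deriv_cmult[OF assms, of i "-1"] by simp

lemma partial_deriv_diff:
  assumes "f differentiable (at x)" "g differentiable (at x)"
  shows "partial_deriv i (\<lambda>x. f x - g x) x = partial_deriv i f x - partial_deriv i g x"
  using partial_deriv_add[OF assms(1) differentiable_minus[OF assms(2)]] partial_deriv_uminus[OF assms(2)]
  by (simp add: minus_apply[abs_def])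

lemmas differentiable_rules = differentiable_add differentiable_mult differentiable_power
  differentiable_diff differentiable_minus differentiable_nth differentiable_const

lemmas partial_deriv_rules = partial_deriv_add partial_deriv_mult partial_deriv_power partial_deriv_diff
  partial_deriv_uminus partial_deriv_nth partial_deriv_norm_sq partial_deriv_sum

lemma differentiable_norm_sq: "(\<lambda>x::real^'n::finite. x \<bullet> x) differentiable (at x)"
  using Ck_differentiable[OF Ck_norm_sq[of 1]] by simp

lemma partial_deriv_locally_const:
  assumes "open S" "x \<in> S" "\<And>y. y \<in> S \<Longrightarrow> f y = c"
  shows "partial_deriv i f x = 0"
proof -
  have "(f has_derivative (\<lambda>h. 0)) (at x)"
    by (rule has_derivative_transform_within_open[OF has_derivative_const[of c] assms(1,2)]) (simp add: assms(3))
  from partial_deriv_eqI[OF this] show ?thesis by simp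
qed

lemma open_norm_greater: "open {x::'a::real_normed_vector. r < norm x}"
  by (rule open_Collect_less) (auto intro: continuous_intros)

lemma partial_deriv_vanish_outside:
  assumes "\<And>x. r < norm x \<Longrightarrow> f x = 0" "r < norm x"
  shows "partial_deriv i f x = 0"
  by (rule partial_deriv_locally_const[OF open_norm_greater[of r]]) (use assms in auto)

lemma integrable_bounded_support:
  fixes f :: "'a::euclidean_space \<Rightarrow> real"
  assumes "f \<in> borel_measurable borel" "\<And>x. norm x \<le> r \<Longrightarrow> \<bar>f x\<bar> \<le> B" "\<And>x. r < norm x \<Longrightarrow> f x = 0"
  shows "integrable lborel f"
proof (rule Bochner_Integration.integrable_bound)
  show "integrable lborel (\<lambda>x. indicator (cball 0 r) x *\<^sub>R B)"
    by (rule borel_integrable_compact) auto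
  have "\<bar>f x\<bar> \<le> \<bar>indicator (cball 0 r) x *\<^sub>R B\<bar>" for x
    using assms(2,3)[of x] by (cases "norm x \<le> r") (force simp: indicator_def)+
  then show "AE x in lborel. norm (f x) \<le> norm (indicator (cball 0 r) x *\<^sub>R B)" by simp
qed (use assms in simp)

lemma continuous_bounded_on_cball:
  fixes f :: "'a::euclidean_space \<Rightarrow> real"
  assumes "continuous_on UNIV f"
  obtains B where "0 \<le> B" "\<And>x. norm x \<le> r \<Longrightarrow> \<bar>f x\<bar> \<le> B"
proof -
  have "compact (f ` cball 0 r)"
    by (rule compact_continuous_image) (use assms continuous_on_subset in auto)
  then have "bounded (f ` cball 0 r)" by (rule compact_imp_bounded)
  then obtain B where B: "\<forall>y\<in>f ` cball 0 r. norm y \<le> B" unfolding bounded_iff by blast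
  show ?thesis by (rule that[of "max 0 B"]) (use B in \<open>force simp: le_max_iff_disj\<close>)+
qed

lemma continuous_imp_borel: "continuous_on UNIV f \<Longrightarrow> f \<in> borel_measurable borel"
  by (rule borel_measurable_continuous_onI)

lemma integrable_continuous_support:
  fixes f :: "'a::euclidean_space \<Rightarrow> real"
  assumes "continuous_on UNIV f" "\<And>x. r < norm x \<Longrightarrow> f x = 0"
  shows "integrable lborel f"
proof -
  obtain B where "\<And>x. norm x \<le> r \<Longrightarrow> \<bar>f x\<bar> \<le> B" using continuous_bounded_on_cball[OF assms(1)] by blast
  then show ?thesis
    using integrable_bounded_support[OF continuous_imp_borel[OF assms(1)]] assms(2) by blast
qed

lemma Ck_support_bounded:
  assumes "Ck k f" "\<And>x. r < norm x \<Longrightarrow> f x = 0"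
  obtains B where "0 \<le> B" "\<And>x. \<bar>f x\<bar> \<le> B"
proof -
  obtain B where B: "0 \<le> B" "\<And>x. norm x \<le> r \<Longrightarrow> \<bar>f x\<bar> \<le> B"
    using continuous_bounded_on_cball[OF Ck_imp_continuous[OF assms(1)]] by blast
  have "\<bar>f x\<bar> \<le> B" for x using B assms(2)[of x] by (cases "norm x \<le> r") auto
  with B that show ?thesis by blast
qed

text \<open>
  Used throughout to dominate difference quotients.
\<close>
lemma Ck_support_Lipschitz:
  fixes f :: "real ^ 'n::finite \<Rightarrow> real"
  assumes f: "Ck 1 f" and supp: "\<And>x. r < norm x \<Longrightarrow> f x = 0"
  obtains L where "0 \<le> L" "\<And>x y. \<bar>f x - f y\<bar> \<le> L * norm (x - y)"
proof -
  have "\<exists>B\<ge>0. \<forall>x. \<bar>partial_deriv i f x\<bar> \<le> B" for i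
    using Ck_support_bounded[of 0 "partial_deriv i f" r] f partial_deriv_vanish_outside[of r f, OF supp]
    by (metis One_nat_def Ck_partial)
  then obtain B where B: "\<And>i. B i \<ge> 0" "\<And>i x. \<bar>partial_deriv i f x\<bar> \<le> B i" by metis
  define L where "L = (\<Sum>i\<in>UNIV. B i)"
  have L: "norm (grad f x) \<le> L" for x
  proof -
    have "norm (grad f x) \<le> (\<Sum>i\<in>UNIV. \<bar>grad f x $ i\<bar>)" by (rule norm_le_l1_cart)
    also have "\<dots> \<le> L" unfolding L_def by (rule sum_mono) (simp add: B)
    finally show ?thesis .
  qed
  have "norm (f x - f y) \<le> L * norm (x - y)" for x y
  proof (rule differentiable_bound[of UNIV f "\<lambda>x h. grad f x \<bullet> h"])
    show "(f has_derivative (\<lambda>h. grad f x \<bullet> h)) (at x within UNIV)" for x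
      using has_derivative_grad[OF Ck_differentiable[OF f]] by simp
    show "onorm (\<lambda>h. grad f x \<bullet> h) \<le> L" for x
    proof (rule onorm_bound)
      show "0 \<le> L" unfolding L_def by (simp add: sum_nonneg B)
      show "norm (grad f x \<bullet> h) \<le> L * norm h" for h
        using Cauchy_Schwarz_ineq2[of "grad f x" h] mult_right_mono[OF L[of x] norm_ge_zero[of h]] by simp
    qed
  qed auto
  moreover have "0 \<le> L" unfolding L_def by (simp add: sum_nonneg B)
  ultimately show ?thesis using that by simp
qed

section \<open>Integration by parts\<close>

lemma integral_lborel_translation:
  fixes f :: "'a::euclidean_space \<Rightarrow> real"
  assumes "f \<in> borel_measurable borel"
  shows "(\<integral>x. f (a + x) \<partial>lborel) = (\<integral>x. f x \<partial>lborel)"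
proof -
  have "(\<integral>x. f x \<partial>lborel) = (\<integral>x. f x \<partial>(distr lborel borel ((+) a)))"
    by (simp add: lborel_distr_plus)
  also have "\<dots> = (\<integral>x. f (a + x) \<partial>lborel)"
    by (rule integral_distr) (use assms in auto)
  finally show ?thesis by simp
qed

lemma integrable_lborel_translation:
  fixes f :: "'a::euclidean_space \<Rightarrow> real"
  assumes "integrable lborel f"
  shows "integrable lborel (\<lambda>x. f (a + x))"
proof -
  have "integrable (distr lborel borel ((+) a)) f"
    using assms by (simp add: lborel_distr_plus)
  then show ?thesis by (subst (asm) integrable_distr_eq) (use assms in auto)
qed

text \<open>
  Integrals are invariant under translation, so every difference quotient of \<open>f\<close> has integral \<open>0\<close>;
  the quotients are dominated because \<open>f\<close> is Lipschitz with bounded support.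
\<close>
lemma integral_partial_deriv_eq_0:
  fixes f :: "real ^ 'n::finite \<Rightarrow> real"
  assumes f: "Ck 1 f" and supp: "\<And>x. r < norm x \<Longrightarrow> f x = 0"
  shows "(\<integral>x. partial_deriv i f x \<partial>lborel) = 0"
proof -
  let ?a = "axis i 1 :: real^'n"
  define h where "h n = inverse (real (Suc n))" for n
  have h0: "h \<longlonglongrightarrow> 0" and hp: "h n > 0" "h n \<le> 1" for n
    unfolding h_def by (rule LIMSEQ_inverse_real_of_nat) (auto simp: field_simps)
  obtain L where L: "0 \<le> L" "\<And>x y. \<bar>f x - f y\<bar> \<le> L * norm (x - y)"
    using Ck_support_Lipschitz[OF f supp] by blast
  have fm: "f \<in> borel_measurable borel" using f Ck_imp_continuous continuous_imp_borel by blast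
  have pm: "partial_deriv i f \<in> borel_measurable borel"
    using f by (auto intro: continuous_imp_borel)
  have fi: "integrable lborel f" using f supp Ck_imp_continuous integrable_continuous_support by blast
  define s where "s n x = (f (h n *\<^sub>R ?a + x) - f x) / h n" for n x
  have "(\<lambda>n. \<integral>x. s n x \<partial>lborel) \<longlonglongrightarrow> (\<integral>x. partial_deriv i f x \<partial>lborel)"
  proof (rule integral_dominated_convergence)
    show "integrable lborel (\<lambda>x. indicator (cball (0::real^'n) (r+1)) x *\<^sub>R L)"
      by (rule borel_integrable_compact) auto
    show "AE x in lborel. (\<lambda>n. s n x) \<longlonglongrightarrow> partial_deriv i f x"
    proof (rule AE_I2)
      fix x
      have "((\<lambda>t. f (x + t *\<^sub>R ?a)) has_real_derivative partial_deriv i f x) (at 0)"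
        using has_real_derivative_along[OF Ck_differentiable[OF f], where x = x and t = 0 and v = ?a]
        by (simp add: inner_axis)
      then have "((\<lambda>t. (f (x + t *\<^sub>R ?a) - f x) / t) \<longlongrightarrow> partial_deriv i f x) (at 0)"
        by (simp add: has_field_derivative_iff)
      moreover have "filterlim h (at 0) sequentially"
        using h0 hp by (auto simp: filterlim_at intro!: always_eventually less_imp_neq[symmetric])
      ultimately have "(\<lambda>n. (f (x + h n *\<^sub>R ?a) - f x) / h n) \<longlonglongrightarrow> partial_deriv i f x"
        by (rule filterlim_compose)
      then show "(\<lambda>n. s n x) \<longlonglongrightarrow> partial_deriv i f x" by (simp add: s_def add.commute)
    qed
    show "AE x in lborel. norm (s n x) \<le> indicator (cball 0 (r+1)) x *\<^sub>R L" for n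
    proof (rule AE_I2)
      fix x
      show "norm (s n x) \<le> indicator (cball 0 (r+1)) x *\<^sub>R L"
      proof (cases "norm x \<le> r + 1")
        case True
        have "\<bar>f (h n *\<^sub>R ?a + x) - f x\<bar> \<le> L * h n" using L(2)[of "h n *\<^sub>R ?a + x" x] hp(1)[of n] by simp
        then show ?thesis using True hp(1)[of n] by (simp add: s_def field_simps)
      next
        case False
        have "norm x \<le> norm (h n *\<^sub>R ?a + x) + norm (h n *\<^sub>R ?a)"
          using norm_triangle_ineq4[of "h n *\<^sub>R ?a + x" "h n *\<^sub>R ?a"] by simp
        then have "r < norm (h n *\<^sub>R ?a + x)" using False hp[of n] by simp
        then show ?thesis using supp False by (simp add: s_def)
      qed
    qed
  qed (use fm pm in \<open>auto simp: s_def\<close>)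
  moreover have "(\<integral>x. s n x \<partial>lborel) = 0" for n
    unfolding s_def using integral_lborel_translation[OF fm, of "h n *\<^sub>R ?a"]
    by (simp add: Bochner_Integration.integral_diff integrable_lborel_translation[OF fi] fi)
  ultimately show ?thesis by (simp add: LIMSEQ_const_iff)
qed

lemma divergence_theorem_support:
  fixes G :: "'n::finite \<Rightarrow> real ^ 'n \<Rightarrow> real"
  assumes G: "\<And>i. Ck 1 (G i)" and supp: "\<And>i x. r < norm x \<Longrightarrow> G i x = 0"
  shows "(\<integral>x. (\<Sum>i\<in>UNIV. partial_deriv i (G i) x) \<partial>lborel) = 0"
proof -
  have "integrable lborel (partial_deriv i (G i))" for i
    using G[of i] partial_deriv_vanish_outside[of r "G i", OF supp]
    by (intro integrable_continuous_support[of _ r]) auto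
  then have "(\<integral>x. (\<Sum>i\<in>UNIV. partial_deriv i (G i) x) \<partial>lborel) = (\<Sum>i\<in>UNIV. \<integral>x. partial_deriv i (G i) x \<partial>lborel)"
    by (intro Bochner_Integration.integral_sum) auto
  also have "\<dots> = 0" using integral_partial_deriv_eq_0[OF G supp] by simp
  finally show ?thesis .
qed

section \<open>The Carleman inequality for smooth functions\<close>

lemma differentiable_cdivide: "f differentiable (at x) \<Longrightarrow> (\<lambda>x. f x / c) differentiable (at x)" for f :: "'a::real_normed_vector \<Rightarrow> real"
  unfolding divide_inverse by (intro differentiable_mult differentiable_const)

lemma partial_deriv_cdivide:
  assumes "f differentiable (at x)"
  shows "partial_deriv i (\<lambda>x. f x / c) x = partial_deriv i f x / c"
  using partial_deriv_cmult[OF assms, of i "inverse c"] by (simp add: divide_inverse mult.commute)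

definition euler :: "(real ^ 'n::finite \<Rightarrow> real) \<Rightarrow> real ^ 'n \<Rightarrow> real" where
  "euler f x = (\<Sum>i\<in>UNIV. x $ i * partial_deriv i f x)"

text \<open>
  The generator of the unitary dilations \<open>z \<mapsto> t ^ (n/2) z(t x)\<close> of \<open>L\<^sup>2\<close>; the summand \<open>n/2\<close> makes the
  Euler field antisymmetric.
\<close>
definition skew_euler :: "(real ^ 'n::finite \<Rightarrow> real) \<Rightarrow> real ^ 'n \<Rightarrow> real" where
  "skew_euler f x = euler f x + real CARD('n) / 2 * f x"

text \<open>
  The divergence-form operator \<open>div (q grad f)\<close> with \<open>q = x \<bullet> x\<close>. It is symmetric and invariant under
  dilations, and differs from \<open>q \<Delta> f\<close> by \<open>2 E f\<close>.
\<close>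
definition conformal_laplacian :: "(real ^ 'n::finite \<Rightarrow> real) \<Rightarrow> real ^ 'n \<Rightarrow> real" where
  "conformal_laplacian f x = (\<Sum>i\<in>UNIV. partial_deriv i (\<lambda>x. (x \<bullet> x) * partial_deriv i f x) x)"

lemma norm_sq_sum: "x \<bullet> x = (\<Sum>i\<in>UNIV. (x $ i)\<^sup>2)" for x :: "real^'n::finite"
  by (simp add: inner_vec_def power2_eq_square)

lemma Ck_euler [intro]: "Ck (Suc k) f \<Longrightarrow> Ck k (euler f)"
  unfolding euler_def by (intro Ck_sum Ck_mult Ck_nth Ck_partial)

lemma Ck_skew_euler [intro]: "Ck (Suc k) f \<Longrightarrow> Ck k (skew_euler f)"
  unfolding skew_euler_def by (intro Ck_add Ck_mult Ck_const Ck_euler) (auto dest: Ck_SucD simp del: Ck.simps)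

lemma Ck_conformal_laplacian: "Ck (Suc (Suc k)) f \<Longrightarrow> Ck k (conformal_laplacian f)"
  unfolding conformal_laplacian_def
  by (intro Ck_sum Ck_partial Ck_mult Ck_norm_sq) 

lemma Ck_laplacian: "Ck (Suc (Suc k)) f \<Longrightarrow> Ck k (laplacian f)"
  unfolding laplacian_def
  by (intro Ck_sum Ck_partial)

lemma euler_vanish_outside:
  assumes "\<And>x. r < norm x \<Longrightarrow> f x = 0" "r < norm x"
  shows "euler f x = 0" "skew_euler f x = 0"
  using partial_deriv_vanish_outside[OF assms] assms by (auto simp: euler_def skew_euler_def)

lemma laplacian_vanish_outside:
  assumes "\<And>x. r < norm x \<Longrightarrow> f x = 0" "r < norm x"
  shows "laplacian f x = 0" "conformal_laplacian f x = 0"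
proof -
  have p: "\<And>x i. r < norm x \<Longrightarrow> partial_deriv i f x = 0"
    using partial_deriv_vanish_outside[of r f] assms by blast
  show "laplacian f x = 0" unfolding laplacian_def
    by (intro sum.neutral ballI partial_deriv_vanish_outside[OF p assms(2)])
  show "conformal_laplacian f x = 0" unfolding conformal_laplacian_def
    by (intro sum.neutral ballI partial_deriv_vanish_outside[of r, OF _ assms(2)]) (simp add: p)
qed

lemma integral_divergence_eq:
  fixes G :: "'n::finite \<Rightarrow> real ^ 'n \<Rightarrow> real"
  assumes "\<And>i. Ck 1 (G i)" "\<And>i x. r < norm x \<Longrightarrow> G i x = 0"
    and "\<And>x. (\<Sum>i\<in>UNIV. partial_deriv i (G i) x) = f x"
  shows "(\<integral>x. f x \<partial>lborel) = 0"
  using divergence_theorem_support[of G r] assms by simp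

lemma integral_mult_skew_euler:
  fixes z :: "real ^ 'n::finite \<Rightarrow> real"
  assumes z: "Ck 1 z" and supp: "\<And>x. r < norm x \<Longrightarrow> z x = 0"
  shows "(\<integral>x. z x * skew_euler z x \<partial>lborel) = 0"
proof (rule integral_divergence_eq[of "\<lambda>i x. 1/2 * (x $ i * (z x)\<^sup>2)" r])
  show "Ck 1 (\<lambda>x. 1/2 * (x $ i * (z x)\<^sup>2))" for i
    using z by (intro Ck_mult Ck_const Ck_nth Ck_power)
  have d: "z differentiable (at x)" for x using Ck_differentiable[OF z] by simp
  fix x
  have "partial_deriv i (\<lambda>x. 1/2 * (x $ i * (z x)\<^sup>2)) x = z x * (x $ i * partial_deriv i z x) + 1/2 * (z x)\<^sup>2" for i
    by (simp add: partial_deriv_rules partial_deriv_cdivide d differentiable_rules algebra_simps)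
  then show "(\<Sum>i\<in>UNIV. partial_deriv i (\<lambda>x. 1/2 * (x $ i * (z x)\<^sup>2)) x) = z x * skew_euler z x"
    by (simp add: sum.distrib sum_distrib_left[symmetric] skew_euler_def euler_def algebra_simps power2_eq_square)
qed (use supp in auto)

text \<open>
  A symmetric operator that commutes with a one-parameter unitary group is orthogonal to its generator.
  Concretely the integrand is the divergence of \<open>q (D z) grad z - 1/2 q \<bar>grad z\<bar>\<^sup>2 x\<close> with
  \<open>D = E + n/2\<close>, an identity of Rellich type. It uses the symmetry of the second derivatives.
\<close>
lemma integral_conformal_laplacian_mult_skew_euler:
  fixes z :: "real ^ 'n::finite \<Rightarrow> real"
  assumes z: "Ck 2 z" and supp: "\<And>x. r < norm x \<Longrightarrow> z x = 0"
  shows "(\<integral>x. conformal_laplacian z x * skew_euler z x \<partial>lborel) = 0"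
proof -
  define P where "P i = partial_deriv i z" for i
  define N where "N x = (\<Sum>j\<in>UNIV. (P j x)\<^sup>2)" for x
  have z1: "Ck 1 z" and P: "Ck 1 (P i)" for i
    using z Ck_SucD[of 1 z] Ck_partial[of 1 z i] unfolding P_def by (simp_all add: numeral_2_eq_2)
  have D: "Ck 1 (skew_euler z)" using z Ck_skew_euler[of 1 z] by (simp add: numeral_2_eq_2)
  have N: "Ck 1 N" unfolding N_def by (intro Ck_sum Ck_power P)
  have dz: "z differentiable (at x)" and dP: "P i differentiable (at x)"
    and dD: "skew_euler z differentiable (at x)" and dN: "N differentiable (at x)" for x i
    using Ck_differentiable[OF z1] Ck_differentiable[OF P] Ck_differentiable[OF D] Ck_differentiable[OF N] by auto
  define Q where "Q i j x = partial_deriv i (P j) x" for i j x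
  have sym: "Q i j x = Q j i x" for i j x unfolding Q_def P_def by (rule partial_deriv_commute[OF z])
  define G where "G i x = (x \<bullet> x) * P i x * skew_euler z x - 1/2 * ((x \<bullet> x) * N x * x $ i)" for i x
  show ?thesis
  proof (rule integral_divergence_eq[of G r])
    show "Ck 1 (G i)" for i unfolding G_def
      by (intro Ck_diff Ck_mult Ck_const Ck_norm_sq Ck_nth P D N)
    have P0: "P i x = 0" if "r < norm x" for i x
      unfolding P_def using partial_deriv_vanish_outside[of r z, OF supp] that by simp
    show "G i x = 0" if "r < norm x" for i x
      using P0[OF that] by (simp add: G_def N_def)
    fix x :: "real^'n"
    define q where "q = x \<bullet> x"
    have dDi: "partial_deriv i (skew_euler z) x = P i x + (\<Sum>j\<in>UNIV. x $ j * Q i j x) + real CARD('n) / 2 * P i x" for i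
    proof -
      have "partial_deriv i (skew_euler z) x = partial_deriv i (\<lambda>x. (\<Sum>j\<in>UNIV. x $ j * P j x) + real CARD('n) / 2 * z x) x"
        by (simp add: skew_euler_def[abs_def] euler_def P_def)
      also have "\<dots> = (\<Sum>j\<in>UNIV. (if i = j then 1 else 0) * P j x + x $ j * Q i j x) + real CARD('n) / 2 * P i x"
        by (subst partial_deriv_add)
           (simp_all add: partial_deriv_rules partial_deriv_cdivide differentiable_cdivide dz dP differentiable_rules differentiable_sum Q_def P_def[symmetric])
      also have "(\<Sum>j\<in>UNIV. (if i = j then 1 else 0) * P j x + x $ j * Q i j x) = P i x + (\<Sum>j\<in>UNIV. x $ j * Q i j x)"
        by (simp add: sum.distrib if_distrib[of "\<lambda>c. c * _"] cong: if_cong)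
      finally show ?thesis .
    qed
    have dNi: "partial_deriv i N x = (\<Sum>j\<in>UNIV. 2 * P j x * Q i j x)" for i
      unfolding N_def Q_def by (simp add: partial_deriv_rules dP differentiable_rules)
    have dqP: "partial_deriv i (\<lambda>x. (x \<bullet> x) * partial_deriv i z x) x = 2 * x $ i * P i x + q * Q i i x" for i
      using partial_deriv_mult[OF differentiable_norm_sq dP, where x = x and i = i]
      by (simp add: partial_deriv_norm_sq Q_def P_def q_def)
    have dG: "partial_deriv i (G i) x = (2 * x $ i * P i x + q * Q i i x) * skew_euler z x
        + q * P i x * (P i x + (\<Sum>j\<in>UNIV. x $ j * Q i j x) + real CARD('n) / 2 * P i x)
        - (x $ i)\<^sup>2 * N x - 1/2 * q * (x $ i * (\<Sum>j\<in>UNIV. 2 * P j x * Q i j x)) - 1/2 * q * N x" for i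
      unfolding G_def
      by (simp add: partial_deriv_rules partial_deriv_cdivide differentiable_cdivide dP dD dN differentiable_rules differentiable_norm_sq dDi dNi Q_def[symmetric] q_def[symmetric])
         (simp add: algebra_simps power2_eq_square)
    define T where "T = (\<Sum>i\<in>UNIV. \<Sum>j\<in>UNIV. P i x * x $ j * Q i j x)"
    have T2: "(\<Sum>i\<in>UNIV. x $ i * (\<Sum>j\<in>UNIV. 2 * P j x * Q i j x)) = 2 * T"
    proof -
      have "(\<Sum>i\<in>UNIV. x $ i * (\<Sum>j\<in>UNIV. 2 * P j x * Q i j x)) = (\<Sum>i\<in>UNIV. \<Sum>j\<in>UNIV. 2 * (P j x * x $ i * Q j i x))"
        unfolding sum_distrib_left by (intro sum.cong refl) (simp add: sym mult_ac)
      also have "\<dots> = (\<Sum>j\<in>UNIV. \<Sum>i\<in>UNIV. 2 * (P j x * x $ i * Q j i x))" by (rule sum.swap)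
      finally show ?thesis by (simp add: T_def sum_distrib_left)
    qed
    have "(\<Sum>i\<in>UNIV. partial_deriv i (G i) x) = (\<Sum>i\<in>UNIV. 2 * x $ i * P i x + q * Q i i x) * skew_euler z x
        + q * (\<Sum>i\<in>UNIV. (P i x)\<^sup>2) * (1 + real CARD('n) / 2) + q * T
        - (\<Sum>i\<in>UNIV. (x $ i)\<^sup>2) * N x - 1/2 * q * (\<Sum>i\<in>UNIV. x $ i * (\<Sum>j\<in>UNIV. 2 * P j x * Q i j x))
        - real CARD('n) / 2 * q * N x"
      unfolding dG T_def
      by (simp add: sum.distrib sum_subtractf sum_distrib_left sum_distrib_right algebra_simps power2_eq_square)
    also have "\<dots> = conformal_laplacian z x * skew_euler z x"
      unfolding T2 conformal_laplacian_def dqP N_def[symmetric] norm_sq_sum[symmetric] q_def[symmetric]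
      by (simp add: algebra_simps)
    finally show "(\<Sum>i\<in>UNIV. partial_deriv i (G i) x) = conformal_laplacian z x * skew_euler z x" .
  qed
qed

lemma integral_scale:
  fixes f :: "'a::euclidean_space \<Rightarrow> real"
  assumes "f \<in> borel_measurable borel" "0 < t"
  shows "(\<integral>x. f x \<partial>lborel) = t ^ DIM('a) * (\<integral>x. f (t *\<^sub>R x) \<partial>lborel)"
proof -
  have "(\<integral>x. f x \<partial>lborel) = (\<integral>x. f x \<partial>(density (distr lborel borel (\<lambda>x::'a. 0 + t *\<^sub>R x)) (\<lambda>_. ennreal (\<bar>t\<bar> ^ DIM('a)))))"
    using lborel_affine[of t "0::'a"] assms by simp
  also have "\<dots> = (\<integral>x. t ^ DIM('a) *\<^sub>R f x \<partial>(distr lborel borel (\<lambda>x::'a. 0 + t *\<^sub>R x)))"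
    using assms by (subst integral_density) auto
  also have "\<dots> = (\<integral>x. t ^ DIM('a) *\<^sub>R f (t *\<^sub>R x) \<partial>lborel)"
    using assms by (subst integral_distr) auto
  finally show ?thesis by simp
qed

text \<open>
  By dilation, the integral of \<open>W(x) t ^ n p(t x)\<close> equals that of \<open>W(x / t) p(x)\<close>, which decreases in
  \<open>t \<ge> 1\<close> if \<open>W\<close> increases along rays. The claim is its derivative at \<open>t = 1\<close>. No derivative of
  \<open>W\<close> occurs, so \<open>W\<close> may be merely measurable and bounded.
\<close>
lemma integral_radially_increasing_mult_euler_nonpos:
  fixes W p :: "real ^ 'n::finite \<Rightarrow> real"
  assumes p: "Ck 1 p" and p_nonneg: "\<And>x. 0 \<le> p x"
    and supp: "\<And>x. r < norm x \<Longrightarrow> p x = 0" "\<And>x. norm x < a' \<Longrightarrow> p x = 0"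
    and a: "0 < a" "a < a'"
    and W: "W \<in> borel_measurable borel" "\<And>x. norm x \<le> r \<Longrightarrow> \<bar>W x\<bar> \<le> B"
    and mono: "\<And>x t. a < norm x \<Longrightarrow> 1 \<le> t \<Longrightarrow> W x \<le> W (t *\<^sub>R x)"
  shows "(\<integral>x. W x * (euler p x + real CARD('n) * p x) \<partial>lborel) \<le> 0"
proof -
  let ?n = "CARD('n)"
  define h where "h k = inverse (real (Suc k))" for k
  define t where "t k = 1 + h k" for k
  have h0: "h \<longlonglongrightarrow> 0" and hp: "h k > 0" "h k \<le> 1" for k
    unfolding h_def by (rule LIMSEQ_inverse_real_of_nat) (auto simp: field_simps)
  have t: "1 < t k" "t k \<le> 2" for k using hp[of k] by (auto simp: t_def)
  obtain L where L: "0 \<le> L" "\<And>x y. \<bar>p x - p y\<bar> \<le> L * norm (x - y)"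
    using Ck_support_Lipschitz[OF p supp(1)] by blast
  obtain P where P: "0 \<le> P" "\<And>x. \<bar>p x\<bar> \<le> P" using Ck_support_bounded[OF p supp(1)] by blast
  have pc: "continuous_on UNIV p" using p Ck_imp_continuous by blast
  note pm[measurable] = continuous_imp_borel[OF pc]
  note W(1)[measurable]
  have em[measurable]: "euler p \<in> borel_measurable borel"
    using p Ck_euler[of 0 p] by (auto intro!: continuous_imp_borel)
  define s where "s k x = (t k ^ ?n * p (t k *\<^sub>R x) - p x) / h k" for k x
  define K where "K = ?n * 2 ^ ?n * P + L * \<bar>r\<bar>"
  have pow: "t k ^ ?n - 1 \<le> h k * (?n * 2 ^ ?n)" for k
  proof -
    have "t k ^ ?n - 1 = (t k - 1) * (\<Sum>i<?n. t k ^ i)"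
      using power_diff_1_eq[of "t k" ?n] by simp
    also have "\<dots> \<le> (t k - 1) * (\<Sum>i<?n. 2 ^ ?n)"
    proof (intro mult_left_mono sum_mono)
      fix i assume "i \<in> {..<?n}"
      then have "t k ^ i \<le> 2 ^ i" "(2::real) ^ i \<le> 2 ^ ?n" using t[of k] by (auto intro!: power_mono power_increasing)
      then show "t k ^ i \<le> 2 ^ ?n" by linarith
    qed (use t[of k] in auto)
    finally show ?thesis by (simp add: t_def)
  qed
  have sb: "\<bar>s k x\<bar> \<le> K" if "norm x \<le> r" for k x
  proof -
    have "\<bar>t k ^ ?n * p (t k *\<^sub>R x) - p x\<bar> = \<bar>(t k ^ ?n - 1) * p (t k *\<^sub>R x) + (p (t k *\<^sub>R x) - p x)\<bar>"
      by (simp add: algebra_simps)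
    also have "\<dots> \<le> \<bar>(t k ^ ?n - 1) * p (t k *\<^sub>R x)\<bar> + \<bar>p (t k *\<^sub>R x) - p x\<bar>" by (rule abs_triangle_ineq)
    also have "\<bar>(t k ^ ?n - 1) * p (t k *\<^sub>R x)\<bar> \<le> h k * (?n * 2 ^ ?n) * P"
    proof -
      have "0 \<le> t k ^ ?n - 1" using t[of k] by simp
      then show ?thesis unfolding abs_mult using pow[of k] P
        by (intro mult_mono) auto
    qed
    also have "\<bar>p (t k *\<^sub>R x) - p x\<bar> \<le> L * (h k * \<bar>r\<bar>)"
    proof -
      have "t k *\<^sub>R x - x = h k *\<^sub>R x" by (simp add: t_def algebra_simps)
      then have "\<bar>p (t k *\<^sub>R x) - p x\<bar> \<le> L * (h k * norm x)" using L(2)[of "t k *\<^sub>R x" x] hp[of k] by simp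
      also have "\<dots> \<le> L * (h k * \<bar>r\<bar>)" using that L(1) hp[of k] by (intro mult_left_mono) auto
      finally show ?thesis .
    qed
    finally have "\<bar>t k ^ ?n * p (t k *\<^sub>R x) - p x\<bar> \<le> h k * K" by (simp add: K_def algebra_simps)
    then show ?thesis using hp[of k] by (simp add: s_def field_simps)
  qed
  have s0: "s k x = 0" if "r < norm x" for k x
  proof -
    have "norm x \<le> norm (t k *\<^sub>R x)" using t[of k] mult_right_mono[of 1 "t k" "norm x"] by simp
    with that supp(1) show ?thesis by (simp add: s_def)
  qed
  have B0: "\<bar>W x\<bar> \<le> \<bar>B\<bar>" if "norm x \<le> r" for x using W(2)[OF that] by simp
  have lim: "(\<lambda>k. \<integral>x. W x * s k x \<partial>lborel) \<longlonglongrightarrow> (\<integral>x. W x * (euler p x + real ?n * p x) \<partial>lborel)"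
  proof (rule integral_dominated_convergence)
    show "integrable lborel (\<lambda>x. indicator (cball (0::real^'n) r) x *\<^sub>R (\<bar>B\<bar> * K))"
      by (rule borel_integrable_compact) auto
    show "AE x in lborel. norm (W x * s k x) \<le> indicator (cball 0 r) x *\<^sub>R (\<bar>B\<bar> * K)" for k
    proof (rule AE_I2)
      fix x show "norm (W x * s k x) \<le> indicator (cball 0 r) x *\<^sub>R (\<bar>B\<bar> * K)"
      proof (cases "norm x \<le> r")
        case True
        then have "\<bar>W x\<bar> * \<bar>s k x\<bar> \<le> \<bar>B\<bar> * K" using sb[OF True] B0[OF True] by (intro mult_mono) auto
        with True show ?thesis by (simp add: abs_mult)
      qed (simp add: s0)
    qed
    show "AE x in lborel. (\<lambda>k. W x * s k x) \<longlonglongrightarrow> W x * (euler p x + real ?n * p x)"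
    proof (rule AE_I2, rule tendsto_mult_left)
      fix x
      have "((\<lambda>u. p (0 + u *\<^sub>R x)) has_real_derivative euler p x) (at 1)"
        using has_real_derivative_along[OF Ck_differentiable[OF p], where x = 0 and t = 1 and v = x]
        by (simp add: euler_def inner_vec_def mult.commute)
      then have "((\<lambda>u. u ^ ?n * p (u *\<^sub>R x)) has_real_derivative euler p x + real ?n * p x) (at 1)"
        by (auto intro!: derivative_eq_intros)
      then have "((\<lambda>h. ((1+h) ^ ?n * p ((1+h) *\<^sub>R x) - p x) / h) \<longlongrightarrow> euler p x + real ?n * p x) (at 0)"
        by (simp add: DERIV_def)
      moreover have "filterlim h (at 0) sequentially"
        using h0 hp by (auto simp: filterlim_at intro!: always_eventually less_imp_neq[symmetric])
      ultimately have "(\<lambda>k. ((1+h k) ^ ?n * p ((1+h k) *\<^sub>R x) - p x) / h k) \<longlonglongrightarrow> euler p x + real ?n * p x"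
        by (rule filterlim_compose)
      then show "(\<lambda>k. s k x) \<longlonglongrightarrow> euler p x + real ?n * p x" by (simp add: s_def t_def)
    qed
  qed (auto simp: s_def)
  have "eventually (\<lambda>k. t k < a' / a) sequentially"
  proof -
    have "t \<longlonglongrightarrow> 1 + 0" unfolding t_def by (intro tendsto_intros h0)
    then show ?thesis by (rule order_tendstoD(2)) (use a in simp)
  qed
  then have "eventually (\<lambda>k. (\<integral>x. W x * s k x \<partial>lborel) \<le> 0) sequentially"
  proof (rule eventually_mono)
    fix k assume tk: "t k < a' / a"
    have i1: "integrable lborel (\<lambda>x. W x * p x)"
      by (rule integrable_bounded_support[of _ r "\<bar>B\<bar> * P"])
         (use P B0 supp in \<open>auto simp: abs_mult intro!: mult_mono\<close>)
    have i2: "integrable lborel (\<lambda>x. W x * p (t k *\<^sub>R x))"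
    proof (rule integrable_bounded_support[of _ r "\<bar>B\<bar> * P"])
      show "W x * p (t k *\<^sub>R x) = 0" if "r < norm x" for x
      proof -
        have "norm x \<le> norm (t k *\<^sub>R x)" using t[of k] mult_right_mono[of 1 "t k" "norm x"] by simp
        with that supp(1) show ?thesis by simp
      qed
    qed (use P B0 in \<open>auto simp: abs_mult intro!: mult_mono\<close>)
    have sc: "W (inverse (t k) *\<^sub>R x) * p x \<le> W x * p x" for x
    proof (cases "norm x < a'")
      case False
      have "a < norm (inverse (t k) *\<^sub>R x)"
      proof -
        have "a * t k < a'" using tk a by (simp add: field_simps)
        then have "a * t k < norm x" using False by simp
        then show ?thesis using t[of k] by (simp add: field_simps)
      qed
      from mono[OF this, of "t k"] t[of k] have "W (inverse (t k) *\<^sub>R x) \<le> W x" by simp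
      then show ?thesis by (rule mult_right_mono[OF _ p_nonneg])
    qed (simp add: supp)
    have i3: "integrable lborel (\<lambda>x. W (inverse (t k) *\<^sub>R x) * p x)"
    proof (rule integrable_bounded_support[of _ r "\<bar>B\<bar> * P"])
      show "\<bar>W (inverse (t k) *\<^sub>R x) * p x\<bar> \<le> \<bar>B\<bar> * P" if "norm x \<le> r" for x
      proof -
        have "norm (inverse (t k) *\<^sub>R x) \<le> norm x" using t[of k] mult_left_mono[of 1 "t k" "norm x"] by (simp add: field_simps)
        then show ?thesis unfolding abs_mult using that B0 P by (intro mult_mono) auto
      qed
    qed (use supp in auto)
    have "t k ^ ?n * (\<integral>x. W x * p (t k *\<^sub>R x) \<partial>lborel) = (\<integral>x. W (inverse (t k) *\<^sub>R x) * p x \<partial>lborel)"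
      using integral_scale[of "\<lambda>x. W (inverse (t k) *\<^sub>R x) * p x" "t k"] t[of k] by simp
    also have "\<dots> \<le> (\<integral>x. W x * p x \<partial>lborel)" by (intro integral_mono i3 i1 sc)
    finally have "t k ^ ?n * (\<integral>x. W x * p (t k *\<^sub>R x) \<partial>lborel) - (\<integral>x. W x * p x \<partial>lborel) \<le> 0" by simp
    moreover have "(\<integral>x. W x * s k x \<partial>lborel) = (t k ^ ?n * (\<integral>x. W x * p (t k *\<^sub>R x) \<partial>lborel) - (\<integral>x. W x * p x \<partial>lborel)) / h k"
    proof -
      have "W x * s k x = (t k ^ ?n * (W x * p (t k *\<^sub>R x)) - W x * p x) / h k" for x
        by (simp add: s_def algebra_simps)
      then show ?thesis using i1 i2 by simp
    qed
    ultimately show "(\<integral>x. W x * s k x \<partial>lborel) \<le> 0" using hp[of k] by (simp add: divide_nonpos_pos)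
  qed
  then show ?thesis using tendsto_upperbound[OF lim] by simp
qed

lemma integrable_bounded_mult:
  fixes Y g :: "'a::euclidean_space \<Rightarrow> real"
  assumes "Y \<in> borel_measurable borel" "\<And>x. norm x \<le> r \<Longrightarrow> \<bar>Y x\<bar> \<le> B"
    and "continuous_on UNIV g" "\<And>x. r < norm x \<Longrightarrow> g x = 0"
  shows "integrable lborel (\<lambda>x. Y x * g x)"
proof -
  obtain C where C: "0 \<le> C" "\<And>x. norm x \<le> r \<Longrightarrow> \<bar>g x\<bar> \<le> C"
    using continuous_bounded_on_cball[OF assms(3)] by blast
  have [measurable]: "g \<in> borel_measurable borel" using continuous_imp_borel assms(3) .
  note assms(1)[measurable]
  show ?thesis
  proof (rule integrable_bounded_support[of _ r "\<bar>B\<bar> * C"])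
    show "\<bar>Y x * g x\<bar> \<le> \<bar>B\<bar> * C" if "norm x \<le> r" for x
      unfolding abs_mult using C assms(2)[OF that] that by (intro mult_mono) auto
  qed (use assms in auto)
qed

lemma Ck2_D: "Ck 2 f \<Longrightarrow> Ck 1 f" "Ck 2 f \<Longrightarrow> Ck 0 f" "Ck 2 f \<Longrightarrow> Ck 1 (partial_deriv i f)"
  using Ck_mono[of 2 f 1] Ck_mono[of 2 f 0] Ck_partial[of 1 f i] by (simp_all add: numeral_2_eq_2)

lemma skew_euler_power_mult:
  fixes w :: "real ^ 'n::finite \<Rightarrow> real"
  assumes w: "Ck 1 w"
  shows "skew_euler (\<lambda>x. (x \<bullet> x) ^ (k+1) * w x) x
    = (x \<bullet> x) ^ (k+1) * (euler w x + (2 * real (k+1) + real CARD('n) / 2) * w x)"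
proof -
  let ?z = "\<lambda>x. (x \<bullet> x) ^ (k+1) * w x"
  have dw: "w differentiable (at x)" for x using Ck_differentiable[OF w] by simp
  have "partial_deriv i ?z x = 2 * real (k+1) * (x \<bullet> x) ^ k * x $ i * w x + (x \<bullet> x) ^ (k+1) * partial_deriv i w x" for i
    by (simp add: partial_deriv_rules dw differentiable_rules differentiable_norm_sq algebra_simps del: power_Suc)
  then have "euler ?z x = (\<Sum>i\<in>UNIV. (x $ i)\<^sup>2 * (2 * real (k+1) * (x \<bullet> x) ^ k * w x) + (x \<bullet> x) ^ (k+1) * (x $ i * partial_deriv i w x))"
    unfolding euler_def by (intro sum.cong refl) (simp add: algebra_simps power2_eq_square)
  also have "\<dots> = (x \<bullet> x) * (2 * real (k+1) * (x \<bullet> x) ^ k * w x) + (x \<bullet> x) ^ (k+1) * euler w x"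
    by (simp add: sum.distrib sum_distrib_left[symmetric] sum_distrib_right[symmetric] norm_sq_sum[symmetric] euler_def)
  finally show ?thesis by (simp add: skew_euler_def algebra_simps)
qed

text \<open>
  Integrating the divergence of \<open>q ^ (2k+1) w\<^sup>2 x\<close> expresses the left-hand side as the integral
  of \<open>q ^ k w\<close> times \<open>D z\<close>, where \<open>z = q ^ (k+1) w\<close>. As \<open>q \<ge> 1\<close> on the support, Young's inequality
  absorbs half of the left-hand side. The price of one factor \<open>q\<close> compared with \<open>z\<^sup>2\<close> is harmless.
\<close>
lemma hardy_skew_euler:
  fixes w :: "real ^ 'n::finite \<Rightarrow> real"
  assumes w: "Ck 1 w" and supp: "\<And>x. r < norm x \<Longrightarrow> w x = 0" "\<And>x. norm x < 1 \<Longrightarrow> w x = 0"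
  shows "(\<integral>x. (x \<bullet> x) ^ (2*k+1) * (w x)\<^sup>2 \<partial>lborel)
    \<le> (\<integral>x. (skew_euler (\<lambda>x. (x \<bullet> x) ^ (k+1) * w x) x)\<^sup>2 \<partial>lborel)"
proof -
  define z where "z x = (x \<bullet> x) ^ (k+1) * w x" for x
  have dw: "w differentiable (at x)" for x using Ck_differentiable[OF w] by simp
  have z: "Ck 1 z" unfolding z_def by (intro Ck_mult Ck_power Ck_norm_sq w)
  have wc: "continuous_on UNIV w" using Ck_imp_continuous w .
  have Dc: "continuous_on UNIV (skew_euler z)" using Ck_skew_euler[of 0 z] z by simp
  have zs: "z x = 0" if "r < norm x" for x using supp(1)[OF that] by (simp add: z_def)
  note Ds = euler_vanish_outside(2)[of r z, OF zs]
  have Dz: "skew_euler z x = (x \<bullet> x) ^ (k+1) * (euler w x + (2 * real (k+1) + real CARD('n) / 2) * w x)" for x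
    unfolding z_def[abs_def] by (rule skew_euler_power_mult[OF w])
  have "(\<integral>x. (2 * (x \<bullet> x) ^ k * w x * skew_euler z x - 2 * (x \<bullet> x) ^ (2*k+1) * (w x)\<^sup>2) \<partial>lborel) = 0"
  proof (rule integral_divergence_eq[of "\<lambda>i x. (x \<bullet> x) ^ (2*k+1) * (w x)\<^sup>2 * x $ i" r])
    show "Ck 1 (\<lambda>x. (x \<bullet> x) ^ (2*k+1) * (w x)\<^sup>2 * x $ i)" for i
      by (intro Ck_mult Ck_power Ck_norm_sq w Ck_nth)
    fix x :: "real^'n"
    have "partial_deriv i (\<lambda>x. (x \<bullet> x) ^ (2*k+1) * (w x)\<^sup>2 * x $ i) x
      = (2 * real (2*k+1) * (x \<bullet> x) ^ (2*k) * (w x)\<^sup>2) * (x $ i)\<^sup>2 + 2 * (x \<bullet> x) ^ (2*k+1) * w x * (x $ i * partial_deriv i w x)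
        + (x \<bullet> x) ^ (2*k+1) * (w x)\<^sup>2" for i
      by (simp add: partial_deriv_rules dw differentiable_rules differentiable_norm_sq del: power_Suc)
         (simp add: algebra_simps power2_eq_square)
    then have "(\<Sum>i\<in>UNIV. partial_deriv i (\<lambda>x. (x \<bullet> x) ^ (2*k+1) * (w x)\<^sup>2 * x $ i) x)
      = (2 * real (2*k+1) * (x \<bullet> x) ^ (2*k) * (w x)\<^sup>2) * (x \<bullet> x) + 2 * (x \<bullet> x) ^ (2*k+1) * w x * euler w x
        + real CARD('n) * ((x \<bullet> x) ^ (2*k+1) * (w x)\<^sup>2)"
      by (simp add: sum.distrib sum_distrib_left[symmetric] norm_sq_sum[symmetric] euler_def)
    also have "\<dots> = 2 * (x \<bullet> x) ^ k * w x * skew_euler z x - 2 * (x \<bullet> x) ^ (2*k+1) * (w x)\<^sup>2"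
    proof -
      define q Q e where "q = x \<bullet> x" and "Q = q ^ k" and "e = euler w x"
      have p: "q ^ (2*k+1) = Q * Q * q" "q ^ (2*k) = Q * Q" "q ^ (k+1) = Q * q"
        unfolding Q_def by (simp_all add: power_add[symmetric] mult_2)
      show ?thesis
        unfolding Dz q_def[symmetric] e_def[symmetric] p Q_def[symmetric]
        by (simp add: algebra_simps power2_eq_square)
    qed
    finally show "(\<Sum>i\<in>UNIV. partial_deriv i (\<lambda>x. (x \<bullet> x) ^ (2*k+1) * (w x)\<^sup>2 * x $ i) x)
      = 2 * (x \<bullet> x) ^ k * w x * skew_euler z x - 2 * (x \<bullet> x) ^ (2*k+1) * (w x)\<^sup>2" .
  qed (use supp in auto)
  moreover have i1: "integrable lborel (\<lambda>x. (x \<bullet> x) ^ k * w x * skew_euler z x)"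
    by (rule integrable_continuous_support[of _ r]) (use supp in \<open>auto intro!: continuous_intros wc Dc\<close>)
  moreover have i2: "integrable lborel (\<lambda>x. (x \<bullet> x) ^ (2*k+1) * (w x)\<^sup>2)"
    by (rule integrable_continuous_support[of _ r]) (use supp in \<open>auto intro!: continuous_intros wc\<close>)
  ultimately have eq: "(\<integral>x. (x \<bullet> x) ^ (2*k+1) * (w x)\<^sup>2 \<partial>lborel) = (\<integral>x. (x \<bullet> x) ^ k * w x * skew_euler z x \<partial>lborel)"
    by (simp add: mult.assoc)
  have i3: "integrable lborel (\<lambda>x. (skew_euler z x)\<^sup>2)"
    by (rule integrable_continuous_support[of _ r]) (use Ds in \<open>auto intro!: continuous_intros Dc\<close>)
  have "(\<integral>x. (x \<bullet> x) ^ k * w x * skew_euler z x \<partial>lborel)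
    \<le> (\<integral>x. 1/2 * ((x \<bullet> x) ^ (2*k+1) * (w x)\<^sup>2) + 1/2 * (skew_euler z x)\<^sup>2 \<partial>lborel)"
  proof (rule integral_mono)
    fix x
    let ?a = "(x \<bullet> x) ^ k * w x"
    have "?a\<^sup>2 \<le> (x \<bullet> x) ^ (2*k+1) * (w x)\<^sup>2"
    proof (cases "norm x < 1")
      case False
      then have "1 \<le> x \<bullet> x" using one_le_power[of "norm x" 2] by (simp add: dot_square_norm)
      then have "(x \<bullet> x) ^ (2*k) \<le> (x \<bullet> x) ^ (2*k+1)" by (intro power_increasing) auto
      then show ?thesis by (simp add: power_mult_distrib power_mult[symmetric] mult.commute[of k] mult_right_mono)
    qed (simp add: supp)
    moreover have "?a * skew_euler z x \<le> 1/2 * ?a\<^sup>2 + 1/2 * (skew_euler z x)\<^sup>2"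
      using sum_squares_bound[of ?a "skew_euler z x"] by simp
    ultimately show "?a * skew_euler z x \<le> 1/2 * ((x \<bullet> x) ^ (2*k+1) * (w x)\<^sup>2) + 1/2 * (skew_euler z x)\<^sup>2"
      by linarith
  qed (use i1 i2 i3 in auto)
  with eq i2 i3 show ?thesis unfolding z_def[abs_def] by simp
qed

text \<open>
  With \<open>z = q ^ m w\<close>, \<open>m = k + 1\<close>, one has \<open>q ^ m (q \<Delta> w + q Y w) = A - b D z\<close>, where \<open>A\<close> is
  \<open>div (q grad z) + c z + q Y z\<close> and \<open>b = 4 m + 2 = 4 k + 6\<close>. Squaring, \<open>A\<^sup>2\<close> is dropped; the cross
  term of \<open>D z\<close> with the first two summands of \<open>A\<close> integrates to \<open>0\<close>, with the third
  to something nonpositive. The Hardy inequality bounds what is left from below.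
\<close>
theorem carleman_estimate:
  fixes w Y :: "real ^ 'n::finite \<Rightarrow> real"
  assumes w: "Ck 2 w"
    and supp: "\<And>x. r < norm x \<Longrightarrow> w x = 0" "\<And>x. norm x < a' \<Longrightarrow> w x = 0"
    and a: "1 \<le> a" "a < a'"
    and Y: "Y \<in> borel_measurable borel" "\<And>x. norm x \<le> r \<Longrightarrow> \<bar>Y x\<bar> \<le> B"
    and mono: "\<And>x t. a < norm x \<Longrightarrow> 1 \<le> t \<Longrightarrow> Y x \<le> t\<^sup>2 * Y (t *\<^sub>R x)"
  shows "(4 * real k + 6)\<^sup>2 * (\<integral>x. (x \<bullet> x) ^ (2*k+1) * (w x)\<^sup>2 \<partial>lborel)
    \<le> (\<integral>x. (x \<bullet> x) ^ (2*k+4) * (laplacian w x + Y x * w x)\<^sup>2 \<partial>lborel)"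
proof -
  define z where "z x = (x \<bullet> x) ^ (k+1) * w x" for x
  define n where "n = real CARD('n)"
  define b where "b = 4 * real k + 6"
  \<comment> \<open>The constant left over when the zeroth-order terms of the conjugation are collected; as \<open>z\<close> is orthogonal
      to \<open>D z\<close>, only its existence matters.\<close>
  define c where "c = 4 * real (k+1) ^ 2 + 4 * real (k+1) + n"
  define S where "S = conformal_laplacian z"
  define D where "D = skew_euler z"
  have dw: "w differentiable (at x)" and dpw: "partial_deriv i w differentiable (at x)" for x i
    using Ck_differentiable[OF Ck2_D(1)[OF w]] Ck_differentiable[OF Ck2_D(3)[OF w]] by auto
  have z: "Ck 2 z" unfolding z_def by (intro Ck_mult Ck_power Ck_norm_sq w)
  note z1 = Ck2_D(1)[OF z]
  have zs: "z x = 0" if "r < norm x" for x using supp(1)[OF that] by (simp add: z_def)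
  have zs': "z x = 0" if "norm x < a'" for x using supp(2)[OF that] by (simp add: z_def)
  have wc: "continuous_on UNIV w" and zc: "continuous_on UNIV z"
    using Ck2_D(2)[OF w] Ck2_D(2)[OF z] by auto
  have Dc: "continuous_on UNIV D" using Ck_skew_euler[of 0 z] z1 by (simp add: D_def)
  have Sc: "continuous_on UNIV S" using Ck_conformal_laplacian[of 0 z] z by (simp add: S_def numeral_2_eq_2)
  have Lc: "continuous_on UNIV (laplacian w)" using Ck_laplacian[of 0 w] w by (simp add: numeral_2_eq_2)
  note Ds = euler_vanish_outside(2)[of r z, OF zs, folded D_def]
  note Ss = laplacian_vanish_outside(2)[of r z, OF zs, folded S_def]
  note Ls = laplacian_vanish_outside(1)[of r w, OF supp(1)]
  have dz: "partial_deriv i z = (\<lambda>x. 2 * real (k+1) * ((x \<bullet> x) ^ k * (x $ i * w x)) + (x \<bullet> x) ^ (k+1) * partial_deriv i w x)" for i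
    unfolding z_def[abs_def]
    by (rule ext) (simp add: partial_deriv_rules dw differentiable_rules differentiable_norm_sq algebra_simps del: power_Suc)
  have Dz: "D x = (x \<bullet> x) ^ (k+1) * (euler w x + (2 * real (k+1) + n / 2) * w x)" for x
    unfolding D_def z_def[abs_def] n_def by (rule skew_euler_power_mult[OF Ck2_D(1)[OF w]])
  have Sz: "S x = (x \<bullet> x) ^ (k+2) * laplacian w x + b * ((x \<bullet> x) ^ (k+1) * euler w x)
      + (4 * real (k+1) ^ 2 + 2 * real (k+1) * n) * ((x \<bullet> x) ^ (k+1) * w x)" for x
  proof -
    have "(\<lambda>x. (x \<bullet> x) * partial_deriv i z x) = (\<lambda>x. 2 * real (k+1) * ((x \<bullet> x) ^ (k+1) * (x $ i * w x)) + (x \<bullet> x) ^ (k+2) * partial_deriv i w x)" for i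
      by (simp add: dz algebra_simps)
    then have "partial_deriv i (\<lambda>x. (x \<bullet> x) * partial_deriv i z x) x
      = 2 * real (k+1) * (2 * real (k+1) * (x \<bullet> x) ^ k * w x * (x $ i)\<^sup>2 + (x \<bullet> x) ^ (k+1) * (w x + x $ i * partial_deriv i w x))
        + (2 * real (k+2) * (x \<bullet> x) ^ (k+1) * (x $ i * partial_deriv i w x) + (x \<bullet> x) ^ (k+2) * partial_deriv i (partial_deriv i w) x)" for i
      by (simp add: partial_deriv_rules dw dpw differentiable_rules differentiable_norm_sq del: power_Suc)
         (simp add: algebra_simps power2_eq_square)
    then have "S x = (\<Sum>i\<in>UNIV. 
        4 * real (k+1)^2 * (x \<bullet> x) ^ k * w x * (x $ i)\<^sup>2 + 2 * real (k+1) * (x \<bullet> x) ^ (k+1) * w x 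
        + b * (x \<bullet> x) ^ (k+1) * (x $ i * partial_deriv i w x) 
        + (x \<bullet> x) ^ (k+2) * partial_deriv i (partial_deriv i w) x)"
      unfolding S_def conformal_laplacian_def
      by (intro sum.cong refl) (simp add: algebra_simps power2_eq_square b_def)
    also have "\<dots> = 4 * real (k+1)^2 * (x \<bullet> x) ^ k * w x * (x \<bullet> x) + n * (2 * real (k+1) * (x \<bullet> x) ^ (k+1) * w x)
        + b * (x \<bullet> x) ^ (k+1) * euler w x + (x \<bullet> x) ^ (k+2) * laplacian w x"
      by (simp add: sum.distrib sum_distrib_left[symmetric] norm_sq_sum[symmetric] euler_def laplacian_def n_def)
    finally show ?thesis by (simp add: algebra_simps)
  qed
  define F where "F x = (x \<bullet> x) ^ (k+2) * (laplacian w x + Y x * w x)" for x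
  have F: "F x = S x + c * z x + (x \<bullet> x) * Y x * z x - b * D x" for x
  proof -
    define q Q e l where "q = x \<bullet> x" and "Q = q ^ k" and "e = euler w x" and "l = laplacian w x"
    have p: "q ^ (k+2) = Q * q * q" "q ^ (k+1) = Q * q"
      unfolding Q_def by (simp_all add: power_add power2_eq_square)
    show ?thesis
      unfolding F_def Sz Dz z_def c_def b_def q_def[symmetric] e_def[symmetric] l_def[symmetric] p Q_def[symmetric]
      by (simp add: algebra_simps power2_eq_square)
  qed
  have F2: "(x \<bullet> x) ^ (2*k+4) * (laplacian w x + Y x * w x)\<^sup>2 = (F x)\<^sup>2" for x
  proof -
    have e: "(k + 2) * 2 = 2 * k + 4" by simp
    show ?thesis unfolding F_def power_mult_distrib power_mult[symmetric] e ..
  qed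
  have euler_sq: "euler (\<lambda>x. (z x)\<^sup>2) x = 2 * z x * euler z x" for x
  proof -
    have "partial_deriv i (\<lambda>x. (z x)\<^sup>2) x = 2 * z x * partial_deriv i z x" for i
      using Ck_differentiable[OF z1] by (simp add: partial_deriv_power)
    then show ?thesis by (simp add: euler_def sum_distrib_left algebra_simps)
  qed
  have "(\<integral>x. ((x \<bullet> x) * Y x) * (euler (\<lambda>x. (z x)\<^sup>2) x + real CARD('n) * (z x)\<^sup>2) \<partial>lborel) \<le> 0"
  proof (rule integral_radially_increasing_mult_euler_nonpos[of _ r a' a _ "r\<^sup>2 * B"])
    show "Ck 1 (\<lambda>x. (z x)\<^sup>2)" by (intro Ck_power z1)
    show "(\<lambda>x. x \<bullet> x * Y x) \<in> borel_measurable borel" using Y(1) by measurable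
    show "\<bar>x \<bullet> x * Y x\<bar> \<le> r\<^sup>2 * B" if "norm x \<le> r" for x
      unfolding abs_mult using that Y(2)[OF that] by (intro mult_mono) (auto simp: dot_square_norm intro!: power_mono)
    show "x \<bullet> x * Y x \<le> (t *\<^sub>R x) \<bullet> (t *\<^sub>R x) * Y (t *\<^sub>R x)" if "a < norm x" "1 \<le> t" for x t
      using mult_left_mono[OF mono[OF that], of "x \<bullet> x"] by (simp add: power2_eq_square algebra_simps)
  qed (use a zs zs' in auto)
  moreover have "((x \<bullet> x) * Y x) * (euler (\<lambda>x. (z x)\<^sup>2) x + real CARD('n) * (z x)\<^sup>2) = 2 * ((x \<bullet> x) * Y x * z x * D x)" for x
    unfolding euler_sq D_def skew_euler_def by (simp add: algebra_simps power2_eq_square)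
  ultimately have YD: "(\<integral>x. (x \<bullet> x) * Y x * z x * D x \<partial>lborel) \<le> 0" by simp
  have SD: "(\<integral>x. S x * D x \<partial>lborel) = 0"
    unfolding S_def D_def by (rule integral_conformal_laplacian_mult_skew_euler[OF z zs])
  have zD: "(\<integral>x. z x * D x \<partial>lborel) = 0"
    unfolding D_def by (rule integral_mult_skew_euler[OF z1 zs])
  have iSD: "integrable lborel (\<lambda>x. S x * D x)" and izD: "integrable lborel (\<lambda>x. z x * D x)"
    and iD: "integrable lborel (\<lambda>x. (D x)\<^sup>2)"
    by (rule integrable_continuous_support[of _ r]; use Ds in \<open>auto intro!: continuous_intros Sc Dc zc\<close>)+
  have iYD: "integrable lborel (\<lambda>x. (x \<bullet> x) * Y x * z x * D x)"
  proof -
    have "integrable lborel (\<lambda>x. Y x * ((x \<bullet> x) * z x * D x))"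
      by (rule integrable_bounded_mult[OF Y]) (use zs in \<open>auto intro!: continuous_intros Dc zc\<close>)
    then show ?thesis by (simp add: mult_ac)
  qed
  have iF: "integrable lborel (\<lambda>x. (F x)\<^sup>2)"
  proof -
    have Y2: "(\<lambda>x. (Y x)\<^sup>2) \<in> borel_measurable borel" "\<And>x. norm x \<le> r \<Longrightarrow> \<bar>(Y x)\<^sup>2\<bar> \<le> B\<^sup>2"
      using Y power_mono[of "\<bar>Y _\<bar>" B 2] by auto
    have "integrable lborel (\<lambda>x. (x \<bullet> x) ^ (2*k+4) * (laplacian w x)\<^sup>2
        + Y x * (2 * (x \<bullet> x) ^ (2*k+4) * laplacian w x * w x) + (Y x)\<^sup>2 * ((x \<bullet> x) ^ (2*k+4) * (w x)\<^sup>2))"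
      by (intro Bochner_Integration.integrable_add integrable_bounded_mult[OF Y] integrable_bounded_mult[OF Y2] integrable_continuous_support[of _ r])
         (use supp(1) Ls in \<open>auto intro!: continuous_intros Lc wc\<close>)
    then show ?thesis unfolding F2[symmetric] by (simp add: algebra_simps power2_eq_square)
  qed
  have "b\<^sup>2 * (\<integral>x. (D x)\<^sup>2 \<partial>lborel) - 2 * b * ((\<integral>x. S x * D x \<partial>lborel) + c * (\<integral>x. z x * D x \<partial>lborel) + (\<integral>x. (x \<bullet> x) * Y x * z x * D x \<partial>lborel))
    = (\<integral>x. b\<^sup>2 * (D x)\<^sup>2 - 2 * b * (S x * D x + c * (z x * D x) + (x \<bullet> x) * Y x * z x * D x) \<partial>lborel)"
    using iSD izD iD iYD by simp
  also have "\<dots> \<le> (\<integral>x. (F x)\<^sup>2 \<partial>lborel)"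
  proof (rule integral_mono)
    fix x
    define A where "A = S x + c * z x + (x \<bullet> x) * Y x * z x"
    have "(F x)\<^sup>2 = A\<^sup>2 + (b\<^sup>2 * (D x)\<^sup>2 - 2 * b * (A * D x))"
      unfolding F A_def[symmetric] by (simp add: power2_eq_square algebra_simps)
    moreover have AD: "S x * D x + c * (z x * D x) + (x \<bullet> x) * Y x * z x * D x = A * D x"
      by (simp add: A_def algebra_simps)
    moreover have "0 \<le> A\<^sup>2" by simp
    ultimately show "b\<^sup>2 * (D x)\<^sup>2 - 2 * b * (S x * D x + c * (z x * D x) + (x \<bullet> x) * Y x * z x * D x) \<le> (F x)\<^sup>2"
      unfolding AD by linarith
  qed (use iSD izD iD iYD iF in auto)
  finally have "b\<^sup>2 * (\<integral>x. (D x)\<^sup>2 \<partial>lborel) \<le> (\<integral>x. (F x)\<^sup>2 \<partial>lborel)"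
    using SD zD YD mult_nonneg_nonpos[of "2 * b" "\<integral>x. (x \<bullet> x) * Y x * z x * D x \<partial>lborel"] by (simp add: b_def)
  moreover have "(\<integral>x. (x \<bullet> x) ^ (2*k+1) * (w x)\<^sup>2 \<partial>lborel) \<le> (\<integral>x. (D x)\<^sup>2 \<partial>lborel)"
    unfolding D_def z_def[abs_def]
    by (rule hardy_skew_euler[OF Ck2_D(1)[OF w] supp(1)]) (use supp(2) a in auto)
  from mult_left_mono[OF this, of "b\<^sup>2"]
  have "b\<^sup>2 * (\<integral>x. (x \<bullet> x) ^ (2*k+1) * (w x)\<^sup>2 \<partial>lborel) \<le> b\<^sup>2 * (\<integral>x. (D x)\<^sup>2 \<partial>lborel)" by simp
  ultimately show ?thesis unfolding F2 b_def by linarith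
qed

text \<open>
  The Laplacian of \<open>f\<^sup>2 / 2\<close> is \<open>\<bar>grad f\<bar>\<^sup>2 + f \<Delta> f\<close>; integrate it against \<open>\<eta>\<close>.
  Being an identity without gradients on the right, it survives limits in which only \<open>f\<close> and its
  Laplacian converge.
\<close>
lemma caccioppoli_identity:
  fixes \<eta> f :: "real ^ 'n::finite \<Rightarrow> real"
  assumes \<eta>: "Ck 2 \<eta>" and f: "Ck 2 f" and supp: "\<And>x. r < norm x \<Longrightarrow> \<eta> x = 0"
  shows "(\<integral>x. \<eta> x * (\<Sum>i\<in>UNIV. (partial_deriv i f x)\<^sup>2) \<partial>lborel)
    = 1/2 * (\<integral>x. laplacian \<eta> x * (f x)\<^sup>2 \<partial>lborel) - (\<integral>x. \<eta> x * (f x * laplacian f x) \<partial>lborel)"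
proof -
  note f1 = Ck2_D(1)[OF f] Ck2_D(3)[OF f] and e1 = Ck2_D(1)[OF \<eta>] Ck2_D(3)[OF \<eta>]
  have d: "f differentiable (at x)" "\<eta> differentiable (at x)" "partial_deriv i f differentiable (at x)"
    "partial_deriv i \<eta> differentiable (at x)" for x i
    using Ck_differentiable[OF f1(1)] Ck_differentiable[OF f1(2)] Ck_differentiable[OF e1(1)] Ck_differentiable[OF e1(2)] by auto
  note ps = partial_deriv_vanish_outside[of r \<eta>, OF supp]
  have "(\<integral>x. 2 * (\<eta> x * (\<Sum>i\<in>UNIV. (partial_deriv i f x)\<^sup>2)) + 2 * (\<eta> x * (f x * laplacian f x)) - laplacian \<eta> x * (f x)\<^sup>2 \<partial>lborel) = 0"
  proof (rule integral_divergence_eq[of "\<lambda>i x. 2 * (\<eta> x * f x * partial_deriv i f x) - (f x)\<^sup>2 * partial_deriv i \<eta> x" r])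
    show "Ck 1 (\<lambda>x. 2 * (\<eta> x * f x * partial_deriv i f x) - (f x)\<^sup>2 * partial_deriv i \<eta> x)" for i
      by (intro Ck_diff Ck_mult Ck_const Ck_power f1 e1)
    fix x :: "real^'n"
    have "partial_deriv i (\<lambda>x. 2 * (\<eta> x * f x * partial_deriv i f x) - (f x)\<^sup>2 * partial_deriv i \<eta> x) x
      = 2 * (\<eta> x * (partial_deriv i f x)\<^sup>2) + 2 * (\<eta> x * (f x * partial_deriv i (partial_deriv i f) x))
        - partial_deriv i (partial_deriv i \<eta>) x * (f x)\<^sup>2" for i
      by (simp add: partial_deriv_rules d differentiable_rules) (simp add: algebra_simps power2_eq_square)
    then show "(\<Sum>i\<in>UNIV. partial_deriv i (\<lambda>x. 2 * (\<eta> x * f x * partial_deriv i f x) - (f x)\<^sup>2 * partial_deriv i \<eta> x) x)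
      = 2 * (\<eta> x * (\<Sum>i\<in>UNIV. (partial_deriv i f x)\<^sup>2)) + 2 * (\<eta> x * (f x * laplacian f x)) - laplacian \<eta> x * (f x)\<^sup>2"
      by (simp add: sum.distrib sum_subtractf sum_distrib_left sum_distrib_right laplacian_def)
  qed (use supp ps in auto)
  moreover have "integrable lborel (\<lambda>x. \<eta> x * (\<Sum>i\<in>UNIV. (partial_deriv i f x)\<^sup>2))"
    "integrable lborel (\<lambda>x. \<eta> x * (f x * laplacian f x))" "integrable lborel (\<lambda>x. laplacian \<eta> x * (f x)\<^sup>2)"
    using f1 e1 f \<eta> Ck_imp_continuous[OF f1(1)] Ck_imp_continuous[OF e1(1)] Ck_imp_continuous[OF f1(2)]
      Ck_imp_continuous[OF Ck_laplacian[of 0 f]] Ck_imp_continuous[OF Ck_laplacian[of 0 \<eta>]]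
      laplacian_vanish_outside(1)[of r \<eta>, OF supp] supp
    by (auto intro!: integrable_continuous_support[of _ r] continuous_intros simp: numeral_2_eq_2)
  ultimately show ?thesis by simp
qed

section \<open>Localisation\<close>

text \<open>
  The Laplacian of \<open>s(x \<bullet> x)\<close> as a function of \<open>t = x \<bullet> x\<close>, in terms of the first two derivatives of
  \<open>s\<close>. All cutoffs are profiles in \<open>x \<bullet> x\<close>, which avoids the norm and its singularity.
\<close>
definition radial_lap :: "real \<Rightarrow> (real \<Rightarrow> real) \<Rightarrow> (real \<Rightarrow> real) \<Rightarrow> real \<Rightarrow> real" where
  "radial_lap n s1 s2 t = 4 * t * s2 t + 2 * n * s1 t"

lemma partial_deriv_radial:
  assumes "\<And>t. (s has_real_derivative s1 t) (at t)"
  shows "partial_deriv i (\<lambda>x. s (x \<bullet> x)) x = 2 * (x $ i * s1 (x \<bullet> x))"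
  using partial_deriv_compose[OF differentiable_norm_sq assms] by (simp add: partial_deriv_norm_sq mult_ac)

lemma laplacian_radial:
  fixes x :: "real ^ 'n::finite"
  assumes s: "\<And>t. (s has_real_derivative s1 t) (at t)" "\<And>t. (s1 has_real_derivative s2 t) (at t)"
  shows "laplacian (\<lambda>x. s (x \<bullet> x)) x = radial_lap (real CARD('n)) s1 s2 (x \<bullet> x)"
proof -
  have ds1: "(\<lambda>x::real^'n. s1 (x \<bullet> x)) differentiable (at x)" for x
    using has_derivative_compose[OF has_derivative_grad[OF differentiable_norm_sq] s(2)[unfolded has_field_derivative_def]]
    unfolding differentiable_def by blast
  have "partial_deriv i (partial_deriv i (\<lambda>x. s (x \<bullet> x))) x
      = 2 * s1 (x \<bullet> x) + 4 * s2 (x \<bullet> x) * (x $ i)\<^sup>2" for i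
    by (simp add: partial_deriv_radial[OF s(1), abs_def] partial_deriv_rules ds1 differentiable_rules partial_deriv_radial[OF s(2)])
       (simp add: algebra_simps power2_eq_square)
  then have "laplacian (\<lambda>x. s (x \<bullet> x)) x = (\<Sum>i::'n\<in>UNIV. 2 * s1 (x \<bullet> x) + 4 * s2 (x \<bullet> x) * (x $ i)\<^sup>2)"
    unfolding laplacian_def by simp
  also have "\<dots> = radial_lap (real CARD('n)) s1 s2 (x \<bullet> x)"
    by (simp add: sum.distrib sum_distrib_left[symmetric] norm_sq_sum[symmetric] radial_lap_def)
  finally show ?thesis .
qed

text \<open>
  For the cutoff \<open>b(q)\<close> the weight in front of \<open>\<bar>grad f\<bar>\<^sup>2\<close> is \<open>q ^ (2k+4)\<close> times
  \<open>\<bar>grad (b(q))\<bar>\<^sup>2 = 4 q b'(q)\<^sup>2\<close>. This is its profile, followed by its two derivatives; its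
  Laplacian enters through the Caccioppoli identity.
\<close>
definition grad_weight0 :: "nat \<Rightarrow> (real \<Rightarrow> real) \<Rightarrow> real \<Rightarrow> real" where
  "grad_weight0 k b1 t = 4 * t ^ (2*k+5) * (b1 t)\<^sup>2"
definition grad_weight1 :: "nat \<Rightarrow> (real \<Rightarrow> real) \<Rightarrow> (real \<Rightarrow> real) \<Rightarrow> real \<Rightarrow> real" where
  "grad_weight1 k b1 b2 t = 4 * (2 * real k + 5) * t ^ (2*k+4) * (b1 t)\<^sup>2 + 8 * t ^ (2*k+5) * (b1 t * b2 t)"
definition grad_weight2 :: "nat \<Rightarrow> (real \<Rightarrow> real) \<Rightarrow> (real \<Rightarrow> real) \<Rightarrow> (real \<Rightarrow> real) \<Rightarrow> real \<Rightarrow> real" where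
  "grad_weight2 k b1 b2 b3 t = 4 * (2 * real k + 5) * (2 * real k + 4) * t ^ (2*k+3) * (b1 t)\<^sup>2
     + 16 * (2 * real k + 5) * t ^ (2*k+4) * (b1 t * b2 t) + 8 * t ^ (2*k+5) * ((b2 t)\<^sup>2 + b1 t * b3 t)"

lemma grad_weight0_deriv:
  assumes b: "\<And>t. (b1 has_real_derivative b2 t) (at t)"
  shows "(grad_weight0 k b1 has_real_derivative grad_weight1 k b1 b2 t) (at t)"
  unfolding grad_weight0_def[abs_def] grad_weight1_def
  by (rule derivative_eq_intros b refl | simp add: algebra_simps)+

lemma grad_weight1_deriv:
  assumes b: "\<And>t. (b1 has_real_derivative b2 t) (at t)" "\<And>t. (b2 has_real_derivative b3 t) (at t)"
  shows "(grad_weight1 k b1 b2 has_real_derivative grad_weight2 k b1 b2 b3 t) (at t)"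
proof -
  have e: "2 * k + 5 - Suc 0 = 2 * k + 4" "2 * k + 4 - Suc 0 = 2 * k + 3" by simp_all
  define T3 T4 T5 where "T3 = t ^ (2*k+3)" and "T4 = t ^ (2*k+4)" and "T5 = t ^ (2*k+5)"
  show ?thesis
    unfolding grad_weight1_def[abs_def] grad_weight2_def
    apply (rule derivative_eq_intros b refl)+
    unfolding One_nat_def e T3_def[symmetric] T4_def[symmetric] T5_def[symmetric]
    by (simp add: algebra_simps power2_eq_square)
qed

text \<open>
  The coefficients of \<open>f\<^sup>2\<close>, of \<open>f \<Delta> f\<close> and of \<open>(\<Delta> f)\<^sup>2\<close> in the localised inequality, after
  the gradient has been eliminated.
\<close>
definition weight_uu :: "nat \<Rightarrow> (real \<Rightarrow> real) \<Rightarrow> (real \<Rightarrow> real) \<Rightarrow> (real \<Rightarrow> real) \<Rightarrow> (real \<Rightarrow> real) \<Rightarrow>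
    (real ^ 'n::finite \<Rightarrow> real) \<Rightarrow> real ^ 'n \<Rightarrow> real" where
  "weight_uu k b b1 b2 b3 Y x = 3 * (x \<bullet> x) ^ (2*k+4) * (b (x \<bullet> x))\<^sup>2 * (Y x)\<^sup>2
     + 3 * (x \<bullet> x) ^ (2*k+4) * (radial_lap (real CARD('n)) b1 b2 (x \<bullet> x))\<^sup>2
     + 6 * radial_lap (real CARD('n)) (grad_weight1 k b1 b2) (grad_weight2 k b1 b2 b3) (x \<bullet> x)"

definition weight_ul :: "nat \<Rightarrow> (real \<Rightarrow> real) \<Rightarrow> (real \<Rightarrow> real) \<Rightarrow>
    (real ^ 'n::finite \<Rightarrow> real) \<Rightarrow> real ^ 'n \<Rightarrow> real" where
  "weight_ul k b b1 Y x = 6 * (x \<bullet> x) ^ (2*k+4) * (b (x \<bullet> x))\<^sup>2 * Y x - 12 * grad_weight0 k b1 (x \<bullet> x)"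

definition weight_ll :: "nat \<Rightarrow> (real \<Rightarrow> real) \<Rightarrow> real ^ 'n::finite \<Rightarrow> real" where
  "weight_ll k b x = 3 * (x \<bullet> x) ^ (2*k+4) * (b (x \<bullet> x))\<^sup>2"

lemma laplacian_mult:
  assumes f: "Ck 2 f" and g: "Ck 2 g"
  shows "laplacian (\<lambda>x. f x * g x) x = f x * laplacian g x
     + 2 * (\<Sum>i\<in>UNIV. partial_deriv i f x * partial_deriv i g x) + g x * laplacian f x"
proof -
  have d: "f differentiable (at x)" "g differentiable (at x)" "partial_deriv i f differentiable (at x)"
    "partial_deriv i g differentiable (at x)" for x i
    using Ck_differentiable[OF Ck2_D(1)[OF f]] Ck_differentiable[OF Ck2_D(3)[OF f]]
      Ck_differentiable[OF Ck2_D(1)[OF g]] Ck_differentiable[OF Ck2_D(3)[OF g]] by auto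
  have "partial_deriv i (\<lambda>x. f x * g x) = (\<lambda>x. partial_deriv i f x * g x + f x * partial_deriv i g x)" for i
    by (rule ext) (simp add: partial_deriv_mult d)
  then have "partial_deriv i (partial_deriv i (\<lambda>x. f x * g x)) x
    = f x * partial_deriv i (partial_deriv i g) x + 2 * (partial_deriv i f x * partial_deriv i g x)
      + g x * partial_deriv i (partial_deriv i f) x" for i
    by (simp add: partial_deriv_rules d differentiable_rules)
  then show ?thesis
    by (simp add: laplacian_def sum.distrib sum_distrib_left)
qed

lemma square_sum3_le: "(a + b + c)\<^sup>2 \<le> 3 * a\<^sup>2 + 3 * b\<^sup>2 + 3 * c\<^sup>2" for a b c :: real
proof -
  have "3 * a\<^sup>2 + 3 * b\<^sup>2 + 3 * c\<^sup>2 - (a + b + c)\<^sup>2 = (a - b)\<^sup>2 + (b - c)\<^sup>2 + (a - c)\<^sup>2"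
    by (simp add: power2_eq_square algebra_simps)
  then show ?thesis by (smt (verit) zero_le_power2)
qed

text \<open>
  Apply \<open>carleman_estimate\<close> to \<open>b(q) f\<close> and expand the Laplacian of the product into three terms. The mixed
  term \<open>2 grad (b(q)) \<bullet> grad f\<close> is bounded by Cauchy-Schwarz, and the resulting weighted integral of
  \<open>\<bar>grad f\<bar>\<^sup>2\<close> is rewritten by \<open>caccioppoli_identity\<close>.
\<close>
lemma carleman_cutoff:
  fixes f Y :: "real ^ 'n::finite \<Rightarrow> real"
  assumes f: "Ck 2 f"
    and b: "\<And>t. (b has_real_derivative b1 t) (at t)" "\<And>t. (b1 has_real_derivative b2 t) (at t)"
      "\<And>t. (b2 has_real_derivative b3 t) (at t)" "continuous_on UNIV b3"
    and supp: "\<And>t. t < a'\<^sup>2 \<or> r\<^sup>2 < t \<Longrightarrow> b t = 0 \<and> b1 t = 0 \<and> b2 t = 0 \<and> b3 t = 0"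
    and a: "1 \<le> a" "a < a'" "0 \<le> r"
    and Y: "Y \<in> borel_measurable borel" "\<And>x. norm x \<le> r \<Longrightarrow> \<bar>Y x\<bar> \<le> B"
    and mono: "\<And>x t. a < norm x \<Longrightarrow> 1 \<le> t \<Longrightarrow> Y x \<le> t\<^sup>2 * Y (t *\<^sub>R x)"
  shows "(4 * real k + 6)\<^sup>2 * (\<integral>x. (x \<bullet> x) ^ (2*k+1) * (b (x \<bullet> x) * f x)\<^sup>2 \<partial>lborel)
    \<le> (\<integral>x. weight_uu k b b1 b2 b3 Y x * (f x * f x) \<partial>lborel)
      + (\<integral>x. weight_ul k b b1 Y x * (f x * laplacian f x) \<partial>lborel)
      + (\<integral>x. weight_ll k b x * (laplacian f x * laplacian f x) \<partial>lborel)"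
proof -
  define n where "n = real CARD('n)"
  have contb: "continuous_on UNIV b" "continuous_on UNIV b1" "continuous_on UNIV b2"
    using b by (auto simp: continuous_on_eq_continuous_at intro: DERIV_isCont)
  have bC: "CkR 2 b" unfolding numeral_2_eq_2 using b(1,2) contb(3) by auto
  define \<psi> :: "real^'n \<Rightarrow> real" where "\<psi> x = b (x \<bullet> x)" for x
  define \<eta> :: "real^'n \<Rightarrow> real" where "\<eta> x = grad_weight0 k b1 (x \<bullet> x)" for x
  have \<psi>: "Ck 2 \<psi>" unfolding \<psi>_def by (rule Ck_compose[OF bC Ck_norm_sq])
  have c2c: "continuous_on UNIV (grad_weight2 k b1 b2 b3)"
    unfolding grad_weight2_def by (intro continuous_intros contb b(4))
  have "CkR 2 (grad_weight0 k b1)" unfolding numeral_2_eq_2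
    by (simp, intro exI[of _ "grad_weight1 k b1 b2"] exI[of _ "grad_weight2 k b1 b2 b3"] conjI allI grad_weight0_deriv[OF b(2)] grad_weight1_deriv[OF b(2,3)] c2c)
  from Ck_compose[OF this Ck_norm_sq] have \<eta>: "Ck 2 \<eta>" unfolding \<eta>_def .
  have out: "x \<bullet> x < a'\<^sup>2 \<or> r\<^sup>2 < x \<bullet> x" if "norm x < a' \<or> r < norm x" for x :: "real^'n"
    using that a by (auto simp: dot_square_norm intro: power_strict_mono)
  have \<psi>0: "\<psi> x = 0" if "norm x < a' \<or> r < norm x" for x
    using supp[OF out[OF that]] by (simp add: \<psi>_def)
  have \<eta>0: "\<eta> x = 0" if "norm x < a' \<or> r < norm x" for x
    using supp[OF out[OF that]] by (simp add: \<eta>_def grad_weight0_def)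
  have L\<psi>: "laplacian \<psi> x = radial_lap n b1 b2 (x \<bullet> x)" for x
    unfolding \<psi>_def[abs_def] n_def by (rule laplacian_radial[OF b(1,2)])
  have L\<eta>: "laplacian \<eta> x = radial_lap n (grad_weight1 k b1 b2) (grad_weight2 k b1 b2 b3) (x \<bullet> x)" for x
    unfolding \<eta>_def[abs_def] n_def by (rule laplacian_radial[OF grad_weight0_deriv[OF b(2)] grad_weight1_deriv[OF b(2,3)]])
  define N where "N x = (\<Sum>i\<in>UNIV. (partial_deriv i f x)\<^sup>2)" for x
  define w where "w x = \<psi> x * f x" for x
  have w: "Ck 2 w" unfolding w_def by (intro Ck_mult \<psi> f)
  have car: "(4 * real k + 6)\<^sup>2 * (\<integral>x. (x \<bullet> x) ^ (2*k+1) * (w x)\<^sup>2 \<partial>lborel)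
    \<le> (\<integral>x. (x \<bullet> x) ^ (2*k+4) * (laplacian w x + Y x * w x)\<^sup>2 \<partial>lborel)"
    by (rule carleman_estimate[OF w _ _ a(1,2) Y mono]) (auto simp: w_def \<psi>0)
  have pw: "(x \<bullet> x) ^ (2*k+4) * (laplacian w x + Y x * w x)\<^sup>2
     \<le> (3 * (x \<bullet> x) ^ (2*k+4) * (\<psi> x)\<^sup>2) * (laplacian f x + Y x * f x)\<^sup>2 + 12 * (\<eta> x * N x)
       + 3 * (x \<bullet> x) ^ (2*k+4) * (laplacian \<psi> x)\<^sup>2 * (f x)\<^sup>2" for x
  proof -
    define q where "q = x \<bullet> x"
    have q: "0 \<le> q" by (simp add: q_def)
    define g where "g = (\<Sum>i\<in>UNIV. partial_deriv i \<psi> x * partial_deriv i f x)"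
    have "g\<^sup>2 \<le> (\<Sum>i\<in>UNIV. (partial_deriv i \<psi> x)\<^sup>2) * N x"
    proof -
      have "g\<^sup>2 = (grad \<psi> x \<bullet> grad f x)\<^sup>2" by (simp add: g_def inner_vec_def)
      also have "\<dots> \<le> (grad \<psi> x \<bullet> grad \<psi> x) * (grad f x \<bullet> grad f x)" by (rule Cauchy_Schwarz_ineq)
      finally show ?thesis by (simp add: norm_sq_sum N_def)
    qed
    also have "(\<Sum>i\<in>UNIV. (partial_deriv i \<psi> x)\<^sup>2) = 4 * q * (b1 q)\<^sup>2"
    proof -
      have "(\<Sum>i\<in>UNIV. (partial_deriv i \<psi> x)\<^sup>2) = (\<Sum>i\<in>UNIV. 4 * (b1 q)\<^sup>2 * (x $ i)\<^sup>2)"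
        unfolding \<psi>_def[abs_def] partial_deriv_radial[OF b(1)] q_def
        by (simp add: power_mult_distrib algebra_simps)
      also have "\<dots> = 4 * (b1 q)\<^sup>2 * q" unfolding sum_distrib_left[symmetric] norm_sq_sum[symmetric] q_def ..
      finally show ?thesis by simp
    qed
    finally have g: "g\<^sup>2 \<le> 4 * q * (b1 q)\<^sup>2 * N x" .
    have lw: "laplacian w x + Y x * w x = \<psi> x * (laplacian f x + Y x * f x) + 2 * g + laplacian \<psi> x * f x"
      unfolding w_def[abs_def] laplacian_mult[OF \<psi> f] g_def by (simp add: algebra_simps)
    have "q ^ (2*k+4) * (laplacian w x + Y x * w x)\<^sup>2
      \<le> q ^ (2*k+4) * (3 * (\<psi> x * (laplacian f x + Y x * f x))\<^sup>2 + 3 * (2 * g)\<^sup>2 + 3 * (laplacian \<psi> x * f x)\<^sup>2)"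
      unfolding lw by (intro mult_left_mono square_sum3_le) (use q in simp)
    moreover have "q ^ (2*k+4) * g\<^sup>2 \<le> q ^ (2*k+4) * (4 * q * (b1 q)\<^sup>2 * N x)"
      by (intro mult_left_mono g) (use q in simp)
    moreover have "q ^ (2*k+4) * (4 * q * (b1 q)\<^sup>2 * N x) = \<eta> x * N x"
    proof -
      have "q ^ (2*k+5) = q ^ (2*k+4) * q" by (simp add: power_add[symmetric] eval_nat_numeral)
      then show ?thesis by (simp add: \<eta>_def grad_weight0_def q_def[symmetric])
    qed
    moreover have "q ^ (2*k+4) * (3 * (\<psi> x * (laplacian f x + Y x * f x))\<^sup>2 + 3 * (2 * g)\<^sup>2 + 3 * (laplacian \<psi> x * f x)\<^sup>2)
      = (3 * q ^ (2*k+4) * (\<psi> x)\<^sup>2) * (laplacian f x + Y x * f x)\<^sup>2 + 12 * (q ^ (2*k+4) * g\<^sup>2)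
       + 3 * q ^ (2*k+4) * (laplacian \<psi> x)\<^sup>2 * (f x)\<^sup>2"
    proof -
      define Q l where "Q = q ^ (2*k+4)" and "l = laplacian f x + Y x * f x"
      show ?thesis unfolding Q_def[symmetric] l_def[symmetric] by (simp add: power_mult_distrib algebra_simps)
    qed
    ultimately show ?thesis
      unfolding q_def[symmetric] by linarith
  qed
  have fc: "continuous_on UNIV f" "continuous_on UNIV (laplacian f)"
    using Ck2_D(2)[OF f] Ck_laplacian[of 0 f] f by (auto simp: numeral_2_eq_2)
  have \<psi>c: "continuous_on UNIV \<psi>" "continuous_on UNIV (laplacian \<psi>)"
    using Ck2_D(2)[OF \<psi>] Ck_laplacian[of 0 \<psi>] \<psi> by (auto simp: numeral_2_eq_2)
  have \<eta>c: "continuous_on UNIV \<eta>" "continuous_on UNIV (laplacian \<eta>)"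
    using Ck2_D(2)[OF \<eta>] Ck_laplacian[of 0 \<eta>] \<eta> by (auto simp: numeral_2_eq_2)
  have Nc: "continuous_on UNIV N" unfolding N_def
    by (intro continuous_intros Ck_imp_continuous[OF Ck2_D(3)[OF f]])
  note L\<psi>0 = laplacian_vanish_outside(1)[of r \<psi>, OF \<psi>0[OF disjI2]]
  note L\<eta>0 = laplacian_vanish_outside(1)[of r \<eta>, OF \<eta>0[OF disjI2]]
  note c = fc \<psi>c \<eta>c Nc
  have Y2: "(\<lambda>x. (Y x)\<^sup>2) \<in> borel_measurable borel" "\<And>x. norm x \<le> r \<Longrightarrow> \<bar>(Y x)\<^sup>2\<bar> \<le> B\<^sup>2"
    using Y power_mono[of "\<bar>Y _\<bar>" B 2] by auto
  define q4 where "q4 x = (x \<bullet> x) ^ (2*k+4)" for x :: "real^'n"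
  have q4c: "continuous_on UNIV q4" unfolding q4_def by (intro continuous_intros)
  have i: "integrable lborel (\<lambda>x. q4 x * (\<psi> x)\<^sup>2 * (laplacian f x)\<^sup>2)"
    "integrable lborel (\<lambda>x. \<eta> x * N x)"
    "integrable lborel (\<lambda>x. \<eta> x * (f x * laplacian f x))"
    "integrable lborel (\<lambda>x. laplacian \<eta> x * (f x)\<^sup>2)"
    "integrable lborel (\<lambda>x. q4 x * (laplacian \<psi> x)\<^sup>2 * (f x)\<^sup>2)"
    by (rule integrable_continuous_support[of _ r]; use L\<psi>0 L\<eta>0 \<psi>0 \<eta>0 in \<open>auto intro!: continuous_intros c q4c\<close>)+
  have j: "integrable lborel (\<lambda>x. Y x * (q4 x * (\<psi> x)\<^sup>2 * (f x * laplacian f x)))"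
    "integrable lborel (\<lambda>x. (Y x)\<^sup>2 * (q4 x * (\<psi> x)\<^sup>2 * (f x)\<^sup>2))"
    by (intro integrable_bounded_mult[OF Y] integrable_bounded_mult[OF Y2]; use \<psi>0 in \<open>auto intro!: continuous_intros c q4c\<close>)+
  have pt: "(x \<bullet> x) ^ (2*k+4) * (laplacian w x + Y x * w x)\<^sup>2
      \<le> 3 * (q4 x * (\<psi> x)\<^sup>2 * (laplacian f x)\<^sup>2) + 6 * (Y x * (q4 x * (\<psi> x)\<^sup>2 * (f x * laplacian f x)))
         + 3 * ((Y x)\<^sup>2 * (q4 x * (\<psi> x)\<^sup>2 * (f x)\<^sup>2)) + 12 * (\<eta> x * N x) + 3 * (q4 x * (laplacian \<psi> x)\<^sup>2 * (f x)\<^sup>2)" for x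
  proof -
    have "(3 * q4 x * (\<psi> x)\<^sup>2) * (laplacian f x + Y x * f x)\<^sup>2
        = 3 * (q4 x * (\<psi> x)\<^sup>2 * (laplacian f x)\<^sup>2) + 6 * (Y x * (q4 x * (\<psi> x)\<^sup>2 * (f x * laplacian f x)))
         + 3 * ((Y x)\<^sup>2 * (q4 x * (\<psi> x)\<^sup>2 * (f x)\<^sup>2))"
      by (simp add: power2_eq_square algebra_simps)
    with pw[of x, folded q4_def] show ?thesis
      unfolding q4_def[symmetric] by simp
  qed
  have "(\<integral>x. (x \<bullet> x) ^ (2*k+4) * (laplacian w x + Y x * w x)\<^sup>2 \<partial>lborel)
    \<le> (\<integral>x. 3 * (q4 x * (\<psi> x)\<^sup>2 * (laplacian f x)\<^sup>2) + 6 * (Y x * (q4 x * (\<psi> x)\<^sup>2 * (f x * laplacian f x)))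
         + 3 * ((Y x)\<^sup>2 * (q4 x * (\<psi> x)\<^sup>2 * (f x)\<^sup>2)) + 12 * (\<eta> x * N x) + 3 * (q4 x * (laplacian \<psi> x)\<^sup>2 * (f x)\<^sup>2) \<partial>lborel)"
  proof (rule integral_mono_AE')
    show "AE x in lborel. (x \<bullet> x) ^ (2*k+4) * (laplacian w x + Y x * w x)\<^sup>2 \<le> 3 * (q4 x * (\<psi> x)\<^sup>2 * (laplacian f x)\<^sup>2) + 6 * (Y x * (q4 x * (\<psi> x)\<^sup>2 * (f x * laplacian f x)))
         + 3 * ((Y x)\<^sup>2 * (q4 x * (\<psi> x)\<^sup>2 * (f x)\<^sup>2)) + 12 * (\<eta> x * N x) + 3 * (q4 x * (laplacian \<psi> x)\<^sup>2 * (f x)\<^sup>2)"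
      by (rule AE_I2) (rule pt)
    show "AE x in lborel. 0 \<le> 3 * (q4 x * (\<psi> x)\<^sup>2 * (laplacian f x)\<^sup>2) + 6 * (Y x * (q4 x * (\<psi> x)\<^sup>2 * (f x * laplacian f x)))
         + 3 * ((Y x)\<^sup>2 * (q4 x * (\<psi> x)\<^sup>2 * (f x)\<^sup>2)) + 12 * (\<eta> x * N x) + 3 * (q4 x * (laplacian \<psi> x)\<^sup>2 * (f x)\<^sup>2)"
      by (rule AE_I2, rule order_trans[OF _ pt]) simp
  qed (use i j in auto)
  also have "\<dots> = 3 * (\<integral>x. q4 x * (\<psi> x)\<^sup>2 * (laplacian f x)\<^sup>2 \<partial>lborel) + 6 * (\<integral>x. Y x * (q4 x * (\<psi> x)\<^sup>2 * (f x * laplacian f x)) \<partial>lborel)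
         + 3 * (\<integral>x. (Y x)\<^sup>2 * (q4 x * (\<psi> x)\<^sup>2 * (f x)\<^sup>2) \<partial>lborel) + 12 * (\<integral>x. \<eta> x * N x \<partial>lborel) + 3 * (\<integral>x. q4 x * (laplacian \<psi> x)\<^sup>2 * (f x)\<^sup>2 \<partial>lborel)"
    using i j by simp
  finally have fin: "(\<integral>x. (x \<bullet> x) ^ (2*k+4) * (laplacian w x + Y x * w x)\<^sup>2 \<partial>lborel) \<le> \<dots>" .
  have cac: "(\<integral>x. \<eta> x * N x \<partial>lborel) = 1/2 * (\<integral>x. laplacian \<eta> x * (f x)\<^sup>2 \<partial>lborel) - (\<integral>x. \<eta> x * (f x * laplacian f x) \<partial>lborel)"
    unfolding N_def by (rule caccioppoli_identity[OF \<eta> f]) (use \<eta>0 in auto)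
  have "(\<integral>x. weight_uu k b b1 b2 b3 Y x * (f x * f x) \<partial>lborel)
    = (\<integral>x. 3 * ((Y x)\<^sup>2 * (q4 x * (\<psi> x)\<^sup>2 * (f x)\<^sup>2)) + 3 * (q4 x * (laplacian \<psi> x)\<^sup>2 * (f x)\<^sup>2) + 6 * (laplacian \<eta> x * (f x)\<^sup>2) \<partial>lborel)"
    by (rule Bochner_Integration.integral_cong[OF refl])
       (simp add: weight_uu_def L\<eta> L\<psi> n_def \<psi>_def q4_def power2_eq_square algebra_simps)
  also have "\<dots> = 3 * (\<integral>x. (Y x)\<^sup>2 * (q4 x * (\<psi> x)\<^sup>2 * (f x)\<^sup>2) \<partial>lborel) + 3 * (\<integral>x. q4 x * (laplacian \<psi> x)\<^sup>2 * (f x)\<^sup>2 \<partial>lborel)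
      + 6 * (\<integral>x. laplacian \<eta> x * (f x)\<^sup>2 \<partial>lborel)"
    using i j by simp
  finally have al: "(\<integral>x. weight_uu k b b1 b2 b3 Y x * (f x * f x) \<partial>lborel) = \<dots>" .
  have "(\<integral>x. weight_ul k b b1 Y x * (f x * laplacian f x) \<partial>lborel)
    = (\<integral>x. 6 * (Y x * (q4 x * (\<psi> x)\<^sup>2 * (f x * laplacian f x))) - 12 * (\<eta> x * (f x * laplacian f x)) \<partial>lborel)"
    by (rule Bochner_Integration.integral_cong[OF refl])
       (simp add: weight_ul_def \<eta>_def \<psi>_def q4_def algebra_simps)
  also have "\<dots> = 6 * (\<integral>x. Y x * (q4 x * (\<psi> x)\<^sup>2 * (f x * laplacian f x)) \<partial>lborel) - 12 * (\<integral>x. \<eta> x * (f x * laplacian f x) \<partial>lborel)"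
    using i j by simp
  finally have be: "(\<integral>x. weight_ul k b b1 Y x * (f x * laplacian f x) \<partial>lborel) = \<dots>" .
  have "(\<integral>x. weight_ll k b x * (laplacian f x * laplacian f x) \<partial>lborel) = (\<integral>x. 3 * (q4 x * (\<psi> x)\<^sup>2 * (laplacian f x)\<^sup>2) \<partial>lborel)"
    by (rule Bochner_Integration.integral_cong[OF refl])
       (simp add: weight_ll_def \<psi>_def q4_def power2_eq_square algebra_simps)
  also have "\<dots> = 3 * (\<integral>x. q4 x * (\<psi> x)\<^sup>2 * (laplacian f x)\<^sup>2 \<partial>lborel)" by simp
  finally have ga: "(\<integral>x. weight_ll k b x * (laplacian f x * laplacian f x) \<partial>lborel) = \<dots>" .
  show ?thesis
    using car fin unfolding cac al be ga w_def \<psi>_def[symmetric] by simp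
qed

subsection \<open>Passing to limits\<close>

text \<open>
  Products of \<open>L\<^sup>2\<close>-convergent sequences converge in \<open>L\<^sup>1\<close>. Young's inequality with a parameter \<open>d\<close> that
  tends to \<open>0\<close> but dominates the square root of the error replaces the Cauchy-Schwarz inequality.
\<close>
lemma integral_bounded_mult_tendsto:
  fixes \<phi> u v :: "'a::euclidean_space \<Rightarrow> real" and f g :: "nat \<Rightarrow> 'a \<Rightarrow> real"
  assumes \<phi>: "\<phi> \<in> borel_measurable borel" "\<And>x. norm x \<le> r \<Longrightarrow> \<bar>\<phi> x\<bar> \<le> C" "\<And>x. r < norm x \<Longrightarrow> \<phi> x = 0"
    and m: "u \<in> borel_measurable borel" "v \<in> borel_measurable borel"
      "\<And>j. f j \<in> borel_measurable borel" "\<And>j. g j \<in> borel_measurable borel"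
    and iu: "integrable lborel (\<lambda>x. indicator (cball 0 r) x * (u x)\<^sup>2)"
    and iv: "integrable lborel (\<lambda>x. indicator (cball 0 r) x * (v x)\<^sup>2)"
    and ifu: "\<And>j. integrable lborel (\<lambda>x. indicator (cball 0 r) x * (f j x - u x)\<^sup>2)"
    and igv: "\<And>j. integrable lborel (\<lambda>x. indicator (cball 0 r) x * (g j x - v x)\<^sup>2)"
    and lf: "(\<lambda>j. \<integral>x. indicator (cball 0 r) x * (f j x - u x)\<^sup>2 \<partial>lborel) \<longlonglongrightarrow> 0"
    and lg: "(\<lambda>j. \<integral>x. indicator (cball 0 r) x * (g j x - v x)\<^sup>2 \<partial>lborel) \<longlonglongrightarrow> 0"
  shows "(\<lambda>j. \<integral>x. \<phi> x * (f j x * g j x) \<partial>lborel) \<longlonglongrightarrow> (\<integral>x. \<phi> x * (u x * v x) \<partial>lborel)"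
proof -
  note [measurable] = \<phi>(1) m
  let ?I = "indicator (cball 0 r) :: 'a \<Rightarrow> real"
  define E where "E j = (\<integral>x. ?I x * (f j x - u x)\<^sup>2 \<partial>lborel) + (\<integral>x. ?I x * (g j x - v x)\<^sup>2 \<partial>lborel)" for j
  define U where "U = (\<integral>x. ?I x * (u x)\<^sup>2 \<partial>lborel) + (\<integral>x. ?I x * (v x)\<^sup>2 \<partial>lborel)"
  have E: "E \<longlonglongrightarrow> 0" using tendsto_add[OF lf lg] by (simp add: E_def[abs_def])
  have E0: "0 \<le> E j" for j unfolding E_def by (intro add_nonneg_nonneg integral_nonneg_AE) auto
  have U0: "0 \<le> U" unfolding U_def by (intro add_nonneg_nonneg integral_nonneg_AE) auto
  define D where "D = max C 0"
  have D: "0 \<le> D" "\<bar>\<phi> x\<bar> \<le> D * ?I x" for x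
    using \<phi>(2,3)[of x] by (cases "norm x \<le> r"; force simp: D_def)+
  have young: "2 * \<bar>a * c\<bar> \<le> d * a\<^sup>2 + c\<^sup>2 / d" if "0 < d" for a c d :: real
  proof -
    have "0 \<le> (d * \<bar>a\<bar> - \<bar>c\<bar>)\<^sup>2 / d" using that by simp
    also have "\<dots> = d * a\<^sup>2 + c\<^sup>2 / d - 2 * \<bar>a * c\<bar>"
      using that by (simp add: power2_eq_square abs_mult field_simps)
    finally show ?thesis by simp
  qed
  have uvi: "integrable lborel (\<lambda>x. \<phi> x * (u x * v x))"
  proof (rule Bochner_Integration.integrable_bound[OF Bochner_Integration.integrable_add[OF iu iv, THEN integrable_mult_right[of D]]])
    show "AE x in lborel. norm (\<phi> x * (u x * v x)) \<le> norm (D * (?I x * (u x)\<^sup>2 + ?I x * (v x)\<^sup>2))"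
    proof (rule AE_I2)
      fix x
      have "\<bar>u x * v x\<bar> \<le> (u x)\<^sup>2 + (v x)\<^sup>2" using young[of 1 "u x" "v x"] by simp
      then have "\<bar>\<phi> x\<bar> * \<bar>u x * v x\<bar> \<le> (D * ?I x) * ((u x)\<^sup>2 + (v x)\<^sup>2)"
        by (intro mult_mono D(2)) (use D(1) in auto)
      also have "\<dots> \<le> norm (D * (?I x * (u x)\<^sup>2 + ?I x * (v x)\<^sup>2))" by (simp add: algebra_simps)
      finally show "norm (\<phi> x * (u x * v x)) \<le> norm (D * (?I x * (u x)\<^sup>2 + ?I x * (v x)\<^sup>2))" by (simp add: abs_mult)
    qed
  qed auto
  have bound: "norm ((\<integral>x. \<phi> x * (f j x * g j x) \<partial>lborel) - (\<integral>x. \<phi> x * (u x * v x) \<partial>lborel))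
      \<le> D * ((E j + sqrt (E j)) + (sqrt (E j) + inverse (real (Suc j))) * U)" for j
  proof -
    \<comment> \<open>The second summand only ensures \<open>d > 0\<close>.\<close>
    define d where "d = sqrt (E j) + inverse (real (Suc j))"
    have d: "0 < d" unfolding d_def using E0[of j] by (simp add: add_nonneg_pos)
    define H where "H x = (1 + 1/d) * (?I x * (f j x - u x)\<^sup>2 + ?I x * (g j x - v x)\<^sup>2) + d * (?I x * (u x)\<^sup>2 + ?I x * (v x)\<^sup>2)" for x
    have Hi: "integrable lborel H" unfolding H_def using iu iv ifu igv by auto
    have pw: "norm (\<phi> x * (f j x * g j x) - \<phi> x * (u x * v x)) \<le> D * H x" for x
    proof -
      define p s where "p = f j x - u x" and "s = g j x - v x"
      have "f j x * g j x - u x * v x = p * s + u x * s + v x * p" by (simp add: p_def s_def algebra_simps)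
      then have "\<bar>f j x * g j x - u x * v x\<bar> \<le> \<bar>p * s\<bar> + \<bar>u x * s\<bar> + \<bar>v x * p\<bar>" by linarith
      also have "\<dots> \<le> (1 + 1/d) * (p\<^sup>2 + s\<^sup>2) + d * ((u x)\<^sup>2 + (v x)\<^sup>2)"
      proof -
        have "\<bar>p * s\<bar> \<le> p\<^sup>2 + s\<^sup>2" using young[of 1 p s] by simp
        moreover have "\<bar>u x * s\<bar> \<le> d * (u x)\<^sup>2 + s\<^sup>2 / d" 
        proof -
          have "0 \<le> d * (u x)\<^sup>2 + s\<^sup>2 / d" using d by (intro add_nonneg_nonneg) auto
          with young[OF d, of "u x" s] show ?thesis by linarith
        qed
        moreover have "\<bar>v x * p\<bar> \<le> d * (v x)\<^sup>2 + p\<^sup>2 / d"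
        proof -
          have "0 \<le> d * (v x)\<^sup>2 + p\<^sup>2 / d" using d by (intro add_nonneg_nonneg) auto
          with young[OF d, of "v x" p] show ?thesis by linarith
        qed
        ultimately show ?thesis by (simp add: algebra_simps)
      qed
      finally have "\<bar>\<phi> x\<bar> * \<bar>f j x * g j x - u x * v x\<bar> \<le> (D * ?I x) * ((1 + 1/d) * (p\<^sup>2 + s\<^sup>2) + d * ((u x)\<^sup>2 + (v x)\<^sup>2))"
        by (intro mult_mono D(2)) (use D(1) in auto)
      also have "\<dots> = D * H x" by (simp add: H_def p_def s_def algebra_simps)
      finally show ?thesis by (simp add: abs_mult[symmetric] algebra_simps)
    qed
    have idf: "integrable lborel (\<lambda>x. \<phi> x * (f j x * g j x) - \<phi> x * (u x * v x))"
    proof (rule Bochner_Integration.integrable_bound[OF integrable_mult_right[OF Hi, of D]])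
      show "AE x in lborel. norm (\<phi> x * (f j x * g j x) - \<phi> x * (u x * v x)) \<le> norm (D * H x)"
        using order_trans[OF pw abs_ge_self] by (intro AE_I2) simp
    qed auto
    have "integrable lborel (\<lambda>x. \<phi> x * (f j x * g j x))"
      using Bochner_Integration.integrable_add[OF idf uvi] by simp
    then have eq: "(\<integral>x. \<phi> x * (f j x * g j x) \<partial>lborel) - (\<integral>x. \<phi> x * (u x * v x) \<partial>lborel)
      = (\<integral>x. \<phi> x * (f j x * g j x) - \<phi> x * (u x * v x) \<partial>lborel)" using uvi by simp
    have "norm ((\<integral>x. \<phi> x * (f j x * g j x) \<partial>lborel) - (\<integral>x. \<phi> x * (u x * v x) \<partial>lborel))
      \<le> (\<integral>x. norm (\<phi> x * (f j x * g j x) - \<phi> x * (u x * v x)) \<partial>lborel)"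
      unfolding eq by (rule integral_norm_bound)
    also have "\<dots> \<le> (\<integral>x. D * H x \<partial>lborel)"
      by (rule integral_mono) (use idf Hi pw in auto)
    also have "\<dots> = D * ((1 + 1/d) * E j + d * U)"
      unfolding H_def E_def U_def using iu iv ifu igv by simp
    also have "\<dots> \<le> D * ((E j + sqrt (E j)) + d * U)"
    proof -
      have "E j = sqrt (E j) * sqrt (E j)" using E0[of j] by simp
      also have "\<dots> \<le> sqrt (E j) * d" unfolding d_def by (intro mult_left_mono) (use E0[of j] in auto)
      finally have "1/d * E j \<le> sqrt (E j)" using d by (simp add: field_simps)
      then show ?thesis using D(1) by (intro mult_left_mono) (simp_all add: algebra_simps)
    qed
    finally show ?thesis by (simp add: d_def)
  qed
  have "(\<lambda>j. D * ((E j + sqrt (E j)) + (sqrt (E j) + inverse (real (Suc j))) * U)) \<longlonglongrightarrow> D * ((0 + sqrt 0) + (sqrt 0 + 0) * U)"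
    by (intro tendsto_intros E LIMSEQ_inverse_real_of_nat)
  then have "(\<lambda>j. D * ((E j + sqrt (E j)) + (sqrt (E j) + inverse (real (Suc j))) * U)) \<longlonglongrightarrow> 0" by simp
  then have "(\<lambda>j. (\<integral>x. \<phi> x * (f j x * g j x) \<partial>lborel) - (\<integral>x. \<phi> x * (u x * v x) \<partial>lborel)) \<longlonglongrightarrow> 0"
    by (rule Lim_null_comparison[OF always_eventually[OF allI[OF bound]]])
  then show ?thesis by (simp add: LIM_zero_cancel)
qed

section \<open>Mollification\<close>

lemma cball_measurable [measurable]: "cball a r \<in> sets borel" for a :: "'a::euclidean_space"
  by simp

text \<open>
  A nonempty open set is not negligible.
\<close>
lemma continuous_AE_nonneg:
  fixes g :: "'a::euclidean_space \<Rightarrow> real"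
  assumes "open S" "continuous_on S g" "AE x in lborel. x \<in> S \<longrightarrow> 0 \<le> g x" "x \<in> S"
  shows "0 \<le> g x"
proof (rule ccontr)
  assume neg: "\<not> 0 \<le> g x"
  define A where "A = S \<inter> g -` {..<0}"
  have oA: "open A" unfolding A_def by (rule continuous_open_preimage) (use assms in auto)
  have "AE x in lebesgue. x \<notin> A"
    using AE_completion[OF assms(3)] by (rule AE_mp) (auto simp: A_def)
  then have "{x. \<not> x \<notin> A} \<in> null_sets lebesgue" using oA
    by (subst (asm) AE_iff_null) auto
  then have "negligible A" by (simp add: negligible_iff_null_sets)
  then have "A = {}" using oA open_not_negligible by blast
  moreover have "x \<in> A" using neg assms(4) by (simp add: A_def)
  ultimately show False by blast
qed

text \<open>
  A Borel version of \<^const>\<open>L2_loc\<close>. Borel functions stay measurable under composition with continuous maps, as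
  in \<open>(x, y) \<mapsto> u(x - y)\<close>; Lebesgue measurable functions in general do not.
\<close>
definition L2_on_balls :: "('a::euclidean_space \<Rightarrow> real) \<Rightarrow> bool" where
  "L2_on_balls u \<longleftrightarrow> u \<in> borel_measurable borel \<and> (\<forall>r. integrable lborel (\<lambda>x. indicator (cball 0 r) x * (u x)\<^sup>2))"

lemma L2_on_balls_measurable: "L2_on_balls u \<Longrightarrow> u \<in> borel_measurable borel"
  and L2_on_balls_integrable: "L2_on_balls u \<Longrightarrow> integrable lborel (\<lambda>x. indicator (cball 0 r) x * (u x)\<^sup>2)"
  unfolding L2_on_balls_def by blast+

lemma L2_on_balls_integrable_L1:
  assumes "L2_on_balls u"
  shows "integrable lborel (\<lambda>x. indicator (cball 0 r) x * \<bar>u x\<bar>)"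
proof (rule Bochner_Integration.integrable_bound)
  show "integrable lborel (\<lambda>x. indicator (cball (0::'a) r) x *\<^sub>R 1 + indicator (cball 0 r) x * (u x)\<^sup>2)"
    by (intro Bochner_Integration.integrable_add borel_integrable_compact L2_on_balls_integrable assms) auto
  show "AE x in lborel. norm (indicator (cball 0 r) x * \<bar>u x\<bar>) \<le> norm (indicator (cball 0 r) x *\<^sub>R 1 + indicator (cball 0 r) x * (u x)\<^sup>2)"
  proof (rule AE_I2)
    fix x
    have "\<bar>u x\<bar> \<le> 1 + (u x)\<^sup>2" using sum_squares_bound[of 1 "\<bar>u x\<bar>"] by simp
    then show "norm (indicator (cball 0 r) x * \<bar>u x\<bar>) \<le> norm (indicator (cball 0 r) x *\<^sub>R 1 + indicator (cball 0 r) x * (u x)\<^sup>2)"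
      by (simp add: indicator_def)
  qed
  note [measurable] = L2_on_balls_measurable[OF assms]
  show "(\<lambda>x. indicator (cball 0 r) x * \<bar>u x\<bar>) \<in> borel_measurable lborel"
    unfolding measurable_lborel2 by measurable
qed

lemma L2_on_balls_diff:
  assumes "L2_on_balls u" "L2_on_balls v"
  shows "L2_on_balls (\<lambda>x. u x - v x)"
  unfolding L2_on_balls_def
proof (intro conjI allI)
  note [measurable] = L2_on_balls_measurable[OF assms(1)] L2_on_balls_measurable[OF assms(2)]
  show "(\<lambda>x. u x - v x) \<in> borel_measurable borel" by measurable
  fix r
  show "integrable lborel (\<lambda>x. indicator (cball 0 r) x * (u x - v x)\<^sup>2)"
  proof (rule Bochner_Integration.integrable_bound)
    show "integrable lborel (\<lambda>x. 2 * (indicator (cball 0 r) x * (u x)\<^sup>2) + 2 * (indicator (cball 0 r) x * (v x)\<^sup>2))"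
      using assms by (intro Bochner_Integration.integrable_add integrable_mult_right L2_on_balls_integrable)
    show "AE x in lborel. norm (indicator (cball 0 r) x * (u x - v x)\<^sup>2)
      \<le> norm (2 * (indicator (cball 0 r) x * (u x)\<^sup>2) + 2 * (indicator (cball 0 r) x * (v x)\<^sup>2))"
    proof (rule AE_I2)
      fix x
      have "(u x - v x)\<^sup>2 \<le> 2 * (u x)\<^sup>2 + 2 * (v x)\<^sup>2"
        using zero_le_power2[of "u x + v x"] by (simp add: power2_eq_square algebra_simps)
      then show "norm (indicator (cball 0 r) x * (u x - v x)\<^sup>2)
      \<le> norm (2 * (indicator (cball 0 r) x * (u x)\<^sup>2) + 2 * (indicator (cball 0 r) x * (v x)\<^sup>2))"
        by (simp add: indicator_def)
    qed
    show "(\<lambda>x. indicator (cball 0 r) x * (u x - v x)\<^sup>2) \<in> borel_measurable lborel"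
      unfolding measurable_lborel2 by measurable
  qed
qed

lemma L2_on_balls_continuous: "continuous_on UNIV f \<Longrightarrow> L2_on_balls f"
  for f :: "'a::euclidean_space \<Rightarrow> real"
  unfolding L2_on_balls_def
proof (intro conjI allI)
  assume c: "continuous_on UNIV f"
  then show "f \<in> borel_measurable borel" by (rule continuous_imp_borel)
  show "integrable lborel (\<lambda>x. indicator (cball 0 r) x * (f x)\<^sup>2)" for r
    using borel_integrable_compact[of "cball 0 r" "\<lambda>x. (f x)\<^sup>2"] c
    by (auto intro!: continuous_intros intro: continuous_on_subset)
qed

subsection \<open>Convolutions\<close>

definition conv :: "('a::euclidean_space \<Rightarrow> real) \<Rightarrow> ('a \<Rightarrow> real) \<Rightarrow> 'a \<Rightarrow> real" where
  "conv \<psi> u x = (\<integral>y. \<psi> (x - y) * u y \<partial>lborel)"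

lemma conv_integrable:
  fixes u :: "'a::euclidean_space \<Rightarrow> real"
  assumes \<psi>: "continuous_on UNIV \<psi>" "\<And>x. s < norm x \<Longrightarrow> \<psi> x = 0" and u: "L2_on_balls u"
  shows "integrable lborel (\<lambda>y. \<psi> (x - y) * u y)"
proof -
  obtain B where B: "0 \<le> B" "\<And>x. norm x \<le> s \<Longrightarrow> \<bar>\<psi> x\<bar> \<le> B" using continuous_bounded_on_cball[OF \<psi>(1)] by blast
  note [measurable] = L2_on_balls_measurable[OF u] continuous_imp_borel[OF \<psi>(1)]
  show ?thesis
  proof (rule Bochner_Integration.integrable_bound[OF integrable_mult_right[OF L2_on_balls_integrable_L1[OF u, of "norm x + s"], of B]])
    show "AE y in lborel. norm (\<psi> (x - y) * u y) \<le> norm (B * (indicator (cball 0 (norm x + s)) y * \<bar>u y\<bar>))"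
    proof (rule AE_I2)
      fix y
      show "norm (\<psi> (x - y) * u y) \<le> norm (B * (indicator (cball 0 (norm x + s)) y * \<bar>u y\<bar>))"
      proof (cases "norm (x - y) \<le> s")
        case True
        then have "norm y \<le> norm x + s" using norm_triangle_ineq2[of y x] by (simp add: norm_minus_commute)
        with B True show ?thesis by (simp add: abs_mult mult_right_mono)
      qed (simp add: \<psi>(2))
    qed
  qed measurable
qed

text \<open>
  The second-order Taylor remainder of \<open>\<psi>\<close> is bounded by \<open>K \<bar>h\<bar>\<^sup>2\<close> uniformly, since its gradient is
  Lipschitz. Integrating against \<open>u\<close> over the common support gives a remainder of the same order.
\<close>
lemma conv_has_derivative:
  fixes u :: "real ^ 'n::finite \<Rightarrow> real"
  assumes \<psi>: "Ck 2 \<psi>" "\<And>x. s < norm x \<Longrightarrow> \<psi> x = 0" and u: "L2_on_balls u"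
  shows "(conv \<psi> u has_derivative (\<lambda>h. (\<chi> i. conv (partial_deriv i \<psi>) u x) \<bullet> h)) (at x)"
proof -
  have ps: "s < norm x \<Longrightarrow> partial_deriv i \<psi> x = 0" for i x
    by (rule partial_deriv_vanish_outside[of s \<psi>, OF \<psi>(2)])
  have "\<exists>L\<ge>0. \<forall>x y. \<bar>partial_deriv i \<psi> x - partial_deriv i \<psi> y\<bar> \<le> L * norm (x - y)" for i
    using Ck_support_Lipschitz[OF Ck2_D(3)[OF \<psi>(1)] ps] by metis
  then obtain L where L: "\<And>i. 0 \<le> L i" "\<And>i x y. \<bar>partial_deriv i \<psi> x - partial_deriv i \<psi> y\<bar> \<le> L i * norm (x - y)"
    by metis
  define K where "K = (\<Sum>i\<in>UNIV. L i)"
  have K0: "0 \<le> K" unfolding K_def by (intro sum_nonneg L)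
  have gradL: "norm (grad \<psi> v - grad \<psi> w) \<le> K * norm (v - w)" for v w
  proof -
    have "norm (grad \<psi> v - grad \<psi> w) \<le> (\<Sum>i\<in>UNIV. \<bar>(grad \<psi> v - grad \<psi> w) $ i\<bar>)" by (rule norm_le_l1_cart)
    also have "\<dots> \<le> (\<Sum>i\<in>UNIV. L i * norm (v - w))" by (rule sum_mono) (simp add: L)
    finally show ?thesis by (simp add: K_def sum_distrib_right)
  qed
  have taylor: "\<bar>\<psi> (w + h) - \<psi> w - grad \<psi> w \<bullet> h\<bar> \<le> K * (norm h)\<^sup>2" for w h
  proof -
    have "((\<lambda>t. \<psi> (w + t *\<^sub>R h)) has_real_derivative grad \<psi> (w + t *\<^sub>R h) \<bullet> h) (at t)" for t
      by (rule has_real_derivative_along) (rule Ck_differentiable[OF \<psi>(1)], simp)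
    from MVT2[OF zero_less_one this] obtain t where t: "0 < t" "t < 1"
      "\<psi> (w + h) - \<psi> w = grad \<psi> (w + t *\<^sub>R h) \<bullet> h" by auto
    then have "\<bar>\<psi> (w + h) - \<psi> w - grad \<psi> w \<bullet> h\<bar> = \<bar>(grad \<psi> (w + t *\<^sub>R h) - grad \<psi> w) \<bullet> h\<bar>"
      by (simp add: inner_diff_left)
    also have "\<dots> \<le> norm (grad \<psi> (w + t *\<^sub>R h) - grad \<psi> w) * norm h" by (rule Cauchy_Schwarz_ineq2)
    also have "\<dots> \<le> (K * norm (w + t *\<^sub>R h - w)) * norm h" by (intro mult_right_mono gradL) simp
    also have "\<dots> \<le> (K * norm h) * norm h"
      using t K0 by (intro mult_right_mono mult_left_mono) (auto intro: mult_left_le_one_le)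
    finally show ?thesis by (simp add: power2_eq_square)
  qed
  have pc: "continuous_on UNIV (partial_deriv i \<psi>)" for i
    using Ck_imp_continuous[OF Ck2_D(3)[OF \<psi>(1)]] .
  have \<psi>c: "continuous_on UNIV \<psi>" using Ck2_D(2)[OF \<psi>(1)] by simp
  define M where "M = (\<integral>y. indicator (cball 0 (norm x + (s + 1))) y * \<bar>u y\<bar> \<partial>lborel)"
  have M0: "0 \<le> M" unfolding M_def by (intro integral_nonneg_AE) auto
  note iM = L2_on_balls_integrable_L1[OF u, of "norm x + (s + 1)"]
  have dv: "(\<chi> i. conv (partial_deriv i \<psi>) u x) \<bullet> h = (\<integral>y. (grad \<psi> (x - y) \<bullet> h) * u y \<partial>lborel)"
    and di: "integrable lborel (\<lambda>y. (grad \<psi> (x - y) \<bullet> h) * u y)" for h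
  proof -
    have i: "integrable lborel (\<lambda>y. (partial_deriv i \<psi> (x - y) * u y) * h $ i)" for i
      by (intro integrable_mult_left conv_integrable[OF pc ps u])
    have e: "(\<lambda>y. (grad \<psi> (x - y) \<bullet> h) * u y) = (\<lambda>y. \<Sum>i\<in>UNIV. (partial_deriv i \<psi> (x - y) * u y) * h $ i)"
      by (simp add: inner_vec_def sum_distrib_left sum_distrib_right mult_ac)
    show "integrable lborel (\<lambda>y. (grad \<psi> (x - y) \<bullet> h) * u y)" unfolding e by (intro Bochner_Integration.integrable_sum i)
    show "(\<chi> i. conv (partial_deriv i \<psi>) u x) \<bullet> h = (\<integral>y. (grad \<psi> (x - y) \<bullet> h) * u y \<partial>lborel)"
      unfolding e by (subst Bochner_Integration.integral_sum[OF i]) (simp add: inner_vec_def conv_def)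
  qed
  have est: "\<bar>conv \<psi> u (x + h) - conv \<psi> u x - (\<chi> i. conv (partial_deriv i \<psi>) u x) \<bullet> h\<bar> \<le> K * (norm h)\<^sup>2 * M"
    if h: "norm h \<le> 1" for h
  proof -
    have i1: "integrable lborel (\<lambda>y. \<psi> (x + h - y) * u y)" and i2: "integrable lborel (\<lambda>y. \<psi> (x - y) * u y)"
      by (rule conv_integrable[OF \<psi>c _ u], erule \<psi>(2))+
    have "conv \<psi> u (x + h) - conv \<psi> u x - (\<chi> i. conv (partial_deriv i \<psi>) u x) \<bullet> h
      = (\<integral>y. \<psi> (x + h - y) * u y - \<psi> (x - y) * u y - (grad \<psi> (x - y) \<bullet> h) * u y \<partial>lborel)"
      unfolding dv unfolding conv_def using i1 i2 di[of h] by simp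
    also have "\<bar>\<dots>\<bar> \<le> (\<integral>y. K * (norm h)\<^sup>2 * (indicator (cball 0 (norm x + (s + 1))) y * \<bar>u y\<bar>) \<partial>lborel)"
    proof (rule integral_abs_bound[THEN order_trans], rule integral_mono)
      fix y
      show "\<bar>\<psi> (x + h - y) * u y - \<psi> (x - y) * u y - (grad \<psi> (x - y) \<bullet> h) * u y\<bar>
        \<le> K * (norm h)\<^sup>2 * (indicator (cball 0 (norm x + (s + 1))) y * \<bar>u y\<bar>)"
      proof (cases "norm y \<le> norm x + (s + 1)")
        case True
        have "\<bar>\<psi> (x + h - y) * u y - \<psi> (x - y) * u y - (grad \<psi> (x - y) \<bullet> h) * u y\<bar>
          = \<bar>\<psi> ((x - y) + h) - \<psi> (x - y) - grad \<psi> (x - y) \<bullet> h\<bar> * \<bar>u y\<bar>"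
          by (simp add: abs_mult[symmetric] algebra_simps)
        also have "\<dots> \<le> K * (norm h)\<^sup>2 * \<bar>u y\<bar>" by (intro mult_right_mono taylor) simp
        finally show ?thesis using True by simp
      next
        case False
        have "norm y \<le> norm x + norm (x - y)" using norm_triangle_ineq2[of y x] by (simp add: norm_minus_commute)
        moreover have "norm (x - y) \<le> norm (x + h - y) + norm h"
          using norm_triangle_ineq4[of "x + h - y" h] by (simp add: algebra_simps)
        ultimately have "s < norm (x - y)" "s < norm (x + h - y)" using False h by auto
        then have "\<psi> (x + h - y) = 0" "\<psi> (x - y) = 0" "grad \<psi> (x - y) = 0"
          using \<psi>(2) ps by (auto simp: vec_eq_iff)
        then show ?thesis using False by simp
      qed
    qed (use i1 i2 di iM in auto)
    finally show ?thesis by (simp add: M_def)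
  qed
  show ?thesis
    unfolding has_derivative_at_alt
  proof (intro conjI allI impI)
    show "bounded_linear (\<lambda>h. (\<chi> i. conv (partial_deriv i \<psi>) u x) \<bullet> h)" by (rule bounded_linear_inner_right)
    fix e :: real assume e: "0 < e"
    define d where "d = min 1 (e / (K * M + 1))"
    have KM: "0 \<le> K * M" using K0 M0 by simp
    have d: "0 < d" unfolding d_def using e KM by simp
    show "\<exists>d>0. \<forall>y. norm (y - x) < d \<longrightarrow> norm (conv \<psi> u y - conv \<psi> u x - (\<chi> i. conv (partial_deriv i \<psi>) u x) \<bullet> (y - x)) \<le> e * norm (y - x)"
    proof (intro exI[of _ d] conjI allI impI d)
      fix y assume y: "norm (y - x) < d"
      then have n1: "norm (y - x) \<le> 1" and n2: "norm (y - x) \<le> e / (K * M + 1)" by (auto simp: d_def)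
      have n: "norm (y - x) * (K * M + 1) \<le> e" using n2 KM by (simp add: field_simps)
      have n3: "norm (y - x) * (K * M) \<le> e" by (rule order_trans[OF _ n]) (simp add: algebra_simps)
      have "\<bar>conv \<psi> u y - conv \<psi> u x - (\<chi> i. conv (partial_deriv i \<psi>) u x) \<bullet> (y - x)\<bar> \<le> K * (norm (y - x))\<^sup>2 * M"
        using est[OF n1] by simp
      also have "\<dots> = (norm (y - x) * (K * M)) * norm (y - x)" by (simp add: power2_eq_square)
      also have "\<dots> \<le> e * norm (y - x)" by (intro mult_right_mono n3) simp
      finally show "norm (conv \<psi> u y - conv \<psi> u x - (\<chi> i. conv (partial_deriv i \<psi>) u x) \<bullet> (y - x)) \<le> e * norm (y - x)" by simp
    qed
  qed
qed

lemma conv_partial_deriv: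
  fixes u :: "real ^ 'n::finite \<Rightarrow> real"
  assumes "Ck 2 \<psi>" "\<And>x. s < norm x \<Longrightarrow> \<psi> x = 0" "L2_on_balls u"
  shows "partial_deriv i (conv \<psi> u) = conv (partial_deriv i \<psi>) u"
  using partial_deriv_eqI[OF conv_has_derivative[OF assms]] by (auto simp: inner_axis)

text \<open>
  Differentiation falls on the kernel, whose partial derivatives are again smooth with the same support:
  hence an induction over all kernels.
\<close>
lemma conv_Ck:
  fixes u :: "real ^ 'n::finite \<Rightarrow> real"
  assumes "\<And>k. Ck k \<psi>" "\<And>x. s < norm x \<Longrightarrow> \<psi> x = 0" "L2_on_balls u"
  shows "Ck k (conv \<psi> u)"
  using assms
proof (induction k arbitrary: \<psi>)
  case 0
  have "isCont (conv \<psi> u) x" for x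
    using has_derivative_continuous[OF conv_has_derivative[OF 0(1) 0(2) 0(3)]] .
  then show ?case by (simp add: continuous_on_eq_continuous_at)
next
  case (Suc k)
  have "Ck k (partial_deriv i (conv \<psi> u))" for i
  proof -
    have e: "partial_deriv i (conv \<psi> u) = conv (partial_deriv i \<psi>) u"
      by (rule conv_partial_deriv[OF Suc.prems(1) _ Suc.prems(3)]) (rule Suc.prems(2))
    show ?thesis unfolding e
      by (rule Suc.IH[OF _ partial_deriv_vanish_outside[of s \<psi>, OF Suc.prems(2)] Suc.prems(3)])
       (use Suc.prems(1)[of "Suc _"] in auto)
  qed
  moreover have "conv \<psi> u differentiable (at x)" for x
    using conv_has_derivative[OF Suc.prems(1,2,3)] unfolding differentiable_def by blast
  ultimately show ?case by simp
qed

lemma partial_deriv_reflect: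
  fixes \<psi> :: "real ^ 'n::finite \<Rightarrow> real"
  assumes "\<And>x. \<psi> differentiable (at x)"
  shows "partial_deriv i (\<lambda>y. \<psi> (x - y)) = (\<lambda>y. - partial_deriv i \<psi> (x - y))"
    and "(\<lambda>y. \<psi> (x - y)) differentiable (at y)"
proof -
  have d: "((\<lambda>y. \<psi> (x - y)) has_derivative (\<lambda>h. grad \<psi> (x - y) \<bullet> (- h))) (at y)" for y
  proof -
    have "((\<lambda>y. x - y) has_derivative (\<lambda>h. - h)) (at y)"
      by (auto intro!: derivative_eq_intros)
    from has_derivative_compose[OF this has_derivative_grad[OF assms]] show ?thesis .
  qed
  show "partial_deriv i (\<lambda>y. \<psi> (x - y)) = (\<lambda>y. - partial_deriv i \<psi> (x - y))"
    using partial_deriv_eqI[OF d] by (auto simp: inner_axis inner_minus_right)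
  show "(\<lambda>y. \<psi> (x - y)) differentiable (at y)" using d unfolding differentiable_def by blast
qed

lemma Ck_reflect:
  fixes \<psi> :: "real ^ 'n::finite \<Rightarrow> real"
  assumes "Ck k \<psi>"
  shows "Ck k (\<lambda>y. \<psi> (x - y))"
  using assms
proof (induction k arbitrary: \<psi>)
  case 0
  then show ?case by (auto intro!: continuous_intros continuous_on_compose2[of UNIV \<psi>])
next
  case (Suc k)
  then have d: "\<And>x. \<psi> differentiable (at x)" by simp
  show ?case
    using Suc by (auto simp: partial_deriv_reflect[OF d] intro!: Ck_uminus)
qed

lemma laplacian_reflect:
  assumes "Ck 2 \<psi>"
  shows "laplacian (\<lambda>y. \<psi> (x - y)) y = laplacian \<psi> (x - y)"
proof -
  have d: "\<psi> differentiable (at x)" "partial_deriv i \<psi> differentiable (at x)" for x i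
    using Ck_differentiable[OF assms] Ck_differentiable[OF Ck2_D(3)[OF assms]] by auto
  show ?thesis unfolding laplacian_def
    by (simp add: partial_deriv_reflect[OF d(1)] partial_deriv_uminus partial_deriv_reflect[OF d(2)])
qed

lemma test_function_intro:
  assumes "\<And>k. Ck k \<phi>" "\<And>x. s < norm x \<Longrightarrow> \<phi> x = 0"
  shows "test_function \<phi>"
proof -
  have "{x. \<phi> x \<noteq> 0} \<subseteq> cball 0 s" using assms(2) by (auto simp: not_less[symmetric])
  then have "bounded {x. \<phi> x \<noteq> 0}" using bounded_cball bounded_subset by blast
  then show ?thesis using assms(1) by (simp add: test_function_def compact_closure)
qed

text \<open>
  The function \<open>y \<mapsto> \<psi>(x - y)\<close> is a test function with Laplacian \<open>\<Delta>\<psi>(x - y)\<close>, so the weak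
  equation for \<open>u\<close> becomes a pointwise equation for the convolution.
\<close>
lemma laplacian_conv:
  fixes u F :: "real ^ 'n::finite \<Rightarrow> real"
  assumes \<psi>: "\<And>k. Ck k \<psi>" "\<And>x. s < norm x \<Longrightarrow> \<psi> x = 0" and u: "L2_on_balls u"
    and weak: "\<And>\<phi>. test_function \<phi> \<Longrightarrow> (\<integral>y. u y * laplacian \<phi> y \<partial>lborel) = - (\<integral>y. F y * \<phi> y \<partial>lborel)"
  shows "laplacian (conv \<psi> u) x = - conv \<psi> F x"
proof -
  have p: "\<And>k. Ck k (partial_deriv i \<psi>)" for i using \<psi>(1)[of "Suc _"] by simp
  note ps = partial_deriv_vanish_outside[of s \<psi>, OF \<psi>(2)]
  have pp: "continuous_on UNIV (partial_deriv i (partial_deriv i \<psi>))" for i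
    using p[of 1 i] by simp
  have pps: "partial_deriv i (partial_deriv i \<psi>) x = 0" if "s < norm x" for i x
    by (rule partial_deriv_vanish_outside[OF ps that])
  have "laplacian (conv \<psi> u) x = (\<Sum>i\<in>UNIV. conv (partial_deriv i (partial_deriv i \<psi>)) u x)"
  proof -
    have e: "partial_deriv i (conv \<psi> u) = conv (partial_deriv i \<psi>) u" for i
      by (rule conv_partial_deriv[OF \<psi>(1) _ u]) (rule \<psi>(2))
    have e2: "partial_deriv i (conv (partial_deriv i \<psi>) u) = conv (partial_deriv i (partial_deriv i \<psi>)) u" for i
      by (rule conv_partial_deriv[OF p _ u]) (rule ps)
    show ?thesis unfolding laplacian_def e e2 ..
  qed
  also have "\<dots> = (\<integral>y. laplacian \<psi> (x - y) * u y \<partial>lborel)"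
    unfolding conv_def laplacian_def sum_distrib_right
    by (rule Bochner_Integration.integral_sum[symmetric]) (rule conv_integrable[OF pp pps u])
  also have "\<dots> = (\<integral>y. u y * laplacian (\<lambda>y. \<psi> (x - y)) y \<partial>lborel)"
    by (simp add: laplacian_reflect[OF \<psi>(1)] mult.commute)
  also have "\<dots> = - (\<integral>y. F y * \<psi> (x - y) \<partial>lborel)"
  proof (rule weak, rule test_function_intro)
    show "Ck k (\<lambda>y. \<psi> (x - y))" for k by (rule Ck_reflect[OF \<psi>(1)])
    show "\<psi> (x - y) = 0" if "norm x + s < norm y" for y
      using that norm_triangle_ineq2[of y x] by (intro \<psi>(2)) (simp add: norm_minus_commute)
  qed
  finally show ?thesis by (simp add: conv_def mult.commute)
qed

text \<open>
  Truncate \<open>u\<close> at height \<open>N\<close>, then approximate almost everywhere by continuous functions truncated at the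
  same height: dominated convergence applies twice.
\<close>
lemma continuous_dense_L2_cball:
  fixes u :: "'a::euclidean_space \<Rightarrow> real"
  assumes u: "L2_on_balls u" and e: "0 < e"
  obtains g where "continuous_on UNIV g"
    "(\<integral>x. indicator (cball 0 r) x * (u x - g x)\<^sup>2 \<partial>lborel) < e"
proof -
  note um[measurable] = L2_on_balls_measurable[OF u]
  let ?I = "indicator (cball 0 r) :: 'a \<Rightarrow> real"
  define T where "T N y = max (- real N) (min (real N) y)" for N y
  have Tm[measurable]: "T N \<in> borel_measurable borel" for N unfolding T_def by measurable
  have Tb: "\<bar>T N y\<bar> \<le> real N" for N y by (auto simp: T_def max_def min_def)
  have Tle: "\<bar>y - T N y\<bar> \<le> \<bar>y\<bar>" for N y by (auto simp: T_def max_def min_def)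
  have Tlim: "(\<lambda>N. y - T N y) \<longlonglongrightarrow> 0" for y
  proof (rule tendsto_eventually)
    obtain N0 :: nat where "\<bar>y\<bar> \<le> real N0" using real_arch_simple by blast
    then show "\<forall>\<^sub>F N in sequentially. y - T N y = 0"
      unfolding eventually_sequentially by (intro exI[of _ N0]) (auto simp: T_def max_def min_def)
  qed
  have Tc: "continuous_on UNIV (\<lambda>x. T N (h x))" if "continuous_on UNIV h" for N and h :: "'a \<Rightarrow> real"
    unfolding T_def by (intro continuous_intros that)
  have "(\<lambda>N. \<integral>x. ?I x * (u x - T N (u x))\<^sup>2 \<partial>lborel) \<longlonglongrightarrow> (\<integral>x. 0 \<partial>(lborel::'a measure))"
  proof (rule integral_dominated_convergence[where w = "\<lambda>x. ?I x * (u x)\<^sup>2"])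
    show "integrable lborel (\<lambda>x. ?I x * (u x)\<^sup>2)" by (rule L2_on_balls_integrable[OF u])
    show "AE x in lborel. (\<lambda>N. ?I x * (u x - T N (u x))\<^sup>2) \<longlonglongrightarrow> 0"
      using tendsto_mult[OF tendsto_const tendsto_power[OF Tlim, of _ 2]] by (intro AE_I2) force
    show "AE x in lborel. norm (?I x * (u x - T N (u x))\<^sup>2) \<le> ?I x * (u x)\<^sup>2" for N
    proof (rule AE_I2)
      fix x
      have "(u x - T N (u x))\<^sup>2 \<le> (u x)\<^sup>2" using Tle[of "u x" N] by (simp add: abs_le_square_iff)
      then show "norm (?I x * (u x - T N (u x))\<^sup>2) \<le> ?I x * (u x)\<^sup>2" by (simp add: indicator_def)
    qed
  qed (unfold measurable_lborel2, measurable)+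
  then have "\<forall>\<^sub>F N in sequentially. (\<integral>x. ?I x * (u x - T N (u x))\<^sup>2 \<partial>lborel) < e / 4"
    using e by (intro order_tendstoD(2)[where a = "e/4"]) auto
  then obtain N where N: "(\<integral>x. ?I x * (u x - T N (u x))\<^sup>2 \<partial>lborel) < e / 4"
    by (auto simp: eventually_sequentially)
  have "u \<in> borel_measurable lebesgue" using um by (simp add: measurable_completion)
  then have "u measurable_on UNIV" by (rule lebesgue_measurable_imp_measurable_on_real) simp
  then obtain Z g where Z: "negligible Z" and g: "\<And>n. continuous_on UNIV (g n)"
    "\<And>x. x \<notin> Z \<Longrightarrow> (\<lambda>n. g n x) \<longlonglongrightarrow> u x"
    unfolding measurable_on_def by auto
  have gm[measurable]: "g n \<in> borel_measurable borel" for n by (rule continuous_imp_borel[OF g(1)])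
  have AEZ: "AE x in lborel. x \<notin> Z"
  proof -
    have "AE x in lebesgue. x \<notin> Z" by (rule AE_not_in) (use Z in \<open>simp add: negligible_iff_null_sets\<close>)
    then show ?thesis by (simp only: AE_completion_iff)
  qed
  have "(\<lambda>n. \<integral>x. ?I x * (T N (u x) - T N (g n x))\<^sup>2 \<partial>lborel) \<longlonglongrightarrow> (\<integral>x. 0 \<partial>(lborel::'a measure))"
  proof (rule integral_dominated_convergence[where w = "\<lambda>x. ?I x *\<^sub>R (2 * real N)\<^sup>2"])
    show "integrable lborel (\<lambda>x. ?I x *\<^sub>R (2 * real N)\<^sup>2)" by (rule borel_integrable_compact) auto
    show "AE x in lborel. (\<lambda>n. ?I x * (T N (u x) - T N (g n x))\<^sup>2) \<longlonglongrightarrow> 0"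
      using AEZ
    proof (rule AE_mp, intro AE_I2 impI)
      fix x assume "x \<notin> Z"
      have "(\<lambda>n. T N (g n x)) \<longlonglongrightarrow> T N (u x)" unfolding T_def by (intro tendsto_intros g(2) \<open>x \<notin> Z\<close>)
      then have "(\<lambda>n. ?I x * (T N (u x) - T N (g n x))\<^sup>2) \<longlonglongrightarrow> ?I x * (T N (u x) - T N (u x))\<^sup>2"
        by (intro tendsto_intros)
      then show "(\<lambda>n. ?I x * (T N (u x) - T N (g n x))\<^sup>2) \<longlonglongrightarrow> 0" by simp
    qed
    show "AE x in lborel. norm (?I x * (T N (u x) - T N (g n x))\<^sup>2) \<le> ?I x *\<^sub>R (2 * real N)\<^sup>2" for n
    proof (rule AE_I2)
      fix x
      have "\<bar>T N (u x) - T N (g n x)\<bar> \<le> \<bar>2 * real N\<bar>" using Tb[of N "u x"] Tb[of N "g n x"] by linarith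
      then have "(T N (u x) - T N (g n x))\<^sup>2 \<le> (2 * real N)\<^sup>2" unfolding abs_le_square_iff .
      then show "norm (?I x * (T N (u x) - T N (g n x))\<^sup>2) \<le> ?I x *\<^sub>R (2 * real N)\<^sup>2" by (simp add: indicator_def)
    qed
  qed (unfold measurable_lborel2, measurable)+
  then have "\<forall>\<^sub>F n in sequentially. (\<integral>x. ?I x * (T N (u x) - T N (g n x))\<^sup>2 \<partial>lborel) < e / 4"
    using e by (intro order_tendstoD(2)[where a = "e/4"]) auto
  then obtain n where n: "(\<integral>x. ?I x * (T N (u x) - T N (g n x))\<^sup>2 \<partial>lborel) < e / 4"
    by (auto simp: eventually_sequentially)
  have L: "L2_on_balls (\<lambda>x. T N (g n x))" by (rule L2_on_balls_continuous[OF Tc[OF g(1)]])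
  have L': "L2_on_balls (\<lambda>x. T N (u x))"
    unfolding L2_on_balls_def
  proof (intro conjI allI)
    show "(\<lambda>x. T N (u x)) \<in> borel_measurable borel" by measurable
    show "integrable lborel (\<lambda>x. indicator (cball 0 r) x * (T N (u x))\<^sup>2)" for r
    proof (rule Bochner_Integration.integrable_bound)
      show "integrable lborel (\<lambda>x. indicator (cball (0::'a) r) x *\<^sub>R (real N)\<^sup>2)" by (rule borel_integrable_compact) auto
      show "AE x in lborel. norm (indicator (cball 0 r) x * (T N (u x))\<^sup>2) \<le> norm (indicator (cball 0 r) x *\<^sub>R (real N)\<^sup>2)"
        using Tb by (intro AE_I2) (simp add: indicator_def abs_le_square_iff[symmetric])
    qed (unfold measurable_lborel2, measurable)+
  qed
  have "(\<integral>x. ?I x * (u x - T N (g n x))\<^sup>2 \<partial>lborel)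
    \<le> (\<integral>x. 2 * (?I x * (u x - T N (u x))\<^sup>2) + 2 * (?I x * (T N (u x) - T N (g n x))\<^sup>2) \<partial>lborel)"
  proof (rule integral_mono)
    fix x
    have "(u x - T N (g n x))\<^sup>2 \<le> 2 * (u x - T N (u x))\<^sup>2 + 2 * (T N (u x) - T N (g n x))\<^sup>2"
      using zero_le_power2[of "(u x - T N (u x)) - (T N (u x) - T N (g n x))"] by (simp add: power2_eq_square algebra_simps)
    then show "?I x * (u x - T N (g n x))\<^sup>2 \<le> 2 * (?I x * (u x - T N (u x))\<^sup>2) + 2 * (?I x * (T N (u x) - T N (g n x))\<^sup>2)"
      by (simp add: indicator_def)
  qed (intro L2_on_balls_integrable L2_on_balls_diff u L L' Bochner_Integration.integrable_add integrable_mult_right)+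
  also have "\<dots> = 2 * (\<integral>x. ?I x * (u x - T N (u x))\<^sup>2 \<partial>lborel) + 2 * (\<integral>x. ?I x * (T N (u x) - T N (g n x))\<^sup>2 \<partial>lborel)"
    by (simp add: L2_on_balls_integrable L2_on_balls_diff u L L')
  also have "\<dots> < e" using N n by simp
  finally show ?thesis by (rule that[OF Tc[OF g(1)]])
qed

lemma nn_integral_lborel_translation:
  fixes f :: "'a::euclidean_space \<Rightarrow> ennreal"
  assumes [measurable]: "f \<in> borel_measurable borel"
  shows "(\<integral>\<^sup>+x. f (a + x) \<partial>lborel) = (\<integral>\<^sup>+x. f x \<partial>lborel)"
proof -
  have "(\<integral>\<^sup>+x. f x \<partial>lborel) = (\<integral>\<^sup>+x. f x \<partial>(distr lborel borel ((+) a)))"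
    by (simp add: lborel_distr_plus)
  also have "\<dots> = (\<integral>\<^sup>+x. f (a + x) \<partial>lborel)"
    by (rule nn_integral_distr) auto
  finally show ?thesis by simp
qed

lemma integral_lborel_reflect:
  fixes f :: "'a::euclidean_space \<Rightarrow> real"
  assumes "f \<in> borel_measurable borel"
  shows "(\<integral>y. f (x - y) \<partial>lborel) = (\<integral>y. f y \<partial>lborel)"
proof -
  have "lborel = density (distr lborel borel (\<lambda>y. x + (-1) *\<^sub>R y)) (\<lambda>_. ennreal (\<bar>-1\<bar> ^ DIM('a)))"
    by (rule lborel_affine) simp
  then have "lborel = distr lborel borel (\<lambda>y. x - y)" by (simp add: density_1)
  then have "(\<integral>y. f y \<partial>lborel) = (\<integral>y. f y \<partial>(distr lborel borel (\<lambda>y. x - y)))" by simp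
  also have "\<dots> = (\<integral>y. f (x - y) \<partial>lborel)" by (rule integral_distr) (use assms in auto)
  finally show ?thesis by simp
qed

text \<open>
  The bound \<open>s \<le> 1\<close> lets a single larger ball, of radius \<open>r + 1\<close>, serve for all kernels of a sequence.
\<close>
locale mollifier =
  fixes \<kappa> :: "'a::euclidean_space \<Rightarrow> real" and s :: real
  assumes cont: "continuous_on UNIV \<kappa>"
    and nonneg: "\<And>x. 0 \<le> \<kappa> x"
    and supp: "\<And>x. s < norm x \<Longrightarrow> \<kappa> x = 0"
    and mass: "(\<integral>x. \<kappa> x \<partial>lborel) = 1"
    and s: "0 \<le> s" "s \<le> 1"
begin

lemma km[measurable]: "\<kappa> \<in> borel_measurable borel"
  by (rule continuous_imp_borel[OF cont])

lemma integrable_kernel: "integrable lborel (\<lambda>y. \<kappa> (x - y))" "integrable lborel \<kappa>"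
  using conv_integrable[OF cont supp L2_on_balls_continuous[OF continuous_on_const[of UNIV 1]], of s x]
    integrable_continuous_support[OF cont supp] by auto

lemma mass': "(\<integral>y. \<kappa> (x - y) \<partial>lborel) = 1"
  using integral_lborel_reflect[OF km] mass by simp

lemma conv_measurable:
  assumes [measurable]: "u \<in> borel_measurable borel"
  shows "conv \<kappa> u \<in> borel_measurable borel"
proof -
  have "(\<lambda>x. \<integral>y. \<kappa> (x - y) * u y \<partial>lborel) \<in> borel_measurable lborel"
    by (rule lborel.borel_measurable_lebesgue_integral) (simp add: case_prod_beta', measurable)
  then show ?thesis by (simp add: conv_def[abs_def])
qed

text \<open>
  Jensen's inequality bounds the square of the mean \<open>conv \<kappa> u\<close> by the mean of \<open>u\<^sup>2\<close>; exchange the order of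
  integration and use that the kernel has mass \<open>1\<close>.
\<close>
lemma conv_L2_bound:
  assumes u: "L2_on_balls u"
  shows "integrable lborel (\<lambda>x. indicator (cball 0 r) x * (conv \<kappa> u x)\<^sup>2)"
    and "(\<integral>x. indicator (cball 0 r) x * (conv \<kappa> u x)\<^sup>2 \<partial>lborel)
      \<le> (\<integral>x. indicator (cball 0 (r + 1)) x * (u x)\<^sup>2 \<partial>lborel)"
proof -
  note um[measurable] = L2_on_balls_measurable[OF u]
  note cm[measurable] = conv_measurable[OF um]
  have jensen: "ennreal ((conv \<kappa> u x)\<^sup>2) \<le> (\<integral>\<^sup>+y. ennreal (\<kappa> (x - y) * (u y)\<^sup>2) \<partial>lborel)" for x
  proof -
    have i1: "integrable lborel (\<lambda>y. \<kappa> (x - y) * u y)"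
      by (rule conv_integrable[OF cont _ u]) (erule supp)
    have i2: "integrable lborel (\<lambda>y. \<kappa> (x - y) * (u y)\<^sup>2)"
    proof -
      obtain B where B: "0 \<le> B" "\<And>x. norm x \<le> s \<Longrightarrow> \<bar>\<kappa> x\<bar> \<le> B" using continuous_bounded_on_cball[OF cont] by blast
      show ?thesis
      proof (rule Bochner_Integration.integrable_bound[OF integrable_mult_right[OF L2_on_balls_integrable[OF u, of "norm x + s"], of B]])
        show "AE y in lborel. norm (\<kappa> (x - y) * (u y)\<^sup>2) \<le> norm (B * (indicator (cball 0 (norm x + s)) y * (u y)\<^sup>2))"
        proof (rule AE_I2)
          fix y
          show "norm (\<kappa> (x - y) * (u y)\<^sup>2) \<le> norm (B * (indicator (cball 0 (norm x + s)) y * (u y)\<^sup>2))"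
          proof (cases "norm (x - y) \<le> s")
            case True
            then have "norm y \<le> norm x + s" using norm_triangle_ineq2[of y x] by (simp add: norm_minus_commute)
            with B True show ?thesis by (simp add: abs_mult mult_right_mono)
          qed (simp add: supp)
        qed
        have "(\<lambda>y. \<kappa> (x - y)) \<in> borel_measurable borel" by (rule measurable_compose[OF _ km]) simp
        then show "(\<lambda>y. \<kappa> (x - y) * (u y)\<^sup>2) \<in> borel_measurable lborel"
          unfolding measurable_lborel2 by (intro borel_measurable_times borel_measurable_power um)
      qed
    qed
    \<comment> \<open>Jensen's inequality as nonnegativity of the variance.\<close>
    define c where "c = conv \<kappa> u x"
    have "0 \<le> (\<integral>y. \<kappa> (x - y) * (u y - c)\<^sup>2 \<partial>lborel)"
      by (intro integral_nonneg_AE AE_I2) (simp add: nonneg)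
    also have "\<dots> = (\<integral>y. \<kappa> (x - y) * (u y)\<^sup>2 - 2 * c * (\<kappa> (x - y) * u y) + c\<^sup>2 * \<kappa> (x - y) \<partial>lborel)"
      by (rule Bochner_Integration.integral_cong[OF refl]) (simp add: power2_eq_square algebra_simps)
    also have "\<dots> = (\<integral>y. \<kappa> (x - y) * (u y)\<^sup>2 \<partial>lborel) - 2 * c * c + c\<^sup>2 * 1"
      using i1 i2 integrable_kernel by (simp add: c_def conv_def mass')
    finally have "c\<^sup>2 \<le> (\<integral>y. \<kappa> (x - y) * (u y)\<^sup>2 \<partial>lborel)" by (simp add: power2_eq_square)
    then have "ennreal (c\<^sup>2) \<le> ennreal (\<integral>y. \<kappa> (x - y) * (u y)\<^sup>2 \<partial>lborel)" by (rule ennreal_leI)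
    also have "\<dots> = (\<integral>\<^sup>+y. ennreal (\<kappa> (x - y) * (u y)\<^sup>2) \<partial>lborel)"
      by (rule nn_integral_eq_integral[symmetric, OF i2]) (simp add: nonneg)
    finally show ?thesis by (simp add: c_def)
  qed
  have "(\<integral>\<^sup>+x. ennreal (indicator (cball 0 r) x * (conv \<kappa> u x)\<^sup>2) \<partial>lborel)
    \<le> (\<integral>\<^sup>+x. (\<integral>\<^sup>+y. indicator (cball 0 r) x * ennreal (\<kappa> (x - y) * (u y)\<^sup>2) \<partial>lborel) \<partial>lborel)"
  proof (rule nn_integral_mono)
    fix x :: 'a
    show "ennreal (indicator (cball 0 r) x * (conv \<kappa> u x)\<^sup>2)
      \<le> (\<integral>\<^sup>+y. indicator (cball 0 r) x * ennreal (\<kappa> (x - y) * (u y)\<^sup>2) \<partial>lborel)"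
      using jensen[of x] by (cases "x \<in> cball 0 r") auto
  qed
  also have "\<dots> = (\<integral>\<^sup>+y. (\<integral>\<^sup>+x. indicator (cball 0 r) x * ennreal (\<kappa> (x - y) * (u y)\<^sup>2) \<partial>lborel) \<partial>lborel)"
    by (rule lborel_pair.Fubini') (simp add: case_prod_beta', measurable)
  also have "\<dots> \<le> (\<integral>\<^sup>+y. ennreal (indicator (cball 0 (r + 1)) y * (u y)\<^sup>2) \<partial>lborel)"
  proof (rule nn_integral_mono)
    fix y :: 'a
    show "(\<integral>\<^sup>+x. indicator (cball 0 r) x * ennreal (\<kappa> (x - y) * (u y)\<^sup>2) \<partial>lborel)
      \<le> ennreal (indicator (cball 0 (r + 1)) y * (u y)\<^sup>2)"
    proof (cases "norm y \<le> r + 1")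
      case True
      have "(\<integral>\<^sup>+x. indicator (cball 0 r) x * ennreal (\<kappa> (x - y) * (u y)\<^sup>2) \<partial>lborel)
        \<le> (\<integral>\<^sup>+x. ennreal ((u y)\<^sup>2) * ennreal (\<kappa> (- y + x)) \<partial>lborel)"
        by (rule nn_integral_mono) (auto simp: indicator_def ennreal_mult nonneg mult.commute)
      also have "\<dots> = ennreal ((u y)\<^sup>2) * (\<integral>\<^sup>+x. ennreal (\<kappa> (- y + x)) \<partial>lborel)"
        by (rule nn_integral_cmult) (unfold measurable_lborel2, measurable)+
      also have "(\<integral>\<^sup>+x. ennreal (\<kappa> (- y + x)) \<partial>lborel) = (\<integral>\<^sup>+x. ennreal (\<kappa> x) \<partial>lborel)"
        by (rule nn_integral_lborel_translation) measurable
      also have "\<dots> = ennreal 1"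
        unfolding mass[symmetric] by (rule nn_integral_eq_integral[OF integrable_kernel(2)]) (simp add: nonneg)
      finally show ?thesis using True by simp
    next
      case False
      have "indicator (cball 0 r) x * ennreal (\<kappa> (x - y) * (u y)\<^sup>2) = 0" for x
      proof (cases "norm x \<le> r")
        case True
        then have "s < norm (x - y)" using False s norm_triangle_ineq2[of y x] by (simp add: norm_minus_commute)
        then show ?thesis by (simp add: supp)
      qed simp
      then have "(\<lambda>x. indicator (cball 0 r) x * ennreal (\<kappa> (x - y) * (u y)\<^sup>2)) = (\<lambda>x. 0)" by blast
      then show ?thesis by (simp only: nn_integral_const)  simp
    qed
  qed
  also have "\<dots> = ennreal (\<integral>y. indicator (cball 0 (r + 1)) y * (u y)\<^sup>2 \<partial>lborel)"
    by (rule nn_integral_eq_integral[OF L2_on_balls_integrable[OF u]]) simp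
  finally have le: "(\<integral>\<^sup>+x. ennreal (indicator (cball 0 r) x * (conv \<kappa> u x)\<^sup>2) \<partial>lborel)
    \<le> ennreal (\<integral>y. indicator (cball 0 (r + 1)) y * (u y)\<^sup>2 \<partial>lborel)" .
  show i: "integrable lborel (\<lambda>x. indicator (cball 0 r) x * (conv \<kappa> u x)\<^sup>2)"
  proof (rule integrableI_bounded)
    show "(\<lambda>x. indicator (cball 0 r) x * (conv \<kappa> u x)\<^sup>2) \<in> borel_measurable lborel"
      unfolding measurable_lborel2 by measurable
    have "(\<integral>\<^sup>+x. ennreal (norm (indicator (cball 0 r) x * (conv \<kappa> u x)\<^sup>2)) \<partial>lborel)
      = (\<integral>\<^sup>+x. ennreal (indicator (cball 0 r) x * (conv \<kappa> u x)\<^sup>2) \<partial>lborel)" by simp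
    also have "\<dots> < \<infinity>" using le by (rule le_less_trans) simp
    finally show "(\<integral>\<^sup>+x. ennreal (norm (indicator (cball 0 r) x * (conv \<kappa> u x)\<^sup>2)) \<partial>lborel) < \<infinity>" .
  qed
  have "ennreal (\<integral>x. indicator (cball 0 r) x * (conv \<kappa> u x)\<^sup>2 \<partial>lborel)
    = (\<integral>\<^sup>+x. ennreal (indicator (cball 0 r) x * (conv \<kappa> u x)\<^sup>2) \<partial>lborel)"
    by (rule nn_integral_eq_integral[symmetric, OF i]) simp
  then have "ennreal (\<integral>x. indicator (cball 0 r) x * (conv \<kappa> u x)\<^sup>2 \<partial>lborel)
    \<le> ennreal (\<integral>x. indicator (cball 0 (r + 1)) x * (u x)\<^sup>2 \<partial>lborel)" using le by simp
  then show "(\<integral>x. indicator (cball 0 r) x * (conv \<kappa> u x)\<^sup>2 \<partial>lborel)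
      \<le> (\<integral>x. indicator (cball 0 (r + 1)) x * (u x)\<^sup>2 \<partial>lborel)"
    by (rule ennreal_le_iff[THEN iffD1, rotated]) (intro integral_nonneg_AE AE_I2, simp)
qed

lemma L2_on_balls_conv: "L2_on_balls u \<Longrightarrow> L2_on_balls (conv \<kappa> u)"
  using conv_L2_bound(1) conv_measurable L2_on_balls_measurable unfolding L2_on_balls_def by blast

lemma conv_diff:
  assumes "L2_on_balls u" "L2_on_balls v"
  shows "conv \<kappa> (\<lambda>x. u x - v x) x = conv \<kappa> u x - conv \<kappa> v x"
proof -
  have "integrable lborel (\<lambda>y. \<kappa> (x - y) * u y)" "integrable lborel (\<lambda>y. \<kappa> (x - y) * v y)"
    by (rule conv_integrable[OF cont _ assms(1)] conv_integrable[OF cont _ assms(2)], erule supp)+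
  then show ?thesis by (simp add: conv_def right_diff_distrib)
qed

lemma conv_uniform:
  assumes g: "continuous_on UNIV g" and d: "\<And>y. norm (x - y) \<le> s \<Longrightarrow> \<bar>g y - g x\<bar> \<le> d"
  shows "\<bar>conv \<kappa> g x - g x\<bar> \<le> d"
proof -
  have i: "integrable lborel (\<lambda>y. \<kappa> (x - y) * g y)"
    by (rule conv_integrable[OF cont _ L2_on_balls_continuous[OF g]]) (erule supp)
  have "conv \<kappa> g x - g x = (\<integral>y. \<kappa> (x - y) * g y - g x * \<kappa> (x - y) \<partial>lborel)"
    using i integrable_kernel by (simp add: conv_def mass')
  also have "\<bar>\<dots>\<bar> \<le> (\<integral>y. d * \<kappa> (x - y) \<partial>lborel)"
  proof (rule integral_abs_bound[THEN order_trans], rule integral_mono)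
    fix y
    show "\<bar>\<kappa> (x - y) * g y - g x * \<kappa> (x - y)\<bar> \<le> d * \<kappa> (x - y)"
    proof (cases "norm (x - y) \<le> s")
      case True
      have "\<bar>\<kappa> (x - y) * g y - g x * \<kappa> (x - y)\<bar> = \<bar>\<kappa> (x - y) * (g y - g x)\<bar>"
        by (simp add: algebra_simps)
      also have "\<dots> = \<bar>g y - g x\<bar> * \<kappa> (x - y)" by (simp add: abs_mult nonneg)
      also have "\<dots> \<le> d * \<kappa> (x - y)" by (intro mult_right_mono d True nonneg)
      finally show ?thesis .
    qed (simp add: supp)
  qed (use i integrable_kernel in auto)
  also have "\<dots> = d" by (simp add: mass')
  finally show ?thesis .
qed

end

text \<open>
  For continuous functions the convergence is uniform on balls. The general case follows by density, as
  convolution is bounded in \<open>L\<^sup>2\<close> uniformly in the kernel.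
\<close>
lemma conv_tendsto_L2:
  fixes u :: "'a::euclidean_space \<Rightarrow> real"
  assumes m: "\<And>j. mollifier (\<kappa> j) (s j)" and s: "s \<longlonglongrightarrow> 0" and u: "L2_on_balls u"
  shows "(\<lambda>j. \<integral>x. indicator (cball 0 r) x * (conv (\<kappa> j) u x - u x)\<^sup>2 \<partial>lborel) \<longlonglongrightarrow> 0"
proof (rule LIMSEQ_I)
  fix e :: real assume e: "0 < e"
  let ?I = "indicator (cball 0 r) :: 'a \<Rightarrow> real"
  obtain g where g: "continuous_on UNIV g" "(\<integral>x. indicator (cball 0 (r+1)) x * (u x - g x)\<^sup>2 \<partial>lborel) < e / 12"
    using continuous_dense_L2_cball[OF u, of "e/12"] e by auto
  have gL: "L2_on_balls g" by (rule L2_on_balls_continuous[OF g(1)])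
  define V where "V = (\<integral>x. ?I x *\<^sub>R (1::real) \<partial>lborel)"
  have V0: "0 \<le> V" unfolding V_def by (intro integral_nonneg_AE AE_I2) (simp add: indicator_def)
  have Ii: "integrable lborel (\<lambda>x. ?I x *\<^sub>R (1::real))" by (rule borel_integrable_compact) auto
  \<comment> \<open>Three errors, each entering with the factor \<open>3\<close>, are to add up to at most \<open>9 e / 12\<close>.\<close>
  define d where "d = sqrt (e / (12 * (V + 1)))"
  have d: "0 < d" "d\<^sup>2 * V \<le> e / 12"
  proof -
    show "0 < d" unfolding d_def using e V0 by simp
    have "d\<^sup>2 = e / (12 * (V + 1))" unfolding d_def using e V0 by simp
    then have "d\<^sup>2 * (V + 1) = e / 12" using e V0 by (simp add: field_simps)
    moreover have "d\<^sup>2 * V \<le> d\<^sup>2 * (V + 1)" by (simp add: algebra_simps)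
    ultimately show "d\<^sup>2 * V \<le> e / 12" by simp
  qed
  have "uniformly_continuous_on (cball (0::'a) (r + 1)) g"
    by (rule compact_uniformly_continuous) (use g(1) continuous_on_subset in auto)
  then obtain \<delta> where \<delta>: "0 < \<delta>" "\<And>x y. norm x \<le> r + 1 \<Longrightarrow> norm y \<le> r + 1 \<Longrightarrow> dist y x < \<delta> \<Longrightarrow> dist (g y) (g x) < d"
    unfolding uniformly_continuous_on_def using d(1) by (metis mem_cball_0)
  obtain J where J: "\<And>j. J \<le> j \<Longrightarrow> s j < \<delta>"
    using order_tendstoD(2)[OF s \<delta>(1)] unfolding eventually_sequentially by blast
  show "\<exists>J. \<forall>j\<ge>J. norm ((\<integral>x. ?I x * (conv (\<kappa> j) u x - u x)\<^sup>2 \<partial>lborel) - 0) < e"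
  proof (intro exI[of _ J] allI impI)
    fix j assume j: "J \<le> j"
    interpret mollifier "\<kappa> j" "s j" by (rule m)
    have unif: "\<bar>conv (\<kappa> j) g x - g x\<bar> \<le> d" if "norm x \<le> r" for x
    proof (rule conv_uniform[OF g(1)])
      fix y assume y: "norm (x - y) \<le> s j"
      then have "norm y \<le> r + 1" using that s norm_triangle_ineq2[of y x] by (simp add: norm_minus_commute)
      moreover have "dist y x < \<delta>" using y J[OF j] by (simp add: dist_norm norm_minus_commute)
      ultimately have "dist (g y) (g x) < d" using \<delta>(2)[of x y] that by simp
      then show "\<bar>g y - g x\<bar> \<le> d" by (simp add: dist_real_def)
    qed
    note L = L2_on_balls_integrable[OF L2_on_balls_conv[OF L2_on_balls_diff[OF u gL]], of r]
      L2_on_balls_integrable[OF L2_on_balls_diff[OF u gL], of r]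
      L2_on_balls_integrable[OF L2_on_balls_diff[OF L2_on_balls_conv[OF u] u], of r]
    have "(\<integral>x. ?I x * (conv (\<kappa> j) u x - u x)\<^sup>2 \<partial>lborel)
      \<le> (\<integral>x. 3 * (?I x * (conv (\<kappa> j) (\<lambda>x. u x - g x) x)\<^sup>2) + 3 * (d\<^sup>2 * (?I x *\<^sub>R 1)) + 3 * (?I x * (u x - g x)\<^sup>2) \<partial>lborel)"
    proof (rule integral_mono)
      fix x
      show "?I x * (conv (\<kappa> j) u x - u x)\<^sup>2
        \<le> 3 * (?I x * (conv (\<kappa> j) (\<lambda>x. u x - g x) x)\<^sup>2) + 3 * (d\<^sup>2 * (?I x *\<^sub>R 1)) + 3 * (?I x * (u x - g x)\<^sup>2)"
      proof (cases "norm x \<le> r")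
        case True
        define c where "c = conv (\<kappa> j) g x - g x"
        define p where "p = conv (\<kappa> j) (\<lambda>x. u x - g x) x"
        have eq: "conv (\<kappa> j) u x - u x = p + c + (g x - u x)"
          by (simp add: p_def c_def conv_diff[OF u gL])
        have c2: "c\<^sup>2 \<le> d\<^sup>2" using unif[OF True] d(1) by (simp add: c_def abs_le_square_iff[symmetric])
        have "(conv (\<kappa> j) u x - u x)\<^sup>2 \<le> 3 * p\<^sup>2 + 3 * c\<^sup>2 + 3 * (g x - u x)\<^sup>2"
          unfolding eq by (rule square_sum3_le)
        with c2 True show ?thesis by (simp add: p_def power2_commute[of "g x"])
      qed simp
    qed (use L Ii in auto)
    also have "\<dots> = 3 * (\<integral>x. ?I x * (conv (\<kappa> j) (\<lambda>x. u x - g x) x)\<^sup>2 \<partial>lborel) + 3 * (d\<^sup>2 * V) + 3 * (\<integral>x. ?I x * (u x - g x)\<^sup>2 \<partial>lborel)"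
      unfolding V_def using L Ii by simp
    also have "\<dots> < e"
    proof -
      have "(\<integral>x. ?I x * (u x - g x)\<^sup>2 \<partial>lborel) \<le> (\<integral>x. indicator (cball 0 (r+1)) x * (u x - g x)\<^sup>2 \<partial>lborel)"
        by (intro integral_mono L2_on_balls_integrable L2_on_balls_diff u gL) (auto simp: indicator_def)
      then show ?thesis using conv_L2_bound(2)[OF L2_on_balls_diff[OF u gL], of r] g(2) d(2) e by linarith
    qed
    finally show "norm ((\<integral>x. ?I x * (conv (\<kappa> j) u x - u x)\<^sup>2 \<partial>lborel) - 0) < e"
      using integral_nonneg_AE[of "\<lambda>x. ?I x * (conv (\<kappa> j) u x - u x)\<^sup>2" lborel] by simp
  qed
qed

definition bump :: "real \<Rightarrow> real ^ 'n::finite \<Rightarrow> real" where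
  "bump s x = flat_exp [:1:] (s\<^sup>2 - x \<bullet> x)"

lemma Ck_bump: "Ck k (bump s)"
  unfolding bump_def by (rule Ck_compose[OF CkR_flat_exp]) (intro Ck_diff Ck_const Ck_norm_sq)

lemma bump_facts:
  fixes x :: "real ^ 'n::finite"
  assumes "0 < s"
  shows "0 \<le> bump s x" "s < norm x \<Longrightarrow> bump s x = 0" "0 < (\<integral>x. bump s (x::real^'n) \<partial>lborel)"
proof -
  show nn: "0 \<le> bump s x" for x :: "real^'n" by (simp add: bump_def flat_exp_def)
  show z: "s < norm x \<Longrightarrow> bump s x = 0" for x :: "real^'n"
    using assms power_strict_mono[of s "norm x" 2] by (auto simp: bump_def flat_exp_def dot_square_norm)
  have c: "continuous_on UNIV (bump s :: real^'n \<Rightarrow> real)" using Ck_imp_continuous[OF Ck_bump] .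
  have i: "integrable lborel (bump s :: real^'n \<Rightarrow> real)" by (rule integrable_continuous_support[OF c]) (erule z)
  show "0 < (\<integral>x. bump s (x::real^'n) \<partial>lborel)"
  proof (rule ccontr)
    assume "\<not> ?thesis"
    then have "(\<integral>x. bump s (x::real^'n) \<partial>lborel) = 0"
      using integral_nonneg_AE[of "bump s" lborel] nn by (metis AE_I2 not_less order.antisym)
    then have "AE x in lborel. bump s (x::real^'n) = 0"
      using integral_nonneg_eq_0_iff_AE[OF i] nn by simp
    then have ae: "AE x in lborel. x \<in> UNIV \<longrightarrow> 0 \<le> - bump s (x::real^'n)" by auto
    have "0 \<le> - bump s (0::real^'n)"
      by (rule continuous_AE_nonneg[OF open_UNIV _ ae]) (use c in \<open>auto intro!: continuous_intros\<close>)
    then show False using assms by (simp add: bump_def flat_exp_def)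
  qed
qed

theorem smooth_approximation:
  fixes u F :: "real ^ 'n::finite \<Rightarrow> real"
  assumes u: "L2_on_balls u" and F: "L2_on_balls F"
    and weak: "\<And>\<phi>. test_function \<phi> \<Longrightarrow> (\<integral>y. u y * laplacian \<phi> y \<partial>lborel) = - (\<integral>y. F y * \<phi> y \<partial>lborel)"
  obtains f where "\<And>j. Ck 2 (f j)"
    "\<And>r. (\<lambda>j. \<integral>x. indicator (cball 0 r) x * (f j x - u x)\<^sup>2 \<partial>lborel) \<longlonglongrightarrow> 0"
    "\<And>r. (\<lambda>j. \<integral>x. indicator (cball 0 r) x * (laplacian (f j) x - (- F x))\<^sup>2 \<partial>lborel) \<longlonglongrightarrow> 0"
proof -
  define s where "s j = inverse (real (Suc j))" for j
  have s0: "s \<longlonglongrightarrow> 0" and sp: "0 < s j" "s j \<le> 1" for j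
    unfolding s_def by (rule LIMSEQ_inverse_real_of_nat) (auto simp: field_simps)
  define Z where "Z j = (\<integral>x. bump (s j) (x::real^'n) \<partial>lborel)" for j
  define \<kappa> where "\<kappa> j x = inverse (Z j) * bump (s j) (x::real^'n)" for j x
  have Zp: "0 < Z j" for j unfolding Z_def by (rule bump_facts(3)[OF sp(1)])
  have Ck: "Ck k (\<kappa> j)" for j k unfolding \<kappa>_def by (intro Ck_mult Ck_const Ck_bump)
  have m: "mollifier (\<kappa> j) (s j)" for j
  proof
    show "continuous_on UNIV (\<kappa> j)" using Ck_imp_continuous[OF Ck] .
    show "0 \<le> \<kappa> j x" for x unfolding \<kappa>_def using Zp[of j] by (intro mult_nonneg_nonneg bump_facts(1)[OF sp(1)]) simp
    show "s j < norm x \<Longrightarrow> \<kappa> j x = 0" for x unfolding \<kappa>_def using bump_facts(2)[OF sp(1), of j x] by simp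
    show "(\<integral>x. \<kappa> j x \<partial>lborel) = 1" using Zp[of j] by (simp add: \<kappa>_def Z_def)
  qed (use sp[of j] in auto)
  show ?thesis
  proof (rule that[of "\<lambda>j. conv (\<kappa> j) u"])
    show "Ck 2 (conv (\<kappa> j) u)" for j
      by (rule conv_Ck[OF Ck _ u]) (erule mollifier.supp[OF m])
    show "(\<lambda>j. \<integral>x. indicator (cball 0 r) x * (conv (\<kappa> j) u x - u x)\<^sup>2 \<partial>lborel) \<longlonglongrightarrow> 0" for r
      by (rule conv_tendsto_L2[OF m s0 u])
    have "laplacian (conv (\<kappa> j) u) x = - conv (\<kappa> j) F x" for j x
      by (rule laplacian_conv[OF Ck _ u weak]) (erule mollifier.supp[OF m])
    then show "(\<lambda>j. \<integral>x. indicator (cball 0 r) x * (laplacian (conv (\<kappa> j) u) x - (- F x))\<^sup>2 \<partial>lborel) \<longlonglongrightarrow> 0" for r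
      using conv_tendsto_L2[OF m s0 F, of r] by (simp add: power2_commute)
  qed
qed

section \<open>Monotonicity along rays\<close>

text \<open>
  The point is that \<open>H\<close> is differentiable almost everywhere. Adding a linear function gives
  \<open>F\<close> with \<open>F(t) - F(s) \<ge> t - s\<close>, a bi-Lipschitz homeomorphism of the line. The image of Lebesgue
  measure under its inverse is absolutely continuous, because Lipschitz maps preserve null sets, so
  \<open>F\<close> is the integral of a Radon-Nikodym density \<open>f\<close>. By Lebesgue's differentiation theorem
  \<open>F\<close> has derivative \<open>f\<close> almost everywhere, which by assumption is at least \<open>L + 1\<close>; integrate.
\<close>
lemma Lipschitz_ae_nonneg_deriv_imp_le_global:
  fixes H :: "real \<Rightarrow> real"
  assumes L: "\<And>s t. \<bar>H s - H t\<bar> \<le> L * \<bar>s - t\<bar>" "0 \<le> L"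
    and ae: "AE t in lborel. \<forall>D. (H has_real_derivative D) (at t) \<longrightarrow> 0 \<le> D"
    and ab: "a < b"
  shows "H a \<le> H b"
proof -
  define F where "F t = H t + (L + 1) * t" for t
  have Flow: "t - s \<le> F t - F s" if "s \<le> t" for s t
    using L(1)[of s t] that by (simp add: F_def abs_le_iff algebra_simps)
  have Flip: "\<bar>F s - F t\<bar> \<le> (2 * L + 1) * \<bar>s - t\<bar>" for s t
  proof -
    have "\<bar>F s - F t\<bar> \<le> \<bar>H s - H t\<bar> + \<bar>(L + 1) * (s - t)\<bar>" unfolding F_def by (simp add: algebra_simps)
    also have "\<bar>(L + 1) * (s - t)\<bar> = (L + 1) * \<bar>s - t\<bar>" using L(2) by (simp add: abs_mult)
    finally show ?thesis using L(1)[of s t] by (simp add: algebra_simps)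
  qed
  have Fc: "continuous_on UNIV F"
  proof (rule continuous_onI)
    fix x e :: real assume e: "0 < e"
    show "\<exists>d>0. \<forall>x'\<in>UNIV. dist x' x < d \<longrightarrow> dist (F x') (F x) \<le> e"
    proof (intro exI[of _ "e / (2 * L + 1)"] conjI ballI impI)
      show "0 < e / (2 * L + 1)" using e L(2) by simp
      fix y assume "dist y x < e / (2 * L + 1)"
      then have "(2 * L + 1) * \<bar>y - x\<bar> < e" using L(2) by (simp add: dist_real_def field_simps)
      with Flip[of y x] show "dist (F y) (F x) \<le> e" by (simp add: dist_real_def)
    qed
  qed
  have Fmono: "strict_mono F"
  proof (rule strict_monoI)
    fix x y :: real assume "x < y"
    then show "F x < F y" using Flow[of x y] by simp
  qed
  have Fsurj: "\<exists>x. F x = y" for y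
  proof -
    define c where "c = \<bar>y - F 0\<bar>"
    have "F (- c) \<le> y" "y \<le> F c" using Flow[of "-c" 0] Flow[of 0 c] by (auto simp: c_def)
    then show ?thesis using IVT'[of F "-c" y c] Fc continuous_on_subset[OF Fc] by (auto simp: c_def)
  qed
  have injF: "inj F" by (rule strict_mono_imp_inj_on[OF Fmono])
  have surjF: "surj F" unfolding surj_def using Fsurj by metis
  define G where "G = inv F"
  have GF: "G (F x) = x" and FG: "F (G y) = y" for x y
    using injF surjF by (simp_all add: G_def surj_f_inv_f)
  have Gm: "strict_mono G"
    by (rule strict_monoI) (metis FG Fmono strict_mono_less)
  have [measurable]: "G \<in> borel_measurable borel"
    by (rule borel_measurable_mono) (use Gm strict_mono_mono in blast)
  define N where "N = distr lborel borel G"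
  have ac: "absolutely_continuous lborel N"
    unfolding absolutely_continuous_def
  proof
    fix A :: "real set" assume A: "A \<in> null_sets lborel"
    then have negA: "negligible A" by (simp add: negligible_iff_null_sets null_sets_completionI)
    have "negligible (F ` A)"
      by (rule negligible_locally_Lipschitz_image[OF _ negA])
         (use Flip in \<open>auto intro!: exI[of _ UNIV] exI[of _ "2 * L + 1"]\<close>)
    moreover have "G -` A = F ` A" using GF FG by (auto simp: image_iff) metis
    moreover have "G -` A \<in> sets borel" using A measurable_sets[of G borel borel A] by auto
    ultimately have "emeasure lborel (G -` A) = 0"
      by (simp add: negligible_iff_null_sets null_sets_def emeasure_completion)
    then show "A \<in> null_sets N"
      using A by (simp add: N_def null_sets_def emeasure_distr)
  qed
  obtain g where g[measurable]: "g \<in> borel_measurable lborel" and gN: "density lborel g = N"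
    using sigma_finite_measure.Radon_Nikodym[OF sigma_finite_lborel ac] by (auto simp: N_def)
  have gI: "(\<integral>\<^sup>+x. g x * indicator {s..t} x \<partial>lborel) = ennreal (F t - F s)" if "s \<le> t" for s t
  proof -
    have "(\<integral>\<^sup>+x. g x * indicator {s..t} x \<partial>lborel) = emeasure N {s..t}"
      unfolding gN[symmetric] by (subst emeasure_density) auto
    also have "\<dots> = emeasure lborel (G -` {s..t})" by (simp add: N_def emeasure_distr)
    also have "G -` {s..t} = {F s..F t}"
    proof -
      have "(s \<le> G x \<and> G x \<le> t) \<longleftrightarrow> (F s \<le> x \<and> x \<le> F t)" for x
        using strict_mono_less_eq[OF Fmono, of s "G x"] strict_mono_less_eq[OF Fmono, of "G x" t] FG[of x] by simp
      then show ?thesis by auto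
    qed
    also have "emeasure lborel {F s..F t} = ennreal (F t - F s)"
      using Flow[OF that] that by simp
    finally show ?thesis .
  qed
  define f where "f x = enn2real (g x)" for x
  have fm[measurable]: "f \<in> borel_measurable borel" using g unfolding f_def by simp
  have gfin: "AE x in lborel. g x \<noteq> \<infinity>"
  proof -
    have "AE x in lborel. g x * indicator {- real n..real n} x \<noteq> \<infinity>" for n
      by (rule nn_integral_noteq_infinite) (use gI[of "- real n" "real n"] in auto)
    then have "AE x in lborel. \<forall>n. g x * indicator {- real n..real n} x \<noteq> \<infinity>" by (simp add: AE_all_countable)
    then show ?thesis
    proof (rule AE_mp, intro AE_I2 impI)
      fix x assume "\<forall>n. g x * indicator {- real n..real n} x \<noteq> \<infinity>"
      moreover obtain n :: nat where "\<bar>x\<bar> \<le> real n" using real_arch_simple by blast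
      ultimately show "g x \<noteq> \<infinity>" by (auto dest!: spec[of _ n] simp: indicator_def abs_le_iff)
    qed
  qed
  have fI: "(f has_integral (F t - F s)) {s..t}" if st: "s \<le> t" for s t
  proof -
    have "(\<integral>\<^sup>+x. ennreal (f x * indicator {s..t} x) \<partial>lborel) = (\<integral>\<^sup>+x. g x * indicator {s..t} x \<partial>lborel)"
      by (rule nn_integral_cong_AE, rule AE_mp[OF gfin], intro AE_I2)
         (auto simp: f_def indicator_def less_top)
    then have "(\<integral>\<^sup>+x. ennreal (f x * indicator {s..t} x) \<partial>lborel) = ennreal (F t - F s)" using gI[OF st] by simp
    then have "((\<lambda>x. f x * indicator {s..t} x) has_integral (F t - F s)) UNIV"
      by (intro nn_integral_has_integral) (use Flow[OF st] st in \<open>auto simp: f_def\<close>)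
    moreover have "(\<lambda>x. f x * indicator {s..t} x) = (\<lambda>x. if x \<in> {s..t} then f x else 0)" by auto
    ultimately show ?thesis by (simp only: has_integral_restrict_UNIV)
  qed
  have fI': "f integrable_on cbox s t" for s t
    using fI[of s t] by (cases "s \<le> t") (auto simp: integrable_on_def)
  have fr: "((\<lambda>x. f (- x)) has_integral (F (- s) - F (- t))) {s..t}" if "s \<le> t" for s t
    using fI[of "-t" "-s"] that has_integral_reflect_real[where f = f and i = "F (-s) - F (-t)" and a = "-t" and b = "-s"] by simp
  have fr': "(\<lambda>x. f (- x)) integrable_on cbox s t" for s t
    using fr[of s t] by (cases "s \<le> t") (auto simp: integrable_on_def)
  obtain N1 where N1: "negligible N1" "\<And>x e. x \<notin> N1 \<Longrightarrow> 0 < e \<Longrightarrow>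
     \<exists>d>0. \<forall>h. 0 < h \<and> h < d \<longrightarrow> norm (integral (cbox x (x + h *\<^sub>R One)) f /\<^sub>R h ^ DIM(real) - f x) < e"
    using integrable_ccontinuous_explicit[of f, OF fI'] by blast
  obtain N2 where N2: "negligible N2" "\<And>x e. x \<notin> N2 \<Longrightarrow> 0 < e \<Longrightarrow>
     \<exists>d>0. \<forall>h. 0 < h \<and> h < d \<longrightarrow> norm (integral (cbox x (x + h *\<^sub>R One)) (\<lambda>x. f (- x)) /\<^sub>R h ^ DIM(real) - f (- x)) < e"
    using integrable_ccontinuous_explicit[of "\<lambda>x. f (- x)", OF fr'] by blast
  \<comment> \<open>The differentiation theorem speaks of cubes with \<open>x\<close> as lower corner, hence of right derivatives;
      reflecting \<open>f\<close> gives the left derivatives.\<close>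
  have neg2: "negligible ((\<lambda>x. - x) ` N2)"
  proof (rule negligible_locally_Lipschitz_image[OF _ N2(1)])
    fix x :: real
    show "\<exists>T B. open T \<and> x \<in> T \<and> (\<forall>y\<in>N2 \<inter> T. norm (- y - - x) \<le> B * norm (y - x))"
      by (rule exI[of _ UNIV], rule exI[of _ 1]) auto
  qed simp
  define Z where "Z = N1 \<union> (\<lambda>x. - x) ` N2"
  have Zneg: "negligible Z" unfolding Z_def using N1(1) neg2 by simp
  have deriv: "(F has_real_derivative f x) (at x)" if "x \<notin> Z" for x
  proof -
    have x1: "x \<notin> N1" and x2: "- x \<notin> N2" using that unfolding Z_def by (auto simp: image_iff)
    show ?thesis
      unfolding DERIV_def LIM_def
    proof (intro allI impI)
      fix e :: real assume e: "0 < e"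
      obtain d1 where d1: "0 < d1" "\<And>h. 0 < h \<Longrightarrow> h < d1 \<Longrightarrow> norm (integral (cbox x (x + h *\<^sub>R One)) f /\<^sub>R h ^ DIM(real) - f x) < e"
        using N1(2)[OF x1 e] by blast
      obtain d2 where d2: "0 < d2" "\<And>h. 0 < h \<Longrightarrow> h < d2 \<Longrightarrow> norm (integral (cbox (-x) (-x + h *\<^sub>R One)) (\<lambda>x. f (- x)) /\<^sub>R h ^ DIM(real) - f x) < e"
        using N2(2)[OF x2 e] by auto
      show "\<exists>d>0. \<forall>h. h \<noteq> 0 \<and> dist h 0 < d \<longrightarrow> dist ((F (x + h) - F x) / h) (f x) < e"
      proof (intro exI[of _ "min d1 d2"] conjI allI impI)
        fix h :: real assume h: "h \<noteq> 0 \<and> dist h 0 < min d1 d2"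
        show "dist ((F (x + h) - F x) / h) (f x) < e"
        proof (cases "0 < h")
          case True
          have "integral {x..x+h} f = F (x + h) - F x" using fI[of x "x + h"] True by (simp add: integral_unique)
          then show ?thesis using d1(2)[of h] True h by (simp add: dist_real_def divide_inverse mult.commute)
        next
          case False
          define k where "k = - h"
          have k: "0 < k" "k < d2" using False h by (auto simp: k_def)
          have "integral {-x..-x+k} (\<lambda>x. f (- x)) = F x - F (x - k)" using fr[of "-x" "-x+k"] k by (simp add: integral_unique)
          then have "\<bar>(F x - F (x - k)) / k - f x\<bar> < e" using d2(2)[OF k] by (simp add: divide_inverse mult.commute)
          moreover have "(F x - F (x - k)) / k = (F (x + h) - F x) / h" using minus_divide_divide[of "F x - F (x - k)" k] by (simp add: k_def)
          ultimately show ?thesis by (simp add: dist_real_def)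
        qed
      qed (use d1 d2 in auto)
    qed
  qed
  have AEZ: "AE x in lborel. x \<notin> Z"
  proof -
    have "AE x in lebesgue. x \<notin> Z" by (rule AE_not_in) (use Zneg in \<open>simp add: negligible_iff_null_sets\<close>)
    then show ?thesis by (simp only: AE_completion_iff)
  qed
  have "AE x in lborel. L + 1 \<le> f x"
    using AEZ ae
  proof eventually_elim
    case (elim x)
    have "((\<lambda>t. F t - (L + 1) * t) has_real_derivative f x - (L + 1)) (at x)"
      using deriv[OF elim(1)] by (auto intro!: derivative_eq_intros)
    moreover have "(\<lambda>t. F t - (L + 1) * t) = H" by (auto simp: F_def)
    ultimately show ?case using elim(2) by auto
  qed
  then have "AE x in lborel. ennreal (L + 1) * indicator {a..b} x \<le> g x * indicator {a..b} x"
    using gfin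
  proof eventually_elim
    case (elim x)
    then have "ennreal (L + 1) \<le> g x" using ennreal_leI[OF elim(1)] by (simp add: f_def less_top)
    then show ?case by (simp add: indicator_def)
  qed
  then have "(\<integral>\<^sup>+x. ennreal (L + 1) * indicator {a..b} x \<partial>lborel) \<le> (\<integral>\<^sup>+x. g x * indicator {a..b} x \<partial>lborel)"
    by (rule nn_integral_mono_AE)
  also have "\<dots> = ennreal (F b - F a)" using gI ab by simp
  finally have "ennreal ((L + 1) * (b - a)) \<le> ennreal (F b - F a)"
    using ab L(2) by (simp add: nn_integral_cmult ennreal_mult)
  then have "(L + 1) * (b - a) \<le> F b - F a"
    using ennreal_le_iff[of "F b - F a"] Flow[of a b] ab by simp
  then show ?thesis by (simp add: F_def algebra_simps)
qed

lemma Lipschitz_ae_nonneg_deriv_imp_le: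
  fixes h :: "real \<Rightarrow> real"
  assumes L: "\<And>s t. s \<in> {a..b} \<Longrightarrow> t \<in> {a..b} \<Longrightarrow> \<bar>h s - h t\<bar> \<le> L * \<bar>s - t\<bar>" "0 \<le> L"
    and ae: "AE t in lborel. t \<in> {a<..<b} \<longrightarrow> (\<forall>D. (h has_real_derivative D) (at t) \<longrightarrow> 0 \<le> D)"
    and ab: "a < b"
  shows "h a \<le> h b"
proof -
  define c where "c t = max a (min b t)" for t
  define H where "H t = h (c t)" for t
  have c: "c t \<in> {a..b}" "\<bar>c s - c t\<bar> \<le> \<bar>s - t\<bar>" for s t using ab by (auto simp: c_def max_def min_def)
  have "H a \<le> H b"
  proof (rule Lipschitz_ae_nonneg_deriv_imp_le_global[OF _ L(2) _ ab])
    show "\<bar>H s - H t\<bar> \<le> L * \<bar>s - t\<bar>" for s t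
      unfolding H_def using L(1)[OF c(1) c(1), of s t] mult_left_mono[OF c(2) L(2), of s t] by linarith
    have "AE t in lborel. t \<noteq> a" "AE t in lborel. t \<noteq> b" by (rule AE_lborel_singleton)+
    with ae show "AE t in lborel. \<forall>D. (H has_real_derivative D) (at t) \<longrightarrow> 0 \<le> D"
    proof eventually_elim
      case (elim t)
      consider "t < a" | "b < t" | "t \<in> {a<..<b}" using elim by fastforce
      then show ?case
      proof cases
        case 1
        have "(H has_real_derivative 0) (at t)"
          by (rule has_field_derivative_transform_within_open[of "\<lambda>t. h a" _ _ "{..<a}"]) (use 1 ab in \<open>auto simp: H_def c_def\<close>)
        then show ?thesis using DERIV_unique by fastforce
      next
        case 2
        have "(H has_real_derivative 0) (at t)"
          by (rule has_field_derivative_transform_within_open[of "\<lambda>t. h b" _ _ "{b<..}"]) (use 2 ab in \<open>auto simp: H_def c_def\<close>)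
        then show ?thesis using DERIV_unique by fastforce
      next
        case 3
        have "(h has_real_derivative D) (at t)" if "(H has_real_derivative D) (at t)" for D
          by (rule has_field_derivative_transform_within_open[OF that, of "{a<..<b}"]) (use 3 in \<open>auto simp: H_def c_def\<close>)
        then show ?thesis using elim(1) 3 by blast
      qed
    qed
  qed
  then show ?thesis using ab by (simp add: H_def c_def)
qed

lemma nn_integral_scale:
  fixes f :: "'a::euclidean_space \<Rightarrow> ennreal"
  assumes [measurable]: "f \<in> borel_measurable borel" and t: "0 < t"
  shows "(\<integral>\<^sup>+x. f x \<partial>lborel) = ennreal (t ^ DIM('a)) * (\<integral>\<^sup>+x. f (t *\<^sub>R x) \<partial>lborel)"
proof -
  have "(\<integral>\<^sup>+x. f x \<partial>lborel) = (\<integral>\<^sup>+x. f x \<partial>(density (distr lborel borel (\<lambda>x::'a. 0 + t *\<^sub>R x)) (\<lambda>_. ennreal (\<bar>t\<bar> ^ DIM('a)))))"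
    using lborel_affine[of t "0::'a"] t by simp
  also have "\<dots> = (\<integral>\<^sup>+x. ennreal (t ^ DIM('a)) * f x \<partial>(distr lborel borel (\<lambda>x::'a. 0 + t *\<^sub>R x)))"
    using t by (subst nn_integral_density) auto
  also have "\<dots> = (\<integral>\<^sup>+x. ennreal (t ^ DIM('a)) * f (t *\<^sub>R x) \<partial>lborel)"
    by (subst nn_integral_distr) auto
  finally show ?thesis by (simp add: nn_integral_cmult)
qed

text \<open>
  A substitute for polar coordinates: each dilate of a null set is null, and by Fubini's theorem almost
  every ray meets the set in a null set of parameters.
\<close>
lemma AE_rays_avoid_null_set:
  fixes N :: "'a::euclidean_space set"
  assumes N: "N \<in> null_sets lborel"
  shows "AE x in lborel. AE s in lborel. (0::real) < s \<longrightarrow> s *\<^sub>R x \<notin> N"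
proof -
  have Nm[measurable]: "N \<in> sets borel" using N by auto
  have sc: "AE x in lborel. s *\<^sub>R x \<notin> N" if s: "0 < s" for s :: real
  proof -
    have "ennreal (s ^ DIM('a)) * (\<integral>\<^sup>+x. indicator N (s *\<^sub>R x) \<partial>lborel) = (\<integral>\<^sup>+x. indicator N x \<partial>(lborel::'a measure))"
      by (rule nn_integral_scale[symmetric]) (use s in auto)
    also have "\<dots> = 0" using N by (simp add: null_sets_def)
    finally have "(\<integral>\<^sup>+x. indicator N (s *\<^sub>R x) \<partial>lborel) = 0" using s by simp
    then have "AE x in lborel. (indicator N (s *\<^sub>R x) :: ennreal) = 0"
      by (subst (asm) nn_integral_0_iff_AE) auto
    then show ?thesis by (auto simp: indicator_def)
  qed
  have "AE s in lborel. AE x in lborel. (0::real) < s \<longrightarrow> s *\<^sub>R x \<notin> N"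
  proof (rule AE_I2)
    fix s :: real
    show "AE x in lborel. 0 < s \<longrightarrow> s *\<^sub>R x \<notin> N" using sc[of s] by (cases "0 < s") auto
  qed
  moreover have "{p \<in> space (lborel \<Otimes>\<^sub>M lborel). (0::real) < fst p \<longrightarrow> fst p *\<^sub>R (snd p :: 'a) \<notin> N} \<in> sets (lborel \<Otimes>\<^sub>M lborel)"
    by measurable
  ultimately show ?thesis
    using lborel_pair.AE_commute[of "\<lambda>s x. (0::real) < s \<longrightarrow> s *\<^sub>R (x::'a) \<notin> N"] by simp
qed

lemma locally_lipschitz_on_continuous:
  assumes "locally_lipschitz_on U f" "open U"
  shows "continuous_on U f"
proof (rule continuous_at_imp_continuous_on, rule ballI)
  fix x assume x: "x \<in> U"
  from assms(1) x obtain e L where e: "0 < e" "L-lipschitz_on (ball x e \<inter> U) f"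
    unfolding locally_lipschitz_on_def by blast
  have "continuous_on (ball x e \<inter> U) f" by (rule lipschitz_on_continuous_on[OF e(2)])
  moreover have "open (ball x e \<inter> U)" "x \<in> ball x e \<inter> U" using e(1) x assms(2) by auto
  ultimately show "isCont f x" using continuous_on_eq_continuous_at by blast
qed

lemma locally_lipschitz_on_ray:
  fixes V :: "'a::real_normed_vector \<Rightarrow> real"
  assumes V: "locally_lipschitz_on U V" and seg: "\<And>s. s \<in> {a..b} \<Longrightarrow> s *\<^sub>R x \<in> U"
  obtains L where "L-lipschitz_on {a..b} (\<lambda>s. V (s *\<^sub>R x))"
proof -
  have "local_lipschitz {0::real} {a..b} (\<lambda>_ s. V (s *\<^sub>R x))"
    unfolding local_lipschitz_def
  proof (intro ballI)
    fix s t :: real assume s: "s \<in> {a..b}"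
    obtain e L where e: "0 < e" and lip: "L-lipschitz_on (ball (s *\<^sub>R x) e \<inter> U) V"
      using V seg[OF s] unfolding locally_lipschitz_on_def by blast
    define d where "d = e / (2 * (norm x + 1))"
    have nx: "0 < norm x + 1" using norm_ge_zero[of x] by linarith
    have d: "0 < d" using e nx by (simp add: d_def)
    have close: "r *\<^sub>R x \<in> ball (s *\<^sub>R x) e \<inter> U" if "r \<in> cball s d \<inter> {a..b}" for r
    proof -
      have "norm (s *\<^sub>R x - r *\<^sub>R x) = \<bar>s - r\<bar> * norm x" by (simp add: scaleR_left_diff_distrib[symmetric])
      also have "\<dots> \<le> d * (norm x + 1)" using that d by (intro mult_mono) (auto simp: dist_real_def)
      also have "\<dots> = e / 2" using less_imp_neq[OF nx] unfolding d_def by (metis nonzero_mult_divide_mult_cancel_right times_divide_eq_left)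
      also have "\<dots> < e" using e by simp
      finally show ?thesis using that seg by (simp add: dist_norm)
    qed
    have "(L * norm x)-lipschitz_on (cball s d \<inter> {a..b}) (\<lambda>s. V (s *\<^sub>R x))"
    proof (rule lipschitz_onI)
      fix r q assume rq: "r \<in> cball s d \<inter> {a..b}" "q \<in> cball s d \<inter> {a..b}"
      have "dist (V (r *\<^sub>R x)) (V (q *\<^sub>R x)) \<le> L * dist (r *\<^sub>R x) (q *\<^sub>R x)"
        by (rule lipschitz_onD[OF lip close[OF rq(1)] close[OF rq(2)]])
      also have "dist (r *\<^sub>R x) (q *\<^sub>R x) = norm x * dist r q"
        by (simp add: dist_norm scaleR_left_diff_distrib[symmetric] mult.commute)
      finally show "dist (V (r *\<^sub>R x)) (V (q *\<^sub>R x)) \<le> L * norm x * dist r q" by (simp add: mult.assoc)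
    qed (use lipschitz_on_nonneg[OF lip] in simp)
    then show "\<exists>u>0. \<exists>L. \<forall>t\<in>cball t u \<inter> {0::real}. L-lipschitz_on (cball s u \<inter> {a..b}) (\<lambda>s. V (s *\<^sub>R x))"
      using d by blast
  qed
  from local_lipschitz_compact_implies_lipschitz[OF this] that show ?thesis by auto
qed

text \<open>
  On almost every ray the sign condition holds almost everywhere, so \<open>s\<^sup>2 V(s x)\<close> is increasing in \<open>s\<close> there.
  The resulting inequality is a closed condition on \<open>x\<close>, and \<open>V\<close> is continuous, so it holds on every ray.
\<close>
theorem radially_increasing:
  fixes V :: "real ^ 'n::finite \<Rightarrow> real"
  assumes V: "locally_lipschitz_on {x. R < norm x} V" and rd: "radial_deriv_nonneg_ae R V" and R: "0 < R"
    and x: "R < norm x" and t: "1 \<le> t"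
  shows "V x \<le> t\<^sup>2 * V (t *\<^sub>R x)"
proof (cases "t = 1")
  case False
  with t have t1: "1 < t" by simp
  have Vc: "continuous_on {x. R < norm x} V"
    by (rule locally_lipschitz_on_continuous[OF V open_norm_greater])
  let ?P = "\<lambda>x. R < norm x \<longrightarrow> (\<forall>D. ((\<lambda>r. r\<^sup>2 * V (r *\<^sub>R sgn x)) has_real_derivative D) (at (norm x)) \<longrightarrow> 0 \<le> D)"
  have "AE x in lborel. ?P x"
    using rd unfolding radial_deriv_nonneg_ae_def AE_completion_iff .
  then obtain N where N: "{x. \<not> ?P x} \<subseteq> N" "N \<in> null_sets lborel"
    by (auto elim!: AE_E simp: null_sets_def)
  have ray: "V x \<le> t\<^sup>2 * V (t *\<^sub>R x)" if x: "R < norm x" and ae: "AE s in lborel. (0::real) < s \<longrightarrow> s *\<^sub>R x \<notin> N" for x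
  proof -
    have nx: "0 < norm x" using x R by linarith
    have seg: "s *\<^sub>R x \<in> {x. R < norm x}" if "1 \<le> s" for s
      using x mult_right_mono[OF that norm_ge_zero[of x]] that by simp
    obtain L where L: "L-lipschitz_on {1..t} (\<lambda>s. V (s *\<^sub>R x))"
      using locally_lipschitz_on_ray[OF V, of 1 t x] seg by auto
    have "continuous_on {1..t} (\<lambda>s. V (s *\<^sub>R x))" by (rule lipschitz_on_continuous_on[OF L])
    then have "bounded ((\<lambda>s. V (s *\<^sub>R x)) ` {1..t})" by (intro compact_imp_bounded compact_continuous_image) auto
    then obtain M where M: "\<And>s. s \<in> {1..t} \<Longrightarrow> \<bar>V (s *\<^sub>R x)\<bar> \<le> M" unfolding bounded_iff by force
    have M0: "0 \<le> M" using M[of 1] t1 by (simp add: order_trans[OF abs_ge_zero])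
    have L0: "0 \<le> L" by (rule lipschitz_on_nonneg[OF L])
    have "(1::real)\<^sup>2 * V (1 *\<^sub>R x) \<le> t\<^sup>2 * V (t *\<^sub>R x)"
    proof (rule Lipschitz_ae_nonneg_deriv_imp_le[where h = "\<lambda>s. s\<^sup>2 * V (s *\<^sub>R x)" and L = "t\<^sup>2 * L + 2 * t * M"])
      fix s r assume sr: "s \<in> {1..t}" "r \<in> {1..t}"
      have "\<bar>s\<^sup>2 * V (s *\<^sub>R x) - r\<^sup>2 * V (r *\<^sub>R x)\<bar> = \<bar>s\<^sup>2 * (V (s *\<^sub>R x) - V (r *\<^sub>R x)) + (s\<^sup>2 - r\<^sup>2) * V (r *\<^sub>R x)\<bar>"
        by (simp add: algebra_simps)
      also have "\<dots> \<le> s\<^sup>2 * \<bar>V (s *\<^sub>R x) - V (r *\<^sub>R x)\<bar> + \<bar>s\<^sup>2 - r\<^sup>2\<bar> * \<bar>V (r *\<^sub>R x)\<bar>"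
        by (rule order_trans[OF abs_triangle_ineq]) (simp add: abs_mult)
      also have "\<dots> \<le> t\<^sup>2 * (L * \<bar>s - r\<bar>) + (2 * t * \<bar>s - r\<bar>) * M"
      proof (intro add_mono mult_mono)
        show "s\<^sup>2 \<le> t\<^sup>2" using sr by (intro power_mono) auto
        show "\<bar>V (s *\<^sub>R x) - V (r *\<^sub>R x)\<bar> \<le> L * \<bar>s - r\<bar>" using lipschitz_onD[OF L sr] by (simp add: dist_real_def)
        have "\<bar>s\<^sup>2 - r\<^sup>2\<bar> = \<bar>s + r\<bar> * \<bar>s - r\<bar>" by (simp add: abs_mult[symmetric] power2_eq_square algebra_simps)
        also have "\<dots> \<le> (2 * t) * \<bar>s - r\<bar>" using sr by (intro mult_right_mono) auto
        finally show "\<bar>s\<^sup>2 - r\<^sup>2\<bar> \<le> 2 * t * \<bar>s - r\<bar>" .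
        show "\<bar>V (r *\<^sub>R x)\<bar> \<le> M" by (rule M[OF sr(2)])
      qed (use t1 L0 in auto)
      finally show "\<bar>s\<^sup>2 * V (s *\<^sub>R x) - r\<^sup>2 * V (r *\<^sub>R x)\<bar> \<le> (t\<^sup>2 * L + 2 * t * M) * \<bar>s - r\<bar>" by (simp add: algebra_simps)
    next
      show "0 \<le> t\<^sup>2 * L + 2 * t * M" using t1 L0 M0 by simp
      show "AE s in lborel. s \<in> {1<..<t} \<longrightarrow> (\<forall>D. ((\<lambda>s. s\<^sup>2 * V (s *\<^sub>R x)) has_real_derivative D) (at s) \<longrightarrow> 0 \<le> D)"
        using ae
      proof (rule AE_mp, intro AE_I2 impI allI)
        fix s D assume sN: "0 < s \<longrightarrow> s *\<^sub>R x \<notin> N" and s: "s \<in> {1<..<t}"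
          and D: "((\<lambda>s. s\<^sup>2 * V (s *\<^sub>R x)) has_real_derivative D) (at s)"
        have s1: "1 < s" using s by simp
        have P: "?P (s *\<^sub>R x)" 
        proof (rule ccontr)
          assume "\<not> ?P (s *\<^sub>R x)"
          then have "s *\<^sub>R x \<in> N" by (intro subsetD[OF N(1)] CollectI)
          with sN s1 show False by simp
        qed
        have ny: "norm (s *\<^sub>R x) = s * norm x" using s1 by simp
        have sg: "sgn (s *\<^sub>R x) = x /\<^sub>R norm x" using s1 nx by (simp add: sgn_div_norm)
        have "((\<lambda>r. r / norm x) has_real_derivative 1 / norm x) (at (s * norm x))"
          using nx by (auto intro!: derivative_eq_intros)
        moreover have "((\<lambda>s. s\<^sup>2 * V (s *\<^sub>R x)) has_real_derivative D) (at (s * norm x / norm x))"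
          using D nx by simp
        ultimately have "((\<lambda>r. (r / norm x)\<^sup>2 * V ((r / norm x) *\<^sub>R x)) has_real_derivative D * (1 / norm x)) (at (s * norm x))"
          by (rule DERIV_chain2[rotated])
        from DERIV_cmult[OF this, of "(norm x)\<^sup>2"]
        have "((\<lambda>r. (norm x)\<^sup>2 * ((r / norm x)\<^sup>2 * V ((r / norm x) *\<^sub>R x))) has_real_derivative (norm x)\<^sup>2 * (D * (1 / norm x))) (at (s * norm x))" .
        moreover have "(\<lambda>r. (norm x)\<^sup>2 * ((r / norm x)\<^sup>2 * V ((r / norm x) *\<^sub>R x))) = (\<lambda>r. r\<^sup>2 * V (r *\<^sub>R sgn (s *\<^sub>R x)))"
        proof (rule ext)
          fix r
          have "(norm x)\<^sup>2 * (r / norm x)\<^sup>2 = r\<^sup>2" using nx by (simp add: power_divide)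
          moreover have e: "r *\<^sub>R (x /\<^sub>R norm x) = (r / norm x) *\<^sub>R x" by (simp add: divide_inverse)
          ultimately show "(norm x)\<^sup>2 * ((r / norm x)\<^sup>2 * V ((r / norm x) *\<^sub>R x)) = r\<^sup>2 * V (r *\<^sub>R sgn (s *\<^sub>R x))"
            unfolding sg e mult.assoc[symmetric] by simp
        qed
        ultimately have "0 \<le> (norm x)\<^sup>2 * (D * (1 / norm x))"
          using P seg[of s] s1 unfolding ny by auto
        then have "0 \<le> norm x * D" using nx by (simp add: power2_eq_square)
        then show "0 \<le> D" using nx by (simp add: zero_le_mult_iff)
      qed
    qed (use t1 in auto)
    then show ?thesis by simp
  qed
  have "continuous_on {x. R < norm x} (\<lambda>x. V (t *\<^sub>R x))"
  proof (rule continuous_on_compose2[OF Vc])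
    show "(\<lambda>x. t *\<^sub>R x) ` {x. R < norm x} \<subseteq> {x. R < norm x}"
    proof (rule subsetI)
      fix y assume "y \<in> (\<lambda>x. t *\<^sub>R x) ` {x. R < norm x}"
      then obtain x where "y = t *\<^sub>R x" "R < norm x" by auto
      then show "y \<in> {x. R < norm x}" using t1 mult_right_mono[of 1 t "norm x"] by simp
    qed
  qed (intro continuous_intros)
  then have c: "continuous_on {x. R < norm x} (\<lambda>x. t\<^sup>2 * V (t *\<^sub>R x) - V x)" by (intro continuous_intros Vc)
  have ae: "AE x in lborel. x \<in> {x. R < norm x} \<longrightarrow> 0 \<le> t\<^sup>2 * V (t *\<^sub>R x) - V x"
    using AE_rays_avoid_null_set[OF N(2)]
  proof eventually_elim
    case (elim x)
    then show ?case using ray[of x] by simp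
  qed
  show ?thesis
    using continuous_AE_nonneg[OF open_norm_greater c ae, of x] x by simp
qed simp

section \<open>The Carleman inequality for weak solutions\<close>

text \<open>
  The class of admissible coefficients in integrals of products of two \<open>L\<^sup>2\<close> functions.
\<close>
definition bounded_borel_on_cball :: "real \<Rightarrow> ('a::euclidean_space \<Rightarrow> real) \<Rightarrow> bool" where
  "bounded_borel_on_cball r f \<longleftrightarrow> f \<in> borel_measurable borel \<and> (\<exists>C. \<forall>x. norm x \<le> r \<longrightarrow> \<bar>f x\<bar> \<le> C)"

lemma bounded_borel_continuous: "continuous_on UNIV f \<Longrightarrow> bounded_borel_on_cball r f"
  unfolding bounded_borel_on_cball_def
  using continuous_imp_borel continuous_bounded_on_cball by metis

lemma bounded_borel_add:
  assumes "bounded_borel_on_cball r f" "bounded_borel_on_cball r g"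
  shows "bounded_borel_on_cball r (\<lambda>x. f x + g x)"
proof -
  obtain C D where C: "\<And>x. norm x \<le> r \<Longrightarrow> \<bar>f x\<bar> \<le> C" "\<And>x. norm x \<le> r \<Longrightarrow> \<bar>g x\<bar> \<le> D"
    using assms unfolding bounded_borel_on_cball_def by blast
  have "\<bar>f x + g x\<bar> \<le> C + D" if "norm x \<le> r" for x using C[OF that] by linarith
  then show ?thesis using assms unfolding bounded_borel_on_cball_def by auto
qed

lemma bounded_borel_mult:
  assumes "bounded_borel_on_cball r f" "bounded_borel_on_cball r g"
  shows "bounded_borel_on_cball r (\<lambda>x. f x * g x)"
proof -
  obtain C D where C: "\<And>x. norm x \<le> r \<Longrightarrow> \<bar>f x\<bar> \<le> C" "\<And>x. norm x \<le> r \<Longrightarrow> \<bar>g x\<bar> \<le> D"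
    using assms unfolding bounded_borel_on_cball_def by blast
  have "\<bar>f x * g x\<bar> \<le> C * D" if "norm x \<le> r" for x
    unfolding abs_mult using C[OF that] order_trans[OF abs_ge_zero C(1)[OF that]] by (intro mult_mono) auto
  then show ?thesis using assms unfolding bounded_borel_on_cball_def by auto
qed

lemma integral_bounded_mult_tendsto':
  fixes \<phi> u v :: "'a::euclidean_space \<Rightarrow> real"
  assumes \<phi>: "bounded_borel_on_cball r \<phi>" "\<And>x. r < norm x \<Longrightarrow> \<phi> x = 0"
    and L: "L2_on_balls u" "L2_on_balls v" "\<And>j. L2_on_balls (f j)" "\<And>j. L2_on_balls (g j)"
    and lf: "(\<lambda>j. \<integral>x. indicator (cball 0 r) x * (f j x - u x)\<^sup>2 \<partial>lborel) \<longlonglongrightarrow> 0"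
    and lg: "(\<lambda>j. \<integral>x. indicator (cball 0 r) x * (g j x - v x)\<^sup>2 \<partial>lborel) \<longlonglongrightarrow> 0"
  shows "(\<lambda>j. \<integral>x. \<phi> x * (f j x * g j x) \<partial>lborel) \<longlonglongrightarrow> (\<integral>x. \<phi> x * (u x * v x) \<partial>lborel)"
proof -
  obtain C where C: "\<And>x. norm x \<le> r \<Longrightarrow> \<bar>\<phi> x\<bar> \<le> C" and m: "\<phi> \<in> borel_measurable borel"
    using \<phi>(1) unfolding bounded_borel_on_cball_def by blast
  show ?thesis
    by (rule integral_bounded_mult_tendsto[OF m C \<phi>(2) _ _ _ _ _ _ _ _ lf lg])
       (auto intro: L2_on_balls_measurable L2_on_balls_integrable L
         L2_on_balls_integrable[OF L2_on_balls_diff[OF L(3) L(1)]] L2_on_balls_integrable[OF L2_on_balls_diff[OF L(4) L(2)]])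
qed

lemma L2_on_balls_integrable_mult:
  assumes \<phi>: "bounded_borel_on_cball r \<phi>" "\<And>x. r < norm x \<Longrightarrow> \<phi> x = 0"
    and L: "L2_on_balls u" "L2_on_balls v"
  shows "integrable lborel (\<lambda>x. \<phi> x * (u x * v x))"
proof -
  obtain C where C: "\<And>x. norm x \<le> r \<Longrightarrow> \<bar>\<phi> x\<bar> \<le> C" and [measurable]: "\<phi> \<in> borel_measurable borel"
    using \<phi>(1) unfolding bounded_borel_on_cball_def by blast
  note [measurable] = L2_on_balls_measurable[OF L(1)] L2_on_balls_measurable[OF L(2)]
  let ?I = "indicator (cball 0 r) :: 'a \<Rightarrow> real"
  show ?thesis
  proof (rule Bochner_Integration.integrable_bound)
    show "integrable lborel (\<lambda>x. \<bar>C\<bar> * (?I x * (u x)\<^sup>2 + ?I x * (v x)\<^sup>2))"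
      by (intro integrable_mult_right Bochner_Integration.integrable_add L2_on_balls_integrable L)
    show "AE x in lborel. norm (\<phi> x * (u x * v x)) \<le> norm (\<bar>C\<bar> * (?I x * (u x)\<^sup>2 + ?I x * (v x)\<^sup>2))"
    proof (rule AE_I2)
      fix x show "norm (\<phi> x * (u x * v x)) \<le> norm (\<bar>C\<bar> * (?I x * (u x)\<^sup>2 + ?I x * (v x)\<^sup>2))"
      proof (cases "norm x \<le> r")
        case True
        have "\<bar>u x * v x\<bar> \<le> 2 * \<bar>u x\<bar> * \<bar>v x\<bar>" by (simp add: abs_mult)
        also have "\<dots> \<le> (u x)\<^sup>2 + (v x)\<^sup>2"
          using sum_squares_bound[of "\<bar>u x\<bar>" "\<bar>v x\<bar>"] by simp
        finally have "\<bar>u x * v x\<bar> \<le> (u x)\<^sup>2 + (v x)\<^sup>2" .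
        moreover have "\<bar>\<phi> x\<bar> \<le> \<bar>C\<bar>" using C[OF True] by linarith
        ultimately have "\<bar>\<phi> x\<bar> * \<bar>u x * v x\<bar> \<le> \<bar>C\<bar> * ((u x)\<^sup>2 + (v x)\<^sup>2)" by (intro mult_mono) auto
        then show ?thesis using True by (simp add: abs_mult)
      qed (simp add: \<phi>(2))
    qed
  qed (unfold measurable_lborel2, measurable)
qed

text \<open>
  Both sides of \<open>carleman_cutoff\<close> are quadratic in \<open>f\<close> and its Laplacian with bounded coefficients of
  bounded support, so they converge along the mollified sequence, with \<open>\<Delta> f\<close> replaced by \<open>- F\<close>.
\<close>
theorem carleman_weak_solution:
  fixes u F Y :: "real ^ 'n::finite \<Rightarrow> real" and k :: nat
  assumes u: "L2_on_balls u" and F: "L2_on_balls F"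
    and weak: "\<And>\<phi>. test_function \<phi> \<Longrightarrow> (\<integral>y. u y * laplacian \<phi> y \<partial>lborel) = - (\<integral>y. F y * \<phi> y \<partial>lborel)"
    and b: "\<And>t. (b has_real_derivative b1 t) (at t)" "\<And>t. (b1 has_real_derivative b2 t) (at t)"
      "\<And>t. (b2 has_real_derivative b3 t) (at t)" "continuous_on UNIV b3"
    and supp: "\<And>t. t < a'\<^sup>2 \<or> r\<^sup>2 < t \<Longrightarrow> b t = 0 \<and> b1 t = 0 \<and> b2 t = 0 \<and> b3 t = 0"
    and a: "1 \<le> a" "a < a'" "0 \<le> r"
    and Y: "bounded_borel_on_cball r Y"
    and mono: "\<And>x t. a < norm x \<Longrightarrow> 1 \<le> t \<Longrightarrow> Y x \<le> t\<^sup>2 * Y (t *\<^sub>R x)"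
  defines "J \<equiv> \<lambda>x. weight_uu k b b1 b2 b3 Y x * (u x * u x) + weight_ul k b b1 Y x * (u x * (- F x))
      + weight_ll k b x * (- F x * - F x)"
  shows "integrable lborel J"
    and "integrable lborel (\<lambda>x. (x \<bullet> x) ^ (2*k+1) * (b (x \<bullet> x) * u x)\<^sup>2)"
    and "(4 * real k + 6)\<^sup>2 * (\<integral>x. (x \<bullet> x) ^ (2*k+1) * (b (x \<bullet> x) * u x)\<^sup>2 \<partial>lborel) \<le> (\<integral>x. J x \<partial>lborel)"
proof -
  let ?\<alpha> = "weight_uu k b b1 b2 b3 Y" and ?\<beta> = "weight_ul k b b1 Y" and ?\<gamma> = "weight_ll k b :: real^'n \<Rightarrow> real"
  let ?\<omega> = "\<lambda>x::real^'n. (x \<bullet> x) ^ (2*k+1) * (b (x \<bullet> x))\<^sup>2"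
  obtain f where f: "\<And>j. Ck 2 (f j)"
    "\<And>r. (\<lambda>j. \<integral>x. indicator (cball 0 r) x * (f j x - u x)\<^sup>2 \<partial>lborel) \<longlonglongrightarrow> 0"
    "\<And>r. (\<lambda>j. \<integral>x. indicator (cball 0 r) x * (laplacian (f j) x - (- F x))\<^sup>2 \<partial>lborel) \<longlonglongrightarrow> 0"
    using smooth_approximation[OF u F weak] by blast
  have fL: "L2_on_balls (f j)" "L2_on_balls (laplacian (f j))" for j
    using Ck2_D(2)[OF f(1)] Ck_laplacian[of 0 "f j"] f(1)[of j]
    by (auto intro!: L2_on_balls_continuous simp: numeral_2_eq_2)
  have F': "L2_on_balls (\<lambda>x. - F x)"
    using L2_on_balls_diff[OF L2_on_balls_continuous[OF continuous_on_const[of UNIV 0]] F] by simp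
  have bc: "continuous_on UNIV b" "continuous_on UNIV b1" "continuous_on UNIV b2"
    using b by (auto simp: continuous_on_eq_continuous_at intro: DERIV_isCont)
  have c: "continuous_on UNIV (\<lambda>x::real^'n. s (x \<bullet> x))" if "continuous_on UNIV s" for s :: "real \<Rightarrow> real"
    by (rule continuous_on_compose2[OF that]) (auto intro: continuous_intros)
  note cs = c[OF bc(1)] c[OF bc(2)] c[OF bc(3)] c[OF b(4)]
  have out: "r\<^sup>2 < x \<bullet> x" if "r < norm x" for x :: "real^'n"
    using that a by (auto simp: dot_square_norm intro: power_strict_mono)
  note z = supp[OF disjI2[OF out]]
  have \<alpha>: "bounded_borel_on_cball r ?\<alpha>" unfolding weight_uu_def power2_eq_square[of "Y _"]
    by (intro bounded_borel_add bounded_borel_mult Y bounded_borel_continuous;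
        intro continuous_intros cs; simp add: radial_lap_def grad_weight1_def grad_weight2_def; intro continuous_intros cs)
  have \<beta>: "bounded_borel_on_cball r ?\<beta>" unfolding weight_ul_def diff_conv_add_uminus
    by (intro bounded_borel_add bounded_borel_mult Y bounded_borel_continuous;
        intro continuous_intros cs; simp add: grad_weight0_def; intro continuous_intros cs)
  have \<gamma>: "bounded_borel_on_cball r ?\<gamma>" unfolding weight_ll_def
    by (intro bounded_borel_continuous continuous_intros cs)
  have \<omega>: "bounded_borel_on_cball r ?\<omega>"
    by (intro bounded_borel_continuous continuous_intros cs)
  have zero: "?\<alpha> x = 0" "?\<beta> x = 0" "?\<gamma> x = 0" "?\<omega> x = 0" if "r < norm x" for x
    using z[OF that] by (simp_all add: weight_uu_def weight_ul_def weight_ll_def radial_lap_def grad_weight0_def grad_weight1_def grad_weight2_def)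
  have i: "integrable lborel (\<lambda>x. ?\<alpha> x * (u x * u x))" "integrable lborel (\<lambda>x. ?\<beta> x * (u x * (- F x)))"
    "integrable lborel (\<lambda>x. ?\<gamma> x * (- F x * - F x))" "integrable lborel (\<lambda>x. ?\<omega> x * (u x * u x))"
    by (rule L2_on_balls_integrable_mult[of r, OF \<alpha> zero(1) u u] L2_on_balls_integrable_mult[of r, OF \<beta> zero(2) u F']
       L2_on_balls_integrable_mult[of r, OF \<gamma> zero(3) F' F'] L2_on_balls_integrable_mult[of r, OF \<omega> zero(4) u u]; assumption)+
  show "integrable lborel J" unfolding J_def using i(1-3) by auto
  have \<omega>eq: "(x \<bullet> x) ^ (2*k+1) * (b (x \<bullet> x) * g x)\<^sup>2 = ?\<omega> x * (g x * g x)" for g x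
    by (simp add: power2_eq_square)
  show "integrable lborel (\<lambda>x. (x \<bullet> x) ^ (2*k+1) * (b (x \<bullet> x) * u x)\<^sup>2)"
    unfolding \<omega>eq by (rule i(4))
  obtain B where Y': "Y \<in> borel_measurable borel" "\<And>x. norm x \<le> r \<Longrightarrow> \<bar>Y x\<bar> \<le> B"
    using Y unfolding bounded_borel_on_cball_def by blast
  have ineq: "(4 * real k + 6)\<^sup>2 * (\<integral>x. ?\<omega> x * (f j x * f j x) \<partial>lborel)
    \<le> (\<integral>x. ?\<alpha> x * (f j x * f j x) \<partial>lborel) + (\<integral>x. ?\<beta> x * (f j x * laplacian (f j) x) \<partial>lborel)
      + (\<integral>x. ?\<gamma> x * (laplacian (f j) x * laplacian (f j) x) \<partial>lborel)" for j
    using carleman_cutoff[OF f(1) b supp a Y' mono, of k] unfolding \<omega>eq by simp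
  have l1: "(\<lambda>j. (4 * real k + 6)\<^sup>2 * (\<integral>x. ?\<omega> x * (f j x * f j x) \<partial>lborel)) \<longlonglongrightarrow> (4 * real k + 6)\<^sup>2 * (\<integral>x. ?\<omega> x * (u x * u x) \<partial>lborel)"
    by (rule tendsto_mult_left, rule integral_bounded_mult_tendsto'[OF \<omega> _ u u fL(1) fL(1) f(2) f(2)]) (rule zero(4))
  have l2: "(\<lambda>j. (\<integral>x. ?\<alpha> x * (f j x * f j x) \<partial>lborel) + (\<integral>x. ?\<beta> x * (f j x * laplacian (f j) x) \<partial>lborel)
      + (\<integral>x. ?\<gamma> x * (laplacian (f j) x * laplacian (f j) x) \<partial>lborel))
    \<longlonglongrightarrow> (\<integral>x. ?\<alpha> x * (u x * u x) \<partial>lborel) + (\<integral>x. ?\<beta> x * (u x * (- F x)) \<partial>lborel)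
      + (\<integral>x. ?\<gamma> x * (- F x * - F x) \<partial>lborel)"
  proof (intro tendsto_add)
    show "(\<lambda>j. \<integral>x. ?\<alpha> x * (f j x * f j x) \<partial>lborel) \<longlonglongrightarrow> (\<integral>x. ?\<alpha> x * (u x * u x) \<partial>lborel)"
      by (rule integral_bounded_mult_tendsto'[OF \<alpha> _ u u fL(1) fL(1) f(2) f(2)]) (rule zero(1))
    show "(\<lambda>j. \<integral>x. ?\<beta> x * (f j x * laplacian (f j) x) \<partial>lborel) \<longlonglongrightarrow> (\<integral>x. ?\<beta> x * (u x * (- F x)) \<partial>lborel)"
      by (rule integral_bounded_mult_tendsto'[OF \<beta> _ u F' fL(1) fL(2) f(2) f(3)]) (rule zero(2))
    show "(\<lambda>j. \<integral>x. ?\<gamma> x * (laplacian (f j) x * laplacian (f j) x) \<partial>lborel) \<longlonglongrightarrow> (\<integral>x. ?\<gamma> x * (- F x * - F x) \<partial>lborel)"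
      by (rule integral_bounded_mult_tendsto'[OF \<gamma> _ F' F' fL(2) fL(2) f(3) f(3)]) (rule zero(3))
  qed
  have "(4 * real k + 6)\<^sup>2 * (\<integral>x. ?\<omega> x * (u x * u x) \<partial>lborel)
    \<le> (\<integral>x. ?\<alpha> x * (u x * u x) \<partial>lborel) + (\<integral>x. ?\<beta> x * (u x * (- F x)) \<partial>lborel)
      + (\<integral>x. ?\<gamma> x * (- F x * - F x) \<partial>lborel)"
    by (rule LIMSEQ_le[OF l1 l2]) (use ineq in blast)
  also have "\<dots> = (\<integral>x. J x \<partial>lborel)" unfolding J_def
    using i(1-3) by (simp add: Bochner_Integration.integral_add)
  finally show "(4 * real k + 6)\<^sup>2 * (\<integral>x. (x \<bullet> x) ^ (2*k+1) * (b (x \<bullet> x) * u x)\<^sup>2 \<partial>lborel) \<le> (\<integral>x. J x \<partial>lborel)"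
    unfolding \<omega>eq .
qed

subsection \<open>A concrete cutoff\<close>

definition pos_part :: "real \<Rightarrow> real" where "pos_part t = max 0 t"

text \<open>
  The positive part raised to the power \<open>k + 2\<close> is continuously differentiable also at \<open>0\<close>.
\<close>
lemma pos_part_power_deriv: "((\<lambda>t. pos_part t ^ Suc (Suc k)) has_real_derivative (real k + 2) * pos_part t ^ Suc k) (at t)"
proof -
  consider "t > 0" | "t < 0" | "t = 0" by linarith
  then show ?thesis
  proof cases
    case 1
    have "((\<lambda>t. t ^ Suc (Suc k)) has_real_derivative (real k + 2) * pos_part t ^ Suc k) (at t)"
      using DERIV_pow[of "Suc (Suc k)" t UNIV] 1 by (simp add: pos_part_def algebra_simps del: power_Suc)
    then show ?thesis
      by (rule has_field_derivative_transform_within_open[where S = "{0<..}"]) (use 1 in \<open>auto simp: pos_part_def\<close>)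
  next
    case 2
    have "((\<lambda>t. 0) has_real_derivative (real k + 2) * pos_part t ^ Suc k) (at t)" using 2 by (simp add: pos_part_def)
    then show ?thesis
      by (rule has_field_derivative_transform_within_open[where S = "{..<0}"]) (use 2 in \<open>auto simp: pos_part_def\<close>)
  next
    case 3
    have "((\<lambda>h. pos_part h ^ Suc k) \<longlongrightarrow> pos_part 0 ^ Suc k) (at 0)"
      unfolding pos_part_def by (intro tendsto_intros)
    then have "((\<lambda>h. pos_part h ^ Suc k) \<longlongrightarrow> 0) (at 0)" by (simp add: pos_part_def)
    then have "((\<lambda>h. pos_part h ^ Suc (Suc k) / h) \<longlongrightarrow> 0) (at 0)"
    proof (rule Lim_null_comparison[rotated])
      show "\<forall>\<^sub>F h in at 0. norm (pos_part h ^ Suc (Suc k) / h) \<le> pos_part h ^ Suc k"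
        by (rule always_eventually) (auto simp: pos_part_def max_def abs_mult)
    qed
    with 3 show ?thesis by (simp add: DERIV_def pos_part_def)
  qed
qed

text \<open>
  The function \<open>1 - (1 - t\<^sub>+ ^ 4)\<^sub>+ ^ 4\<close> climbs from \<open>0\<close> to \<open>1\<close> on the unit interval. The fourth powers make
  it three times continuously differentiable, and its derivatives are explicit.
\<close>
definition step0 :: "real \<Rightarrow> real" where "step0 t = 1 - pos_part (1 - pos_part t ^ 4) ^ 4"
definition step1 :: "real \<Rightarrow> real" where "step1 t = 16 * (pos_part (1 - pos_part t ^ 4) ^ 3 * pos_part t ^ 3)"
definition step2 :: "real \<Rightarrow> real" where
  "step2 t = 48 * (pos_part (1 - pos_part t ^ 4) ^ 3 * pos_part t ^ 2) - 192 * (pos_part (1 - pos_part t ^ 4) ^ 2 * pos_part t ^ 6)"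
definition step3 :: "real \<Rightarrow> real" where
  "step3 t = 96 * (pos_part (1 - pos_part t ^ 4) ^ 3 * pos_part t) - 1728 * (pos_part (1 - pos_part t ^ 4) ^ 2 * pos_part t ^ 5)
     + 1536 * (pos_part (1 - pos_part t ^ 4) * pos_part t ^ 9)"

lemma step_derivs:
  shows "(step0 has_real_derivative step1 t) (at t)" "(step1 has_real_derivative step2 t) (at t)"
    "(step2 has_real_derivative step3 t) (at t)" "continuous_on UNIV step3"
proof -
  have p: "((\<lambda>t. pos_part t ^ 2) has_real_derivative 2 * pos_part t) (at t)"
    "((\<lambda>t. pos_part t ^ 3) has_real_derivative 3 * pos_part t ^ 2) (at t)"
    "((\<lambda>t. pos_part t ^ 4) has_real_derivative 4 * pos_part t ^ 3) (at t)"
    "((\<lambda>t. pos_part t ^ 6) has_real_derivative 6 * pos_part t ^ 5) (at t)" for t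
    using pos_part_power_deriv[of 0 t] pos_part_power_deriv[of 1 t] pos_part_power_deriv[of 2 t] pos_part_power_deriv[of 4 t]
    by (simp_all add: eval_nat_numeral)
  have u: "((\<lambda>t. 1 - pos_part t ^ 4) has_real_derivative - (4 * pos_part t ^ 3)) (at t)" for t
    using DERIV_diff[OF DERIV_const p(3)] by simp
  have c: "((\<lambda>t. pos_part (1 - pos_part t ^ 4) ^ 2) has_real_derivative 2 * pos_part (1 - pos_part t ^ 4) * - (4 * pos_part t ^ 3)) (at t)"
    "((\<lambda>t. pos_part (1 - pos_part t ^ 4) ^ 3) has_real_derivative 3 * pos_part (1 - pos_part t ^ 4) ^ 2 * - (4 * pos_part t ^ 3)) (at t)"
    "((\<lambda>t. pos_part (1 - pos_part t ^ 4) ^ 4) has_real_derivative 4 * pos_part (1 - pos_part t ^ 4) ^ 3 * - (4 * pos_part t ^ 3)) (at t)" for t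
    by (rule DERIV_chain2[OF p(1) u] DERIV_chain2[OF p(2) u] DERIV_chain2[OF p(3) u])+
  show "(step0 has_real_derivative step1 t) (at t)"
    unfolding step0_def[abs_def] step1_def
    by (rule derivative_eq_intros c p refl | simp)+
  show "(step1 has_real_derivative step2 t) (at t)"
    unfolding step1_def[abs_def] step2_def
    by (rule derivative_eq_intros c p refl)+ (simp add: algebra_simps eval_nat_numeral)
  show "(step2 has_real_derivative step3 t) (at t)"
    unfolding step2_def[abs_def] step3_def
    by (rule derivative_eq_intros c p refl)+ (simp add: algebra_simps eval_nat_numeral)
  show "continuous_on UNIV step3"
    unfolding step3_def pos_part_def by (intro continuous_intros)
qed

lemma step_outside:
  "t \<le> 0 \<Longrightarrow> step0 t = 0 \<and> step1 t = 0 \<and> step2 t = 0 \<and> step3 t = 0"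
  "1 \<le> t \<Longrightarrow> step0 t = 1 \<and> step1 t = 0 \<and> step2 t = 0 \<and> step3 t = 0"
proof -
  show "t \<le> 0 \<Longrightarrow> step0 t = 0 \<and> step1 t = 0 \<and> step2 t = 0 \<and> step3 t = 0"
    by (simp add: step0_def step1_def step2_def step3_def pos_part_def)
  assume "1 \<le> t"
  then have "1 \<le> pos_part t ^ 4" by (simp add: pos_part_def one_le_power)
  then have "pos_part (1 - pos_part t ^ 4) = 0" by (simp add: pos_part_def)
  then show "step0 t = 1 \<and> step1 t = 0 \<and> step2 t = 0 \<and> step3 t = 0"
    by (simp add: step0_def step1_def step2_def step3_def)
qed

lemma step_bounds: "\<bar>step1 t\<bar> \<le> 4000" "\<bar>step2 t\<bar> \<le> 4000" "\<bar>step3 t\<bar> \<le> 4000"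
proof -
  have "\<bar>step1 t\<bar> \<le> 4000 \<and> \<bar>step2 t\<bar> \<le> 4000 \<and> \<bar>step3 t\<bar> \<le> 4000"
  proof (cases "1 \<le> t")
    case True
    then show ?thesis using step_outside(2) by simp
  next
    case False
    define p where "p = pos_part t"
    define v where "v = pos_part (1 - p ^ 4)"
    have p: "0 \<le> p" "p \<le> 1" using False by (auto simp: p_def pos_part_def)
    have v: "0 \<le> v" "v \<le> 1" using p by (auto simp: v_def pos_part_def)
    have m: "0 \<le> v ^ i * p ^ j" "v ^ i * p ^ j \<le> 1" for i j
      using p v by (auto intro!: mult_le_one power_le_one)
    note mm = m[of 3 3] m[of 3 2] m[of 2 6] m[of 3 1] m[of 2 5] m[of 1 9]
    have e: "step1 t = 16 * (v ^ 3 * p ^ 3)" "step2 t = 48 * (v ^ 3 * p ^ 2) - 192 * (v ^ 2 * p ^ 6)"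
      "step3 t = 96 * (v ^ 3 * p ^ 1) - 1728 * (v ^ 2 * p ^ 5) + 1536 * (v ^ 1 * p ^ 9)"
      by (simp_all add: step1_def step2_def step3_def v_def p_def)
    show ?thesis unfolding e using mm by linarith
  qed
  then show "\<bar>step1 t\<bar> \<le> 4000" "\<bar>step2 t\<bar> \<le> 4000" "\<bar>step3 t\<bar> \<le> 4000" by auto
qed

text \<open>
  The difference of an upward step at \<open>c\<close> and one from \<open>\<rho>\<close> to \<open>2 \<rho>\<close>. The bounds on the derivatives do not
  depend on \<open>\<rho>\<close>, which is what allows \<open>\<rho> \<rightarrow> \<infinity>\<close> with the weight exponent fixed.
\<close>
lemma annular_cutoff:
  fixes c \<rho> :: real
  assumes "0 < c" "c + 1 \<le> \<rho>"
  obtains b b1 b2 b3 where "\<And>t. (b has_real_derivative b1 t) (at t)" "\<And>t. (b1 has_real_derivative b2 t) (at t)"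
      "\<And>t. (b2 has_real_derivative b3 t) (at t)" "continuous_on UNIV b3"
    "\<forall>t. t \<le> c \<or> 2 * \<rho> \<le> t \<longrightarrow> b t = 0 \<and> b1 t = 0 \<and> b2 t = 0 \<and> b3 t = 0"
    "\<forall>t. c + 1 \<le> t \<and> t \<le> \<rho> \<longrightarrow> b t = 1 \<and> b1 t = 0 \<and> b2 t = 0 \<and> b3 t = 0"
    "\<And>t. \<bar>b1 t\<bar> \<le> 8000" "\<And>t. \<bar>b2 t\<bar> \<le> 8000" "\<And>t. \<bar>b3 t\<bar> \<le> 8000"
proof -
  have r: "1 \<le> \<rho>" using assms by simp
  define b where "b t = step0 (t - c) - step0 (t / \<rho> - 1)" for t
  define b1 where "b1 t = step1 (t - c) - step1 (t / \<rho> - 1) / \<rho>" for t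
  define b2 where "b2 t = step2 (t - c) - step2 (t / \<rho> - 1) / \<rho> ^ 2" for t
  define b3 where "b3 t = step3 (t - c) - step3 (t / \<rho> - 1) / \<rho> ^ 3" for t
  have sh: "((\<lambda>t. t - c) has_real_derivative 1) (at t)" for t
    by (auto intro!: derivative_eq_intros)
  have sc: "((\<lambda>t. t / \<rho> - 1) has_real_derivative 1 / \<rho>) (at t)" for t
    using r by (auto intro!: derivative_eq_intros)
  have bd: "\<bar>x - y / \<rho> ^ i\<bar> \<le> 8000" if "\<bar>x\<bar> \<le> 4000" "\<bar>y\<bar> \<le> 4000" for x y i
  proof -
    have "\<bar>y / \<rho> ^ i\<bar> \<le> \<bar>y\<bar>" using one_le_power[OF r, of i] r
      by (simp add: abs_divide divide_le_eq mult_le_cancel_left1)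
    with that show ?thesis by linarith
  qed
  show ?thesis
  proof (rule that[of b b1 b2 b3])
    show "(b has_real_derivative b1 t) (at t)" for t
      unfolding b_def[abs_def] b1_def
      using DERIV_diff[OF DERIV_chain2[OF step_derivs(1) sh] DERIV_chain2[OF step_derivs(1) sc]] by simp
    show "(b1 has_real_derivative b2 t) (at t)" for t
      unfolding b1_def[abs_def] b2_def
      using DERIV_diff[OF DERIV_chain2[OF step_derivs(2) sh] DERIV_cdivide[OF DERIV_chain2[OF step_derivs(2) sc], of \<rho>]]
      by (simp add: power2_eq_square)
    show "(b2 has_real_derivative b3 t) (at t)" for t
      unfolding b2_def[abs_def] b3_def
      using DERIV_diff[OF DERIV_chain2[OF step_derivs(3) sh] DERIV_cdivide[OF DERIV_chain2[OF step_derivs(3) sc], of "\<rho> ^ 2"]]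
      by (simp add: eval_nat_numeral)
    show "continuous_on UNIV b3"
      unfolding b3_def using r
      by (intro continuous_intros continuous_on_compose2[OF step_derivs(4)]) auto
    show "\<forall>t. t \<le> c \<or> 2 * \<rho> \<le> t \<longrightarrow> b t = 0 \<and> b1 t = 0 \<and> b2 t = 0 \<and> b3 t = 0"
    proof (intro allI impI)
      fix t assume that: "t \<le> c \<or> 2 * \<rho> \<le> t"
      show "b t = 0 \<and> b1 t = 0 \<and> b2 t = 0 \<and> b3 t = 0"
      proof (cases "t \<le> c")
        case True
        then have "t - c \<le> 0" "t / \<rho> - 1 \<le> 0" using assms by (auto simp: field_simps)
        then show ?thesis using step_outside(1) by (simp add: b_def b1_def b2_def b3_def)
      next
        case False
        then have "1 \<le> t - c" "1 \<le> t / \<rho> - 1" using that assms by (auto simp: field_simps)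
        then show ?thesis using step_outside(2) by (simp add: b_def b1_def b2_def b3_def)
      qed
    qed
    show "\<forall>t. c + 1 \<le> t \<and> t \<le> \<rho> \<longrightarrow> b t = 1 \<and> b1 t = 0 \<and> b2 t = 0 \<and> b3 t = 0"
    proof (intro allI impI)
      fix t assume that: "c + 1 \<le> t \<and> t \<le> \<rho>"
      have "1 \<le> t - c" "t / \<rho> - 1 \<le> 0" using that r by (auto simp: field_simps)
      then show "b t = 1 \<and> b1 t = 0 \<and> b2 t = 0 \<and> b3 t = 0" using step_outside by (simp add: b_def b1_def b2_def b3_def)
    qed
    show "\<bar>b1 t\<bar> \<le> 8000" for t unfolding b1_def using bd[OF step_bounds(1) step_bounds(1), of _ _ 1] by simp
    show "\<bar>b2 t\<bar> \<le> 8000" for t unfolding b2_def by (rule bd[OF step_bounds(2) step_bounds(2)])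
    show "\<bar>b3 t\<bar> \<le> 8000" for t unfolding b3_def by (rule bd[OF step_bounds(3) step_bounds(3)])
  qed
qed

section \<open>Vanishing near infinity\<close>

text \<open>
  The growth in \<open>k\<close> beyond the factor \<open>t ^ (2k)\<close> is only \<open>(k + 1)\<^sup>2\<close>, coming from the two
  derivatives that fall on the weight. It is compensated by the factor \<open>(4k + 6)\<^sup>2\<close> of the Carleman
  inequality.
\<close>
lemma cutoff_weight_bound:
  fixes t n B M y :: real
  assumes t: "1 \<le> t" and n: "0 \<le> n" and B: "\<bar>b1 t\<bar> \<le> B" "\<bar>b2 t\<bar> \<le> B" "\<bar>b3 t\<bar> \<le> B"
    and y: "\<bar>y\<bar> \<le> M * t ^ N" "0 \<le> M"
  shows "\<bar>3 * t ^ (2*k+4) * (radial_lap n b1 b2 t)\<^sup>2 + 6 * radial_lap n (grad_weight1 k b1 b2) (grad_weight2 k b1 b2 b3) t + 12 * grad_weight0 k b1 t * y\<bar>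
    \<le> (3 * (4 + 2 * n)\<^sup>2 + 6 * (704 + 56 * n) + 48 * M) * B\<^sup>2 * (real k + 1)\<^sup>2 * t ^ (2*k+6+N)"
proof -
  have B0: "0 \<le> B" using B(1) by linarith
  define T where "T = t ^ (2*k+5)"
  define k1 where "k1 = real k + 1"
  have k1: "1 \<le> k1" "k1 \<le> k1\<^sup>2" "1 \<le> k1\<^sup>2" unfolding k1_def by (auto simp: power2_eq_square algebra_simps)
  have T0: "0 \<le> T" unfolding T_def using t by simp
  have T: "t ^ (2*k+3) \<le> T" "t ^ (2*k+4) \<le> T" unfolding T_def using t by (auto intro!: power_increasing)
  have tN: "1 \<le> t ^ N" using t by (rule one_le_power)
  have q: "\<bar>b1 t * b1 t\<bar> \<le> B\<^sup>2" "\<bar>b1 t * b2 t\<bar> \<le> B\<^sup>2" "\<bar>b2 t * b2 t\<bar> \<le> B\<^sup>2" "\<bar>b1 t * b3 t\<bar> \<le> B\<^sup>2"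
    unfolding abs_mult power2_eq_square by (intro mult_mono B B0 abs_ge_zero)+
  have monomial: "\<bar>a * s * z\<bar> \<le> a * (B\<^sup>2 * T)" if "0 \<le> a" "0 \<le> s" "s \<le> T" "\<bar>z\<bar> \<le> B\<^sup>2" for a s z :: real
  proof -
    have "\<bar>a * s * z\<bar> = a * (\<bar>z\<bar> * s)" using that by (simp add: abs_mult)
    also have "\<dots> \<le> a * (B\<^sup>2 * T)" using that by (intro mult_left_mono mult_mono) auto
    finally show ?thesis .
  qed
  have s0: "0 \<le> t ^ i" for i using t by simp
  have c0: "\<bar>grad_weight0 k b1 t\<bar> \<le> 4 * (B\<^sup>2 * T)"
    unfolding grad_weight0_def power2_eq_square[of "b1 t"] T_def[symmetric] by (rule monomial) (use T0 q in auto)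
  have c1: "\<bar>grad_weight1 k b1 b2 t\<bar> \<le> 28 * k1\<^sup>2 * (B\<^sup>2 * T)"
  proof -
    have "\<bar>4 * (2 * real k + 5) * t ^ (2*k+4) * (b1 t * b1 t)\<bar> \<le> 4 * (2 * real k + 5) * (B\<^sup>2 * T)"
      by (rule monomial) (use T s0 q in auto)
    moreover have "\<bar>8 * T * (b1 t * b2 t)\<bar> \<le> 8 * (B\<^sup>2 * T)"
      by (rule monomial) (use T0 q in auto)
    ultimately have "\<bar>grad_weight1 k b1 b2 t\<bar> \<le> (4 * (2 * real k + 5) + 8) * (B\<^sup>2 * T)"
      unfolding grad_weight1_def power2_eq_square[of "b1 t"] T_def[symmetric] distrib_right by linarith
    also have "\<dots> \<le> 28 * k1\<^sup>2 * (B\<^sup>2 * T)"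
    proof (rule mult_right_mono)
      have "4 * (2 * real k + 5) + 8 \<le> 28 * k1" by (simp add: k1_def)
      then show "4 * (2 * real k + 5) + 8 \<le> 28 * k1\<^sup>2" using k1 by linarith
    qed (use T0 in simp)
    finally show ?thesis .
  qed
  have c2: "\<bar>grad_weight2 k b1 b2 b3 t\<bar> \<le> 176 * k1\<^sup>2 * (B\<^sup>2 * T)"
  proof -
    have "\<bar>4 * (2 * real k + 5) * (2 * real k + 4) * t ^ (2*k+3) * (b1 t * b1 t)\<bar> \<le> 4 * (2 * real k + 5) * (2 * real k + 4) * (B\<^sup>2 * T)"
      by (rule monomial) (use T s0 q in auto)
    moreover have "\<bar>16 * (2 * real k + 5) * t ^ (2*k+4) * (b1 t * b2 t)\<bar> \<le> 16 * (2 * real k + 5) * (B\<^sup>2 * T)"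
      by (rule monomial) (use T s0 q in auto)
    moreover have "\<bar>8 * T * (b2 t * b2 t)\<bar> \<le> 8 * (B\<^sup>2 * T)" "\<bar>8 * T * (b1 t * b3 t)\<bar> \<le> 8 * (B\<^sup>2 * T)"
      by (rule monomial; use T0 q in auto)+
    moreover have "8 * T * ((b2 t)\<^sup>2 + b1 t * b3 t) = 8 * T * (b2 t * b2 t) + 8 * T * (b1 t * b3 t)"
      by (simp add: power2_eq_square algebra_simps)
    ultimately have "\<bar>grad_weight2 k b1 b2 b3 t\<bar> \<le> (4 * (2 * real k + 5) * (2 * real k + 4) + 16 * (2 * real k + 5) + 16) * (B\<^sup>2 * T)"
      unfolding grad_weight2_def power2_eq_square[of "b1 t"] T_def[symmetric] distrib_right by linarith
    also have "\<dots> \<le> 176 * k1\<^sup>2 * (B\<^sup>2 * T)"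
      by (rule mult_right_mono, simp add: k1_def power2_eq_square algebra_simps, intro mult_nonneg_nonneg T0 zero_le_power2)
    finally show ?thesis .
  qed
  define Q where "Q = B\<^sup>2 * k1\<^sup>2 * t ^ (2*k+6+N)"
  have Tt: "t * T = t ^ (2*k+6)" unfolding T_def by (simp add: eval_nat_numeral)
  have Q1: "k1\<^sup>2 * (B\<^sup>2 * (t * T)) \<le> Q"
  proof -
    have "k1\<^sup>2 * (B\<^sup>2 * (t * T)) * 1 \<le> k1\<^sup>2 * (B\<^sup>2 * (t * T)) * t ^ N"
      by (rule mult_left_mono[OF tN]) (use T0 t in simp)
    then show ?thesis unfolding Q_def Tt by (simp add: power_add mult_ac)
  qed
  have Q2: "k1\<^sup>2 * (B\<^sup>2 * T) \<le> k1\<^sup>2 * (B\<^sup>2 * (t * T))"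
    by (intro mult_left_mono) (use T0 t mult_right_mono[of 1 t T] in auto)
  have r2: "\<bar>radial_lap n (grad_weight1 k b1 b2) (grad_weight2 k b1 b2 b3) t\<bar> \<le> (704 + 56 * n) * Q"
  proof -
    have "\<bar>4 * t * grad_weight2 k b1 b2 b3 t\<bar> = 4 * t * \<bar>grad_weight2 k b1 b2 b3 t\<bar>" using t by (simp add: abs_mult)
    also have "\<dots> \<le> 4 * t * (176 * k1\<^sup>2 * (B\<^sup>2 * T))"
      by (rule mult_left_mono[OF c2]) (use t in simp)
    also have "\<dots> = 704 * (k1\<^sup>2 * (B\<^sup>2 * (t * T)))" by simp
    also have "\<dots> \<le> 704 * Q" using Q1 by simp
    finally have 1: "\<bar>4 * t * grad_weight2 k b1 b2 b3 t\<bar> \<le> 704 * Q" .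
    have "\<bar>2 * n * grad_weight1 k b1 b2 t\<bar> = 2 * n * \<bar>grad_weight1 k b1 b2 t\<bar>" using n by (simp add: abs_mult)
    also have "\<dots> \<le> 2 * n * (28 * k1\<^sup>2 * (B\<^sup>2 * T))"
      by (rule mult_left_mono[OF c1]) (use n in simp)
    also have "\<dots> = 56 * n * (k1\<^sup>2 * (B\<^sup>2 * T))" by simp
    also have "\<dots> \<le> 56 * n * Q" using Q1 Q2 n by (intro mult_left_mono) auto
    finally have 2: "\<bar>2 * n * grad_weight1 k b1 b2 t\<bar> \<le> 56 * n * Q" .
    show ?thesis unfolding radial_lap_def using 1 2 by (simp add: distrib_right)
  qed
  have r1: "\<bar>3 * t ^ (2*k+4) * (radial_lap n b1 b2 t)\<^sup>2\<bar> \<le> 3 * (4 + 2 * n)\<^sup>2 * Q"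
  proof -
    have "\<bar>4 * t * b2 t\<bar> \<le> 4 * t * B" "\<bar>2 * n * b1 t\<bar> \<le> 2 * n * B" unfolding abs_mult using t n
      by (simp_all add: mult_left_mono B)
    moreover have "2 * n * B \<le> 2 * n * (t * B)" using n t B0 mult_right_mono[of 1 t B] by (intro mult_left_mono) auto
    ultimately have "\<bar>radial_lap n b1 b2 t\<bar> \<le> (4 + 2 * n) * (t * B)"
      unfolding radial_lap_def by (simp add: algebra_simps)
    then have "(radial_lap n b1 b2 t)\<^sup>2 \<le> ((4 + 2 * n) * (t * B))\<^sup>2"
      using power_mono[of "\<bar>radial_lap n b1 b2 t\<bar>" _ 2] by simp
    then have "t ^ (2*k+4) * (radial_lap n b1 b2 t)\<^sup>2 \<le> t ^ (2*k+4) * ((4 + 2 * n) * (t * B))\<^sup>2"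
      by (intro mult_left_mono s0)
    also have "\<dots> = (4 + 2 * n)\<^sup>2 * (B\<^sup>2 * (t * T))"
      unfolding Tt by (simp add: power_mult_distrib power2_eq_square eval_nat_numeral)
    also have "\<dots> \<le> (4 + 2 * n)\<^sup>2 * Q"
    proof (rule mult_left_mono)
      have "1 * (B\<^sup>2 * (t * T)) \<le> k1\<^sup>2 * (B\<^sup>2 * (t * T))" by (intro mult_right_mono k1) (use T0 t in simp)
      then show "B\<^sup>2 * (t * T) \<le> Q" using Q1 by simp
    qed simp
    finally show ?thesis using s0 by (simp add: abs_mult)
  qed
  have r3: "\<bar>12 * grad_weight0 k b1 t * y\<bar> \<le> 48 * M * Q"
  proof -
    have "\<bar>grad_weight0 k b1 t\<bar> * \<bar>y\<bar> \<le> (4 * (B\<^sup>2 * T)) * (M * t ^ N)" using c0 y T0 by (intro mult_mono) auto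
    also have "\<dots> = 4 * M * (B\<^sup>2 * (T * t ^ N))" by simp
    also have "\<dots> \<le> 4 * M * Q"
    proof (rule mult_left_mono)
      have "B\<^sup>2 * (T * t ^ N) = 1 * (B\<^sup>2 * t ^ (2*k+5+N))" by (simp add: T_def power_add)
      also have "\<dots> \<le> k1\<^sup>2 * (B\<^sup>2 * t ^ (2*k+6+N))"
      proof (rule mult_mono)
        show "B\<^sup>2 * t ^ (2*k+5+N) \<le> B\<^sup>2 * t ^ (2*k+6+N)"
          by (rule mult_left_mono, rule power_increasing) (use t in auto)
      qed (use k1 s0 in auto)
      finally show "B\<^sup>2 * (T * t ^ N) \<le> Q" by (simp add: Q_def mult_ac)
    qed (use y in simp)
    finally show ?thesis by (simp add: abs_mult mult_ac)
  qed
  have "\<bar>3 * t ^ (2*k+4) * (radial_lap n b1 b2 t)\<^sup>2 + 6 * radial_lap n (grad_weight1 k b1 b2) (grad_weight2 k b1 b2 b3) t + 12 * grad_weight0 k b1 t * y\<bar>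
    \<le> 3 * (4 + 2 * n)\<^sup>2 * Q + 6 * ((704 + 56 * n) * Q) + 48 * M * Q"
    using r1 r2 r3 by linarith
  also have "\<dots> = (3 * (4 + 2 * n)\<^sup>2 + 6 * (704 + 56 * n) + 48 * M) * B\<^sup>2 * k1\<^sup>2 * t ^ (2*k+6+N)"
    by (simp add: Q_def algebra_simps)
  finally show ?thesis unfolding k1_def .
qed

text \<open>
  Where \<open>F = Y u\<close> the first summand vanishes, and where the cutoff is locally constant the two others do.
\<close>
lemma cut_integrand_eq:
  fixes u F Y :: "real ^ 'n::finite \<Rightarrow> real"
  shows "weight_uu k b b1 b2 b3 Y x * (u x * u x) + weight_ul k b b1 Y x * (u x * (- F x)) + weight_ll k b x * (- F x * - F x)
    = 3 * (x \<bullet> x) ^ (2*k+4) * (b (x \<bullet> x))\<^sup>2 * (Y x * u x - F x)\<^sup>2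
      + (3 * (x \<bullet> x) ^ (2*k+4) * (radial_lap (real CARD('n)) b1 b2 (x \<bullet> x))\<^sup>2
         + 6 * radial_lap (real CARD('n)) (grad_weight1 k b1 b2) (grad_weight2 k b1 b2 b3) (x \<bullet> x)) * (u x)\<^sup>2
      + 12 * grad_weight0 k b1 (x \<bullet> x) * (u x * F x)"
proof -
  define P where "P = (x \<bullet> x) ^ (2*k+4)"
  define l1 where "l1 = radial_lap (real CARD('n)) b1 b2 (x \<bullet> x)"
  define l2 where "l2 = radial_lap (real CARD('n)) (grad_weight1 k b1 b2) (grad_weight2 k b1 b2 b3) (x \<bullet> x)"
  show ?thesis
    unfolding weight_uu_def weight_ul_def weight_ll_def P_def[symmetric] l1_def[symmetric] l2_def[symmetric]
    by (simp add: power2_eq_square algebra_simps)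
qed

lemma integrable_indicator_sq:
  fixes u :: "'a::euclidean_space \<Rightarrow> real"
  assumes "L2_on_balls u" "S \<in> sets borel" "\<And>x. x \<in> S \<Longrightarrow> norm x \<le> r"
  shows "integrable lborel (\<lambda>x. indicator S x * (u x)\<^sup>2)"
proof -
  have "bounded_borel_on_cball r (indicator S :: 'a \<Rightarrow> real)"
    unfolding bounded_borel_on_cball_def using assms(2) by (auto intro!: exI[of _ 1] simp: indicator_def)
  from L2_on_balls_integrable_mult[OF this _ assms(1) assms(1)] show ?thesis
    using assms(3) by (force simp: power2_eq_square indicator_def)
qed

lemma norm_le_of_sq_le: "x \<bullet> x \<le> s \<Longrightarrow> norm x \<le> s + 1" for x :: "'a::euclidean_space"
proof -
  assume "x \<bullet> x \<le> s"
  then have "(norm x)\<^sup>2 \<le> s" by (simp add: dot_square_norm)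
  moreover have "2 * norm x \<le> (norm x)\<^sup>2 + 1" using sum_squares_bound[of 1 "norm x"] by simp
  ultimately show ?thesis using norm_ge_zero[of x] by linarith
qed

text \<open>
  Let \<open>c = (R + 1)\<^sup>2\<close>, and use a cutoff that rises for \<open>c \<le> q \<le> c + 1\<close> and falls for \<open>\<rho> \<le> q \<le> 2 \<rho>\<close>,
  \<open>\<rho> = \<sigma>\<^sup>2\<close>. By decay the outer error tends to \<open>0\<close> as \<open>\<sigma> \<rightarrow> \<infinity>\<close> for fixed \<open>k\<close>. The inner error is
  of size \<open>(c + 1) ^ (2k)\<close>, whereas the mass of \<open>u\<close> in \<open>q \<ge> c + 2\<close> is weighted with at least
  \<open>(c + 2) ^ (2k)\<close>; let \<open>k \<rightarrow> \<infinity>\<close>.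
\<close>
theorem vanishing_near_infinity:
  fixes u F Y :: "real ^ 'n::finite \<Rightarrow> real"
  assumes u: "L2_on_balls u" and F: "L2_on_balls F"
    and weak: "\<And>\<phi>. test_function \<phi> \<Longrightarrow> (\<integral>y. u y * laplacian \<phi> y \<partial>lborel) = - (\<integral>y. F y * \<phi> y \<partial>lborel)"
    and R: "1 \<le> R"
    and Y: "\<And>r. bounded_borel_on_cball r Y"
    and mono: "\<And>x t. R < norm x \<Longrightarrow> 1 \<le> t \<Longrightarrow> Y x \<le> t\<^sup>2 * Y (t *\<^sub>R x)"
    and Ybound: "\<And>x. 1 \<le> norm x \<Longrightarrow> \<bar>Y x\<bar> \<le> M * (x \<bullet> x) ^ N" and M: "0 \<le> M"
    and FY: "AE x in lborel. R < norm x \<longrightarrow> F x = Y x * u x"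
    and decay: "\<And>p::nat. (\<lambda>\<sigma>::nat. (real \<sigma>) ^ p *
        (\<integral>x. indicator {x. real \<sigma> < norm x \<and> x \<bullet> x \<le> 2 * (real \<sigma>)\<^sup>2} x * (u x)\<^sup>2 \<partial>lborel)) \<longlonglongrightarrow> 0"
  shows "AE x in lborel. (R + 1)\<^sup>2 + 2 \<le> x \<bullet> x \<longrightarrow> u x = 0"
proof -
  define c where "c = (R + 1)\<^sup>2"
  define n where "n = real CARD('n)"
  have c1: "1 \<le> c" unfolding c_def using R by (simp add: one_le_power)
  define A where "A = {x::real^'n. c \<le> x \<bullet> x \<and> x \<bullet> x \<le> c + 1}"
  define Z where "Z \<sigma> = {x::real^'n. real \<sigma> < norm x \<and> x \<bullet> x \<le> 2 * (real \<sigma>)\<^sup>2}" for \<sigma> :: nat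
  define S where "S \<tau> = {x::real^'n. c + 2 \<le> x \<bullet> x \<and> x \<bullet> x \<le> \<tau>}" for \<tau>
  have [measurable]: "A \<in> sets borel" "Z \<sigma> \<in> sets borel" "S \<tau> \<in> sets borel" for \<sigma> \<tau>
    unfolding A_def Z_def S_def by measurable
  note um[measurable] = L2_on_balls_measurable[OF u]
  have iA: "integrable lborel (\<lambda>x. indicator A x * (u x)\<^sup>2)"
    by (rule integrable_indicator_sq[OF u, of _ "c + 1 + 1"]) (auto simp: A_def dest!: norm_le_of_sq_le)
  have iZ: "integrable lborel (\<lambda>x. indicator (Z \<sigma>) x * (u x)\<^sup>2)" for \<sigma>
    by (rule integrable_indicator_sq[OF u, of _ "2 * (real \<sigma>)\<^sup>2 + 1"]) (auto simp: Z_def dest!: norm_le_of_sq_le)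
  have iS: "integrable lborel (\<lambda>x. indicator (S \<tau>) x * (u x)\<^sup>2)" for \<tau>
    by (rule integrable_indicator_sq[OF u, of _ "\<tau> + 1"]) (auto simp: S_def dest!: norm_le_of_sq_le)
  define IA where "IA = (\<integral>x. indicator A x * (u x)\<^sup>2 \<partial>lborel)"
  define IZ where "IZ \<sigma> = (\<integral>x. indicator (Z \<sigma>) x * (u x)\<^sup>2 \<partial>lborel)" for \<sigma>
  define IS where "IS \<tau> = (\<integral>x. indicator (S \<tau>) x * (u x)\<^sup>2 \<partial>lborel)" for \<tau>
  have IS0: "0 \<le> IS \<tau>" for \<tau> unfolding IS_def by (intro integral_nonneg_AE AE_I2) simp
  define C0 where "C0 = (3 * (4 + 2 * n)\<^sup>2 + 6 * (704 + 56 * n) + 48 * M) * 8000\<^sup>2"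
  have C0: "0 \<le> C0" unfolding C0_def n_def using M by simp
  have key: "(c + 2) ^ (2*k+1) * IS \<tau> \<le> C0 * ((c + 1) ^ (2*k+6+N) * IA + (2 * (real \<sigma>)\<^sup>2) ^ (2*k+6+N) * IZ \<sigma>)"
    if \<sigma>: "c + 2 \<le> (real \<sigma>)\<^sup>2" "\<tau> \<le> (real \<sigma>)\<^sup>2" for \<sigma> :: nat and \<tau> and k
  proof -
    define \<rho> where "\<rho> = (real \<sigma>)\<^sup>2"
    define p where "p = 2*k+6+N"
    have \<rho>: "c + 1 \<le> \<rho>" "1 \<le> \<rho>" using \<sigma> c1 by (auto simp: \<rho>_def)
    have c0: "0 < c" using c1 by simp
    obtain b b1 b2 b3 where b: "\<And>t. (b has_real_derivative b1 t) (at t)" "\<And>t. (b1 has_real_derivative b2 t) (at t)"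
      "\<And>t. (b2 has_real_derivative b3 t) (at t)" "continuous_on UNIV b3"
      and b0': "\<forall>t. t \<le> c \<or> 2 * \<rho> \<le> t \<longrightarrow> b t = 0 \<and> b1 t = 0 \<and> b2 t = 0 \<and> b3 t = 0"
      and bone': "\<forall>t. c + 1 \<le> t \<and> t \<le> \<rho> \<longrightarrow> b t = 1 \<and> b1 t = 0 \<and> b2 t = 0 \<and> b3 t = 0"
      and bB: "\<And>t. \<bar>b1 t\<bar> \<le> 8000" "\<And>t. \<bar>b2 t\<bar> \<le> 8000" "\<And>t. \<bar>b3 t\<bar> \<le> 8000"
      by (rule annular_cutoff[OF c0 \<rho>(1)]) (rule that; assumption)
    have b0: "b t = 0 \<and> b1 t = 0 \<and> b2 t = 0 \<and> b3 t = 0" if "t \<le> c \<or> 2 * \<rho> \<le> t" for t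
      using b0' that by blast
    have bone: "b t = 1 \<and> b1 t = 0 \<and> b2 t = 0 \<and> b3 t = 0" if "c + 1 \<le> t" "t \<le> \<rho>" for t
      using bone' that by blast
    have supp: "b t = 0 \<and> b1 t = 0 \<and> b2 t = 0 \<and> b3 t = 0" if "t < (R + 1)\<^sup>2 \<or> (2 * \<rho>)\<^sup>2 < t" for t
    proof (rule b0)
      have "2 * \<rho> \<le> (2 * \<rho>)\<^sup>2" using \<rho> by (simp add: power2_eq_square)
      then show "t \<le> c \<or> 2 * \<rho> \<le> t" using that by (auto simp: c_def)
    qed
    have R1: "R < R + 1" "0 \<le> 2 * \<rho>" using \<rho> by auto
    note cw = carleman_weak_solution[OF u F weak b supp R R1 Y mono, where k = k]
    define J where "J x = weight_uu k b b1 b2 b3 Y x * (u x * u x) + weight_ul k b b1 Y x * (u x * (- F x))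
      + weight_ll k b x * (- F x * - F x)" for x
    have Ji: "integrable lborel J" using cw(1) unfolding J_def .
    have bi: "integrable lborel (\<lambda>x. (x \<bullet> x) ^ (2*k+1) * (b (x \<bullet> x) * u x)\<^sup>2)" using cw(2) .
    have main: "(4 * real k + 6)\<^sup>2 * (\<integral>x. (x \<bullet> x) ^ (2*k+1) * (b (x \<bullet> x) * u x)\<^sup>2 \<partial>lborel) \<le> (\<integral>x. J x \<partial>lborel)"
      using cw(3) unfolding J_def .
    define D where "D = C0 * (real k + 1)\<^sup>2"
    have D0: "0 \<le> D" unfolding D_def using C0 by simp
    have "(\<integral>x. J x \<partial>lborel) \<le> (\<integral>x. D * ((c + 1) ^ p * (indicator A x * (u x)\<^sup>2) + (2 * \<rho>) ^ p * (indicator (Z \<sigma>) x * (u x)\<^sup>2)) \<partial>lborel)"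
    proof (rule integral_mono_AE)
      show "AE x in lborel. J x \<le> D * ((c + 1) ^ p * (indicator A x * (u x)\<^sup>2) + (2 * \<rho>) ^ p * (indicator (Z \<sigma>) x * (u x)\<^sup>2))"
        using FY
      proof eventually_elim
        case (elim x)
        define t where "t = x \<bullet> x"
        have R0: "0 \<le> D * ((c + 1) ^ p * (indicator A x * (u x)\<^sup>2) + (2 * \<rho>) ^ p * (indicator (Z \<sigma>) x * (u x)\<^sup>2))"
          using D0 c1 \<rho> by simp
        have J: "J x = 3 * t ^ (2*k+4) * (b t)\<^sup>2 * (Y x * u x - F x)\<^sup>2
          + (3 * t ^ (2*k+4) * (radial_lap n b1 b2 t)\<^sup>2 + 6 * radial_lap n (grad_weight1 k b1 b2) (grad_weight2 k b1 b2 b3) t) * (u x)\<^sup>2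
          + 12 * grad_weight0 k b1 t * (u x * F x)"
          unfolding J_def t_def n_def by (rule cut_integrand_eq)
        show ?case
        proof (cases "t \<le> c \<or> 2 * \<rho> \<le> t")
          case True
          from b0[OF True] have "J x = 0" unfolding J by (simp add: radial_lap_def grad_weight0_def grad_weight1_def grad_weight2_def)
          with R0 show ?thesis by simp
        next
          case False
          then have t: "c < t" "t < 2 * \<rho>" by auto
          have nx: "R + 1 < norm x"
          proof (rule power2_less_imp_less)
            show "(R + 1)\<^sup>2 < (norm x)\<^sup>2" using t by (simp add: c_def t_def dot_square_norm)
          qed simp
          have FYx: "F x = Y x * u x" using elim nx by simp
          have J': "J x = (3 * t ^ (2*k+4) * (radial_lap n b1 b2 t)\<^sup>2 + 6 * radial_lap n (grad_weight1 k b1 b2) (grad_weight2 k b1 b2 b3) t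
              + 12 * grad_weight0 k b1 t * Y x) * (u x)\<^sup>2"
            unfolding J FYx by (simp add: power2_eq_square algebra_simps)
          show ?thesis
          proof (cases "c + 1 \<le> t \<and> t \<le> \<rho>")
            case True
            from bone[of t] True have "J x = 0" unfolding J' by (simp add: radial_lap_def grad_weight0_def grad_weight1_def grad_weight2_def)
            with R0 show ?thesis by simp
          next
            case False
            have "\<bar>3 * t ^ (2*k+4) * (radial_lap n b1 b2 t)\<^sup>2 + 6 * radial_lap n (grad_weight1 k b1 b2) (grad_weight2 k b1 b2 b3) t + 12 * grad_weight0 k b1 t * Y x\<bar>
              \<le> (3 * (4 + 2 * n)\<^sup>2 + 6 * (704 + 56 * n) + 48 * M) * 8000\<^sup>2 * (real k + 1)\<^sup>2 * t ^ (2*k+6+N)"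
              by (rule cutoff_weight_bound) (use t c1 bB M Ybound[of x] nx R in \<open>auto simp: n_def t_def\<close>)
            then have "3 * t ^ (2*k+4) * (radial_lap n b1 b2 t)\<^sup>2 + 6 * radial_lap n (grad_weight1 k b1 b2) (grad_weight2 k b1 b2 b3) t + 12 * grad_weight0 k b1 t * Y x
              \<le> D * t ^ p" unfolding D_def C0_def p_def by linarith
            then have Jle: "J x \<le> D * t ^ p * (u x)\<^sup>2" unfolding J' by (rule mult_right_mono) simp
            also have "\<dots> \<le> D * ((c + 1) ^ p * (indicator A x * (u x)\<^sup>2) + (2 * \<rho>) ^ p * (indicator (Z \<sigma>) x * (u x)\<^sup>2))"
            proof (cases "t < c + 1")
              case True
              then have "x \<in> A" using t by (simp add: A_def t_def)
              moreover have "t ^ p \<le> (c + 1) ^ p" using True t c1 by (intro power_mono) auto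
              ultimately have "t ^ p * (u x)\<^sup>2 \<le> (c + 1) ^ p * (indicator A x * (u x)\<^sup>2)" by (simp add: mult_right_mono)
              also have "\<dots> \<le> (c + 1) ^ p * (indicator A x * (u x)\<^sup>2) + (2 * \<rho>) ^ p * (indicator (Z \<sigma>) x * (u x)\<^sup>2)"
                using \<rho> by simp
              finally show ?thesis unfolding mult.assoc by (rule mult_left_mono[OF _ D0])
            next
              case notA: False
              then have "\<rho> < t" using False by auto
              then have "real \<sigma> < norm x"
                by (intro power2_less_imp_less[of "real \<sigma>" "norm x"]) (auto simp: \<rho>_def t_def dot_square_norm)
              then have "x \<in> Z \<sigma>" using t by (simp add: Z_def t_def \<rho>_def)
              moreover have "t ^ p \<le> (2 * \<rho>) ^ p" using t c1 by (intro power_mono) auto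
              ultimately have "t ^ p * (u x)\<^sup>2 \<le> (2 * \<rho>) ^ p * (indicator (Z \<sigma>) x * (u x)\<^sup>2)" by (simp add: mult_right_mono)
              also have "\<dots> \<le> (c + 1) ^ p * (indicator A x * (u x)\<^sup>2) + (2 * \<rho>) ^ p * (indicator (Z \<sigma>) x * (u x)\<^sup>2)"
                using c1 by simp
              finally show ?thesis unfolding mult.assoc by (rule mult_left_mono[OF _ D0])
            qed
            finally show ?thesis .
          qed
        qed
      qed
    qed (use Ji iA iZ in auto)
    also have "\<dots> = D * ((c + 1) ^ p * IA + (2 * \<rho>) ^ p * IZ \<sigma>)"
      using iA iZ by (simp add: IA_def IZ_def)
    finally have JD: "(\<integral>x. J x \<partial>lborel) \<le> D * ((c + 1) ^ p * IA + (2 * \<rho>) ^ p * IZ \<sigma>)" .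
    have "(\<integral>x. (c + 2) ^ (2*k+1) * (indicator (S \<tau>) x * (u x)\<^sup>2) \<partial>lborel) \<le> (\<integral>x. (x \<bullet> x) ^ (2*k+1) * (b (x \<bullet> x) * u x)\<^sup>2 \<partial>lborel)"
    proof (rule integral_mono)
      fix x
      show "(c + 2) ^ (2*k+1) * (indicator (S \<tau>) x * (u x)\<^sup>2) \<le> (x \<bullet> x) ^ (2*k+1) * (b (x \<bullet> x) * u x)\<^sup>2"
      proof (cases "x \<in> S \<tau>")
        case True
        then have x: "c + 2 \<le> x \<bullet> x" "x \<bullet> x \<le> \<rho>" using \<sigma> by (auto simp: S_def \<rho>_def)
        then have "b (x \<bullet> x) = 1" using bone by simp
        moreover have "(c + 2) ^ (2*k+1) \<le> (x \<bullet> x) ^ (2*k+1)" using x c1 by (intro power_mono) auto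
        ultimately show ?thesis using True by (simp add: mult_right_mono)
      qed simp
    qed (use iS bi in auto)
    then have "(c + 2) ^ (2*k+1) * IS \<tau> \<le> (\<integral>x. (x \<bullet> x) ^ (2*k+1) * (b (x \<bullet> x) * u x)\<^sup>2 \<partial>lborel)"
      using iS by (simp add: IS_def)
    then have "(real k + 1)\<^sup>2 * ((c + 2) ^ (2*k+1) * IS \<tau>) \<le> (4 * real k + 6)\<^sup>2 * (\<integral>x. (x \<bullet> x) ^ (2*k+1) * (b (x \<bullet> x) * u x)\<^sup>2 \<partial>lborel)"
      using IS0[of \<tau>] c1 by (intro mult_mono power_mono) auto
    also have "\<dots> \<le> D * ((c + 1) ^ p * IA + (2 * \<rho>) ^ p * IZ \<sigma>)" using main JD by linarith
    also have "\<dots> = (real k + 1)\<^sup>2 * (C0 * ((c + 1) ^ p * IA + (2 * \<rho>) ^ p * IZ \<sigma>))" by (simp add: D_def)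
    finally have "(c + 2) ^ (2*k+1) * IS \<tau> \<le> C0 * ((c + 1) ^ p * IA + (2 * \<rho>) ^ p * IZ \<sigma>)"
      by (rule mult_left_le_imp_le) simp
    then show ?thesis by (simp add: p_def \<rho>_def)
  qed
  have key2: "(c + 2) ^ (2*k+1) * IS \<tau> \<le> C0 * ((c + 1) ^ (2*k+6+N) * IA)" for \<tau> k
  proof -
    define p where "p = 2*k+6+N"
    have "(\<lambda>\<sigma>. C0 * ((c + 1) ^ p * IA + 2 ^ p * (real \<sigma> ^ (2 * p) * IZ \<sigma>))) \<longlonglongrightarrow> C0 * ((c + 1) ^ p * IA + 2 ^ p * 0)"
      unfolding IZ_def Z_def by (intro tendsto_intros decay)
    moreover have "\<forall>\<^sub>F \<sigma> in sequentially. (c + 2) ^ (2*k+1) * IS \<tau> \<le> C0 * ((c + 1) ^ p * IA + 2 ^ p * (real \<sigma> ^ (2 * p) * IZ \<sigma>))"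
    proof -
      obtain \<sigma>0 :: nat where \<sigma>0: "max 1 (max (c + 2) \<tau>) \<le> real \<sigma>0" using real_arch_simple by blast
      show ?thesis
        unfolding eventually_sequentially
      proof (intro exI[of _ \<sigma>0] allI impI)
        fix \<sigma> assume "\<sigma>0 \<le> \<sigma>"
        then have "max 1 (max (c + 2) \<tau>) \<le> real \<sigma>" using \<sigma>0 by linarith
        then have s: "1 \<le> real \<sigma>" "c + 2 \<le> real \<sigma>" "\<tau> \<le> real \<sigma>" by simp_all
        have "real \<sigma> \<le> (real \<sigma>)\<^sup>2" using mult_left_mono[OF s(1), of "real \<sigma>"] by (simp add: power2_eq_square)
        then have "c + 2 \<le> (real \<sigma>)\<^sup>2" "\<tau> \<le> (real \<sigma>)\<^sup>2" using s by linarith+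
        from key[OF this, of k] show "(c + 2) ^ (2*k+1) * IS \<tau> \<le> C0 * ((c + 1) ^ p * IA + 2 ^ p * (real \<sigma> ^ (2 * p) * IZ \<sigma>))"
          by (simp only: p_def[symmetric] power_mult_distrib power_mult[symmetric] mult.assoc)
      qed
    qed
    ultimately have "(c + 2) ^ (2*k+1) * IS \<tau> \<le> C0 * ((c + 1) ^ p * IA + 2 ^ p * 0)"
      by (rule tendsto_lowerbound) simp
    then show ?thesis by (simp add: p_def)
  qed
  have IS: "IS \<tau> = 0" for \<tau>
  proof -
    define \<theta> where "\<theta> = (c + 1) / (c + 2)"
    define E where "E = C0 * ((c + 1) ^ (5 + N) * IA)"
    have \<theta>: "0 < \<theta>" "\<theta> < 1" using c1 by (auto simp: \<theta>_def)
    have "IS \<tau> \<le> E * \<theta> ^ (2*k+1)" for k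
    proof -
      have e: "2*k+6+N = (2*k+1) + (5+N)" by simp
      have "(c + 2) ^ (2*k+1) * IS \<tau> \<le> (c + 1) ^ (2*k+1) * E"
        using key2[of k \<tau>] unfolding e power_add[of "c + 1"] E_def by (simp add: mult_ac)
      then have "IS \<tau> \<le> ((c + 1) ^ (2*k+1) * E) / (c + 2) ^ (2*k+1)" using c1 by (simp add: pos_le_divide_eq mult.commute)
      also have "\<dots> = E * \<theta> ^ (2*k+1)" by (simp add: \<theta>_def power_divide)
      finally show ?thesis .
    qed
    moreover have "(\<lambda>k. E * \<theta> ^ (2*k+1)) \<longlonglongrightarrow> E * 0"
    proof (intro tendsto_intros)
      have "(\<lambda>k. (\<theta>\<^sup>2) ^ k * \<theta>) \<longlonglongrightarrow> 0 * \<theta>"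
        by (intro tendsto_intros LIMSEQ_power_zero) (use \<theta> in \<open>auto simp: power_less_one_iff abs_square_less_1\<close>)
      moreover have e: "\<theta> ^ (2*k+1) = (\<theta>\<^sup>2) ^ k * \<theta>" for k unfolding power_add power_mult by simp
      ultimately show "(\<lambda>k. \<theta> ^ (2*k+1)) \<longlonglongrightarrow> 0" unfolding e by simp
    qed
    ultimately have "IS \<tau> \<le> E * 0" by (intro LIMSEQ_le_const) auto
    with IS0[of \<tau>] show ?thesis by simp
  qed
  have "AE x in lborel. x \<in> S (real j) \<longrightarrow> u x = 0" for j :: nat
  proof -
    have "AE x in lborel. indicator (S (real j)) x * (u x)\<^sup>2 = 0"
      using integral_nonneg_eq_0_iff_AE[OF iS[of "real j"]] IS[of "real j"] unfolding IS_def by simp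
    then show ?thesis by (rule AE_mp) (auto simp: indicator_def)
  qed
  then have "AE x in lborel. \<forall>j::nat. x \<in> S (real j) \<longrightarrow> u x = 0" unfolding AE_all_countable by blast
  then show ?thesis
  proof eventually_elim
    case (elim x)
    obtain j :: nat where "x \<bullet> x \<le> real j" using real_arch_simple by blast
    then show ?case using elim by (auto simp: S_def c_def)
  qed
qed

section \<open>From a neighbourhood of infinity to the whole space\<close>

lemma AE_lborel_translation:
  fixes a :: "'a::euclidean_space"
  assumes "{x. P x} \<in> sets borel" "AE x in lborel. P x"
  shows "AE x in lborel. P (a + x)"
proof -
  have "AE x in distr lborel borel ((+) a). P x" unfolding lborel_distr_plus by (rule assms(2))
  then show ?thesis using assms(1) by (subst (asm) AE_distr_iff) auto
qed

lemma L2_on_balls_translation: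
  fixes u :: "'a::euclidean_space \<Rightarrow> real"
  assumes u: "L2_on_balls u"
  shows "L2_on_balls (\<lambda>x. u (a + x))"
  unfolding L2_on_balls_def
proof (intro conjI allI)
  note um[measurable] = L2_on_balls_measurable[OF u]
  show "(\<lambda>x. u (a + x)) \<in> borel_measurable borel" by measurable
  fix r
  have "integrable lborel (\<lambda>x. indicator (cball a r) x * (u x)\<^sup>2)"
  proof (rule integrable_indicator_sq[OF u, of _ "norm a + r"])
    fix x assume "x \<in> cball a r"
    then show "norm x \<le> norm a + r" using norm_triangle_ineq2[of x a] by (simp add: dist_norm norm_minus_commute)
  qed simp
  from integrable_lborel_translation[OF this, of a]
  have "integrable lborel (\<lambda>x. indicator (cball a r) (a + x) * (u (a + x))\<^sup>2)" .
  moreover have "indicator (cball a r) (a + x) = (indicator (cball 0 r) x :: real)" for x :: 'a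
    by (simp add: indicator_def dist_norm)
  ultimately show "integrable lborel (\<lambda>x. indicator (cball 0 r) x * (u (a + x))\<^sup>2)" by simp
qed

lemma weak_equation_translation:
  fixes u F :: "real ^ 'n::finite \<Rightarrow> real"
  assumes um: "u \<in> borel_measurable borel" "F \<in> borel_measurable borel"
    and weak: "\<And>\<phi>. test_function \<phi> \<Longrightarrow> (\<integral>y. u y * laplacian \<phi> y \<partial>lborel) = - (\<integral>y. F y * \<phi> y \<partial>lborel)"
    and \<phi>: "test_function \<phi>"
  shows "(\<integral>y. u (a + y) * laplacian \<phi> y \<partial>lborel) = - (\<integral>y. F (a + y) * \<phi> y \<partial>lborel)"
proof -
  have Ck: "Ck k \<phi>" for k using \<phi> by (simp add: test_function_def)
  define \<psi> where "\<psi> y = \<phi> (- a - (0 - y))" for y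
  have \<psi>: "\<psi> = (\<lambda>y. \<phi> (- a + y))" by (rule ext) (simp add: \<psi>_def)
  define \<phi>' where "\<phi>' y = \<phi> (- a - y)" for y
  have Ck1: "Ck k \<phi>'" for k unfolding \<phi>'_def by (rule Ck_reflect[OF Ck])
  have \<psi>': "\<psi> = (\<lambda>y. \<phi>' (0 - y))" by (rule ext) (simp add: \<psi>_def \<phi>'_def)
  have Ck2: "Ck k \<psi>" for k unfolding \<psi>' by (rule Ck_reflect[OF Ck1])
  have lap: "laplacian \<psi> y = laplacian \<phi> (- a + y)" for y
  proof -
    have "laplacian \<psi> y = laplacian \<phi>' (0 - y)" unfolding \<psi>' by (rule laplacian_reflect[OF Ck1])
    also have "\<dots> = laplacian \<phi> (- a - (0 - y))" unfolding \<phi>'_def by (rule laplacian_reflect[OF Ck])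
    finally show ?thesis by simp
  qed
  have "bounded {x. \<phi> x \<noteq> 0}" using \<phi> compact_imp_bounded bounded_subset closure_subset
    unfolding test_function_def by metis
  then obtain s where s: "\<And>x. \<phi> x \<noteq> 0 \<Longrightarrow> norm x \<le> s" unfolding bounded_iff by blast
  have "test_function \<psi>"
  proof (rule test_function_intro[OF Ck2])
    fix x :: "real^'n" assume "norm a + s < norm x"
    then have "s < norm (- a + x)" using norm_triangle_ineq2[of x a] by simp
    then show "\<psi> x = 0" using s[of "- a + x"] unfolding \<psi> by force
  qed
  from weak[OF this] have eq: "(\<integral>y. u y * laplacian \<phi> (- a + y) \<partial>lborel) = - (\<integral>y. F y * \<phi> (- a + y) \<partial>lborel)"
    unfolding lap unfolding \<psi> .
  have [measurable]: "laplacian \<phi> \<in> borel_measurable borel" "\<phi> \<in> borel_measurable borel"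
    using Ck_laplacian[of 0 \<phi>] Ck[of 2] Ck[of 0] by (auto intro!: continuous_imp_borel simp: numeral_2_eq_2)
  note um[measurable]
  have "(\<integral>y. u (a + y) * laplacian \<phi> y \<partial>lborel) = (\<integral>y. u y * laplacian \<phi> (- a + y) \<partial>lborel)"
    using integral_lborel_translation[of "\<lambda>y. u y * laplacian \<phi> (- a + y)" a] by simp
  moreover have "(\<integral>y. F (a + y) * \<phi> y \<partial>lborel) = (\<integral>y. F y * \<phi> (- a + y) \<partial>lborel)"
    using integral_lborel_translation[of "\<lambda>y. F y * \<phi> (- a + y)" a] by simp
  ultimately show ?thesis using eq by simp
qed

text \<open>
  With \<open>Y = 0\<close> and a cutoff that is \<open>1\<close> on the support of \<open>u\<close>, the right-hand side of the Carleman inequality is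
  \<open>3 q ^ (2k+4) F\<^sup>2 \<le> 3 K\<^sup>2 \<rho>\<^sup>3 q ^ (2k+1) u\<^sup>2\<close>, a multiple of the left-hand side that does not
  depend on \<open>k\<close>.
\<close>
lemma vanishing_of_supported_in_annulus:
  fixes u F :: "real ^ 'n::finite \<Rightarrow> real"
  assumes u: "L2_on_balls u" and F: "L2_on_balls F"
    and weak: "\<And>\<phi>. test_function \<phi> \<Longrightarrow> (\<integral>y. u y * laplacian \<phi> y \<partial>lborel) = - (\<integral>y. F y * \<phi> y \<partial>lborel)"
    and ann: "AE x in lborel. u x \<noteq> 0 \<longrightarrow> 3 \<le> norm x \<and> norm x \<le> s"
    and FK: "AE x in lborel. \<bar>F x\<bar> \<le> K * \<bar>u x\<bar>"
  shows "AE x in lborel. u x = 0"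
proof -
  define \<rho> where "\<rho> = s\<^sup>2 + 5"
  have \<rho>: "4 + 1 \<le> \<rho>" "s\<^sup>2 \<le> \<rho>" by (auto simp: \<rho>_def)
  have zero_less_4: "(0::real) < 4" by simp
  obtain b b1 b2 b3 where b: "\<And>t. (b has_real_derivative b1 t) (at t)" "\<And>t. (b1 has_real_derivative b2 t) (at t)"
    "\<And>t. (b2 has_real_derivative b3 t) (at t)" "continuous_on UNIV b3"
    and b0: "\<forall>t. t \<le> 4 \<or> 2 * \<rho> \<le> t \<longrightarrow> b t = 0 \<and> b1 t = 0 \<and> b2 t = 0 \<and> b3 t = 0"
    and bone: "\<forall>t. 4 + 1 \<le> t \<and> t \<le> \<rho> \<longrightarrow> b t = 1 \<and> b1 t = 0 \<and> b2 t = 0 \<and> b3 t = 0"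
    and "\<And>t. \<bar>b1 t\<bar> \<le> 8000" "\<And>t. \<bar>b2 t\<bar> \<le> 8000" "\<And>t. \<bar>b3 t\<bar> \<le> 8000"
    by (rule annular_cutoff[OF zero_less_4 \<rho>(1)]) (rule that; assumption)
  have supp: "b t = 0 \<and> b1 t = 0 \<and> b2 t = 0 \<and> b3 t = 0" if "t < 2\<^sup>2 \<or> (2 * \<rho>)\<^sup>2 < t" for t
  proof -
    \<comment> \<open>The cutoff ends at \<open>q = 2 \<rho>\<close>, which lies in the ball of radius \<open>2 \<rho>\<close> since \<open>\<rho> \<ge> 1\<close>.\<close>
    have "2 * \<rho> \<le> (2 * \<rho>)\<^sup>2" using \<rho> by (simp add: power2_eq_square)
    then have "t \<le> 4 \<or> 2 * \<rho> \<le> t" using that by auto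
    then show ?thesis using b0 by blast
  qed
  have Y: "bounded_borel_on_cball (2 * \<rho>) (\<lambda>x::real^'n. 0)" by (rule bounded_borel_continuous) simp
  define L where "L = 3 * K\<^sup>2 * \<rho> ^ 3"
  obtain k :: nat where k: "L \<le> real k" using real_arch_simple by blast
  have R: "(1::real) \<le> 1" "(1::real) < 2" "0 \<le> 2 * \<rho>" using \<rho> by auto
  note cw = carleman_weak_solution[OF u F weak b supp R Y, where k = k]
  define J where "J x = weight_uu k b b1 b2 b3 (\<lambda>x. 0) x * (u x * u x) + weight_ul k b b1 (\<lambda>x. 0) x * (u x * (- F x))
      + weight_ll k b x * (- F x * - F x)" for x
  define w where "w x = (x \<bullet> x) ^ (2*k+1) * (b (x \<bullet> x) * u x)\<^sup>2" for x
  have Ji: "integrable lborel J" using cw(1) unfolding J_def by simp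
  have wi: "integrable lborel w" using cw(2) unfolding w_def by simp
  have main: "(4 * real k + 6)\<^sup>2 * (\<integral>x. w x \<partial>lborel) \<le> (\<integral>x. J x \<partial>lborel)"
    using cw(3) unfolding J_def w_def by simp
  have w0: "0 \<le> w x" for x unfolding w_def by simp
  have "(\<integral>x. J x \<partial>lborel) \<le> (\<integral>x. L * w x \<partial>lborel)"
  proof (rule integral_mono_AE)
    show "AE x in lborel. J x \<le> L * w x"
      using ann FK
    proof eventually_elim
      case (elim x)
      define t where "t = x \<bullet> x"
      show ?case
      proof (cases "u x = 0")
        case True
        then have "F x = 0" using elim(2) by simp
        with True show ?thesis by (simp add: J_def w_def)
      next
        case False
        then have nx: "3 \<le> norm x" "norm x \<le> s" using elim(1) by auto
        have t: "5 \<le> t" "t \<le> \<rho>"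
        proof -
          have "(3::real)\<^sup>2 \<le> (norm x)\<^sup>2" "(norm x)\<^sup>2 \<le> s\<^sup>2"
          by (rule power_mono[OF nx(1)], simp, rule power_mono[OF nx(2)], simp)
          then show "5 \<le> t" "t \<le> \<rho>" using \<rho> by (auto simp: t_def dot_square_norm)
        qed
        have bt: "b t = 1" "b1 t = 0" "b2 t = 0" "b3 t = 0" using bone t by auto
        have "J x = 3 * t ^ (2*k+4) * (F x)\<^sup>2"
          unfolding J_def cut_integrand_eq t_def[symmetric]
          by (simp add: bt radial_lap_def grad_weight0_def grad_weight1_def grad_weight2_def)
        also have "\<dots> \<le> 3 * t ^ (2*k+4) * (K\<^sup>2 * (u x)\<^sup>2)"
        proof (rule mult_left_mono)
          have "\<bar>F x\<bar>\<^sup>2 \<le> (K * \<bar>u x\<bar>)\<^sup>2" by (rule power_mono[OF elim(2)]) simp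
          then show "(F x)\<^sup>2 \<le> K\<^sup>2 * (u x)\<^sup>2" by (simp add: power_mult_distrib)
        qed (use t in simp)
        also have "\<dots> = t ^ 3 * (3 * K\<^sup>2 * (t ^ (2*k+1) * (u x)\<^sup>2))"
          by (simp add: power_add eval_nat_numeral)
        also have "\<dots> \<le> \<rho> ^ 3 * (3 * K\<^sup>2 * (t ^ (2*k+1) * (u x)\<^sup>2))"
          by (intro mult_right_mono power_mono) (use t in auto)
        also have "\<dots> = L * w x" by (simp add: L_def w_def t_def[symmetric] bt)
        finally show ?thesis .
      qed
    qed
  qed (use Ji wi in auto)
  then have "(4 * real k + 6)\<^sup>2 * (\<integral>x. w x \<partial>lborel) \<le> L * (\<integral>x. w x \<partial>lborel)" using main by simp
  moreover have "L < (4 * real k + 6)\<^sup>2"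
  proof -
    have "real k < 4 * real k + 6" by simp
    also have "\<dots> \<le> (4 * real k + 6)\<^sup>2" by (simp add: power2_eq_square)
    finally show ?thesis using k by simp
  qed
  moreover have "0 \<le> (\<integral>x. w x \<partial>lborel)" by (intro integral_nonneg_AE AE_I2 w0)
  ultimately have "(\<integral>x. w x \<partial>lborel) = 0"
    by (smt (verit) mult_strict_right_mono)
  then have "AE x in lborel. w x = 0" using integral_nonneg_eq_0_iff_AE[OF wi] w0 by simp
  then show ?thesis using ann
  proof eventually_elim
    case (elim x)
    show ?case
    proof (rule ccontr)
      assume nz: "u x \<noteq> 0"
      then have nx: "3 \<le> norm x" "norm x \<le> s" using elim by auto
      have "(3::real)\<^sup>2 \<le> (norm x)\<^sup>2" "(norm x)\<^sup>2 \<le> s\<^sup>2"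
          by (rule power_mono[OF nx(1)], simp, rule power_mono[OF nx(2)], simp)
      then have "5 \<le> x \<bullet> x" "x \<bullet> x \<le> \<rho>" using \<rho> by (auto simp: dot_square_norm)
      then have "b (x \<bullet> x) = 1" "x \<bullet> x \<noteq> 0" using bone by auto
      with elim(1) nz show False by (simp add: w_def)
    qed
  qed
qed

text \<open>
  Move the origin to distance \<open>s + 3\<close>, so that the support of \<open>u\<close> lies in an annulus around the new one. The
  pointwise bound on \<open>F\<close> is invariant under translations, unlike monotonicity along rays.
\<close>
theorem vanishing_of_compactly_supported:
  fixes u F :: "real ^ 'n::finite \<Rightarrow> real"
  assumes u: "L2_on_balls u" and F: "L2_on_balls F"
    and weak: "\<And>\<phi>. test_function \<phi> \<Longrightarrow> (\<integral>y. u y * laplacian \<phi> y \<partial>lborel) = - (\<integral>y. F y * \<phi> y \<partial>lborel)"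
    and supp: "AE x in lborel. s < norm x \<longrightarrow> u x = 0" and s: "0 \<le> s"
    and FK: "AE x in lborel. \<bar>F x\<bar> \<le> K * \<bar>u x\<bar>"
  shows "AE x in lborel. u x = 0"
proof -
  note [measurable] = L2_on_balls_measurable[OF u] L2_on_balls_measurable[OF F]
  define a where "a = (axis undefined (s + 3) :: real ^ 'n)"
  have na: "norm a = s + 3" unfolding a_def using s by (simp add: norm_eq_sqrt_inner inner_axis_axis)
  have "AE x in lborel. u (- a + x) = 0"
  proof (rule vanishing_of_supported_in_annulus[OF L2_on_balls_translation[OF u] L2_on_balls_translation[OF F]])
    show "(\<integral>y. u (- a + y) * laplacian \<phi> y \<partial>lborel) = - (\<integral>y. F (- a + y) * \<phi> y \<partial>lborel)" if "test_function \<phi>" for \<phi>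
      by (rule weak_equation_translation[OF L2_on_balls_measurable[OF u] L2_on_balls_measurable[OF F] weak that])
    have "AE x in lborel. s < norm (- a + x) \<longrightarrow> u (- a + x) = 0"
      by (rule AE_lborel_translation[OF _ supp]) measurable
    then show "AE x in lborel. u (- a + x) \<noteq> 0 \<longrightarrow> 3 \<le> norm x \<and> norm x \<le> 2 * s + 3"
    proof eventually_elim
      case (elim x)
      have "norm a - norm x \<le> norm (- a + x)" using norm_triangle_ineq2[of a x] by (simp add: norm_minus_commute)
      moreover have "norm x - norm a \<le> norm (- a + x)" using norm_triangle_ineq2[of x a] by simp
      ultimately show ?case using elim na by auto
    qed
    show "AE x in lborel. \<bar>F (- a + x)\<bar> \<le> K * \<bar>u (- a + x)\<bar>"
      by (rule AE_lborel_translation[OF _ FK]) measurable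
  qed
  from AE_lborel_translation[OF _ this, of a] show ?thesis by simp
qed

section \<open>The theorem\<close>

lemma L2_loc_borel_version:
  assumes "L2_loc u" "u' \<in> borel_measurable borel" "AE x in lborel. u x = u' x"
  shows "L2_on_balls u'"
  unfolding L2_on_balls_def
proof (intro conjI allI)
  note um[measurable] = assms(2)
  show "u' \<in> borel_measurable borel" by (rule um)
  fix r
  have i: "integrable lebesgue (\<lambda>x. indicator (cball 0 r) x *\<^sub>R \<bar>u x\<bar>\<^sup>2)"
    using assms(1) unfolding L2_loc_def set_integrable_def by auto
  have ae: "AE x in lebesgue. indicator (cball 0 r) x *\<^sub>R \<bar>u x\<bar>\<^sup>2 = indicator (cball 0 r) x * (u' x)\<^sup>2"
    using AE_completion[OF assms(3)] by eventually_elim simp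
  have m: "(\<lambda>x. indicator (cball 0 r) x * (u' x)\<^sup>2) \<in> borel_measurable lborel"
    unfolding measurable_lborel2 by measurable
  have "integrable lebesgue (\<lambda>x. indicator (cball 0 r) x * (u' x)\<^sup>2)"
    by (rule integrable_cong_AE_imp[OF i measurable_completion[OF m] ae])
  then show "integrable lborel (\<lambda>x. indicator (cball 0 r) x * (u' x)\<^sup>2)"
    using integrable_completion[OF m] by simp
qed

lemma L2_on_balls_mult_bounded:
  fixes u V :: "'a::euclidean_space \<Rightarrow> real"
  assumes u: "L2_on_balls u" and V: "V \<in> borel_measurable borel"
    and bnd: "\<And>r. \<exists>B. AE x in lborel. norm x \<le> r \<longrightarrow> \<bar>V x\<bar> \<le> B"
  shows "L2_on_balls (\<lambda>x. V x * u x)"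
  unfolding L2_on_balls_def
proof (intro conjI allI)
  note [measurable] = L2_on_balls_measurable[OF u] V
  show "(\<lambda>x. V x * u x) \<in> borel_measurable borel" by measurable
  fix r
  obtain B where B: "AE x in lborel. norm x \<le> r \<longrightarrow> \<bar>V x\<bar> \<le> B" using bnd by blast
  show "integrable lborel (\<lambda>x. indicator (cball 0 r) x * (V x * u x)\<^sup>2)"
  proof (rule Bochner_Integration.integrable_bound[OF integrable_mult_right[OF L2_on_balls_integrable[OF u, of r], of "B\<^sup>2"]])
    show "AE x in lborel. norm (indicator (cball 0 r) x * (V x * u x)\<^sup>2) \<le> norm (B\<^sup>2 * (indicator (cball 0 r) x * (u x)\<^sup>2))"
      using B
    proof eventually_elim
      case (elim x)
      show ?case
      proof (cases "norm x \<le> r")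
        case True
        then have "(V x)\<^sup>2 \<le> B\<^sup>2" using elim power_mono[of "\<bar>V x\<bar>" B 2] by simp
        then show ?thesis using True by (simp add: power_mult_distrib mult_right_mono)
      qed simp
    qed
  qed (unfold measurable_lborel2, measurable)
qed

text \<open>
  What is left is to pass to Borel representatives and to check the hypotheses of the two vanishing
  theorems for \<open>F = (V + lam) u\<close>. The constant \<open>lam \<ge> 0\<close> preserves the monotonicity: \<open>r\<^sup>2 lam\<close> is increasing.
\<close>
theorem corollary1p3:
  fixes V u :: "real ^ 'n::finite \<Rightarrow> real"
    and R C M lam :: real
  assumes "CARD('n) \<ge> 2"
    and "Linf_loc V"
    and "R > 1" and "C > 0"
    and "locally_lipschitz_on {x. norm x > R} V"
    and "\<And>x. norm x > R \<Longrightarrow> \<bar>V x\<bar> \<le> C * norm x powr M"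
    and "radial_deriv_nonneg_ae R V"
    and "lam \<ge> 0"
    and "L2_loc u"
    and "weak_solution V lam u"
    and "\<And>m::real. m \<ge> 0 \<Longrightarrow>
           ((\<lambda>r. ennreal (r powr m) * outer_mass u r) \<longlongrightarrow> 0) at_top"
  shows "AE x in lebesgue. u x = 0"
proof -
  have um: "u \<in> borel_measurable lebesgue" and Vm: "V \<in> borel_measurable lebesgue"
    using assms(2,9) by (auto simp: L2_loc_def Linf_loc_def)
  obtain w where w[measurable]: "w \<in> borel_measurable borel" and uw: "AE x in lborel. u x = w x"
    using completion_ex_borel_measurable_real[OF um] by auto
  obtain V' where V'[measurable]: "V' \<in> borel_measurable borel" and VV': "AE x in lborel. V x = V' x"
    using completion_ex_borel_measurable_real[OF Vm] by auto
  have wL: "L2_on_balls w" by (rule L2_loc_borel_version[OF assms(9) w uw])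
  define P where "P x = V' x + lam" for x
  have Pm[measurable]: "P \<in> borel_measurable borel" unfolding P_def by measurable
  have Pb: "\<exists>B. AE x in lborel. norm x \<le> r \<longrightarrow> \<bar>P x\<bar> \<le> B" for r
  proof -
    obtain B where "AE x in lebesgue. x \<in> cball 0 r \<longrightarrow> \<bar>V x\<bar> \<le> B"
      using assms(2) unfolding Linf_loc_def by (meson compact_cball)
    then have "AE x in lborel. x \<in> cball 0 r \<longrightarrow> \<bar>V x\<bar> \<le> B" unfolding AE_completion_iff .
    then have "AE x in lborel. norm x \<le> r \<longrightarrow> \<bar>P x\<bar> \<le> B + lam"
      using VV' by eventually_elim (use assms(8) in \<open>auto simp: P_def\<close>)
    then show ?thesis by blast
  qed
  have Vb: "\<exists>B. AE x in lborel. norm x \<le> r \<longrightarrow> \<bar>V' x\<bar> \<le> B" for r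
  proof -
    obtain B where "AE x in lborel. norm x \<le> r \<longrightarrow> \<bar>P x\<bar> \<le> B" using Pb by blast
    then have "AE x in lborel. norm x \<le> r \<longrightarrow> \<bar>V' x\<bar> \<le> B + lam"
      by eventually_elim (use assms(8) in \<open>auto simp: P_def\<close>)
    then show ?thesis by blast
  qed
  define F where "F x = P x * w x" for x
  have FL: "L2_on_balls F" unfolding F_def by (rule L2_on_balls_mult_bounded[OF wL Pm Pb])
  have VwL: "L2_on_balls (\<lambda>x. V' x * w x)" by (rule L2_on_balls_mult_bounded[OF wL V' Vb])
  have weak: "(\<integral>y. w y * laplacian \<phi> y \<partial>lborel) = - (\<integral>y. F y * \<phi> y \<partial>lborel)" if \<phi>: "test_function \<phi>" for \<phi>
  proof -
    have Ck: "Ck k \<phi>" for k using \<phi> by (simp add: test_function_def)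
    have c: "continuous_on UNIV \<phi>" "continuous_on UNIV (laplacian \<phi>)"
      using Ck_laplacian[of 0 \<phi>] Ck[of 2] Ck[of 0] by (auto simp: numeral_2_eq_2)
    note cm[measurable] = continuous_imp_borel[OF c(1)] continuous_imp_borel[OF c(2)]
    have "bounded {x. \<phi> x \<noteq> 0}" using \<phi> compact_imp_bounded bounded_subset closure_subset
      unfolding test_function_def by metis
    then obtain s where s: "\<And>x. \<phi> x \<noteq> 0 \<Longrightarrow> norm x \<le> s" unfolding bounded_iff by blast
    have s0: "\<phi> x = 0" if "s < norm x" for x using s[of x] that by force
    have i: "integrable lborel (\<lambda>x. g x * \<phi> x)" if "L2_on_balls g" for g
      using L2_on_balls_integrable_mult[OF bounded_borel_continuous[OF c(1)] s0 that L2_on_balls_continuous[OF continuous_on_const[of UNIV 1]]]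
      by (simp add: mult.commute)
    have conv: "(\<integral>x. g x \<partial>lebesgue) = (\<integral>x. g' x \<partial>lborel)"
      if "g' \<in> borel_measurable borel" "AE x in lborel. g x = g' x" "g \<in> borel_measurable lebesgue" for g g' :: "real^'n \<Rightarrow> real"
    proof -
      have "(\<integral>x. g x \<partial>lebesgue) = (\<integral>x. g' x \<partial>lebesgue)"
        by (rule integral_cong_AE) (use that AE_completion in \<open>auto intro: measurable_completion\<close>)
      also have "\<dots> = (\<integral>x. g' x \<partial>lborel)" by (rule integral_completion) (use that in simp)
      finally show ?thesis .
    qed
    have cl: "\<phi> \<in> borel_measurable lebesgue" "laplacian \<phi> \<in> borel_measurable lebesgue"
      using cm by (auto intro: measurable_completion)
    have e1: "(\<integral>x. u x * (- laplacian \<phi> x) \<partial>lebesgue) = (\<integral>x. w x * (- laplacian \<phi> x) \<partial>lborel)"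
    proof (rule conv)
      show "AE x in lborel. u x * (- laplacian \<phi> x) = w x * (- laplacian \<phi> x)" using uw by eventually_elim simp
      show "(\<lambda>x. u x * (- laplacian \<phi> x)) \<in> borel_measurable lebesgue" using um cl by (intro borel_measurable_times borel_measurable_uminus)
    qed measurable
    have e2: "(\<integral>x. V x * u x * \<phi> x \<partial>lebesgue) = (\<integral>x. V' x * w x * \<phi> x \<partial>lborel)"
    proof (rule conv)
      show "AE x in lborel. V x * u x * \<phi> x = V' x * w x * \<phi> x" using uw VV' by eventually_elim simp
      show "(\<lambda>x. V x * u x * \<phi> x) \<in> borel_measurable lebesgue" using um Vm cl by (intro borel_measurable_times)
    qed measurable
    have e3: "(\<integral>x. u x * \<phi> x \<partial>lebesgue) = (\<integral>x. w x * \<phi> x \<partial>lborel)"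
    proof (rule conv)
      show "AE x in lborel. u x * \<phi> x = w x * \<phi> x" using uw by eventually_elim simp
      show "(\<lambda>x. u x * \<phi> x) \<in> borel_measurable lebesgue" using um cl by (intro borel_measurable_times)
    qed measurable
    have "(\<integral>x. w x * (- laplacian \<phi> x) \<partial>lborel) - (\<integral>x. V' x * w x * \<phi> x \<partial>lborel) = lam * (\<integral>x. w x * \<phi> x \<partial>lborel)"
      using assms(10) \<phi> unfolding weak_solution_def e1[symmetric] e2[symmetric] e3[symmetric] by blast
    moreover have "(\<integral>x. F x * \<phi> x \<partial>lborel) = (\<integral>x. V' x * w x * \<phi> x + lam * (w x * \<phi> x) \<partial>lborel)"
      by (rule Bochner_Integration.integral_cong) (simp_all add: F_def P_def algebra_simps)
    moreover have "(\<integral>x. V' x * w x * \<phi> x + lam * (w x * \<phi> x) \<partial>lborel) = (\<integral>x. V' x * w x * \<phi> x \<partial>lborel) + lam * (\<integral>x. w x * \<phi> x \<partial>lborel)"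
      using i[OF VwL] i[OF wL] by simp
    moreover have "(\<integral>x. w x * (- laplacian \<phi> x) \<partial>lborel) = - (\<integral>x. w x * laplacian \<phi> x \<partial>lborel)" by simp
    ultimately show ?thesis by linarith
  qed
  \<comment> \<open>\<open>V\<close> itself, not its Borel version, because it is continuous here and the bounds hold pointwise.\<close>
  define Y where "Y x = (if R < norm x then V x + lam else 0)" for x
  \<comment> \<open>Powers of \<open>x \<bullet> x\<close> with natural exponent suffice, as \<open>norm x > 1\<close>.\<close>
  define N where "N = nat \<lceil>\<bar>M\<bar>\<rceil>"
  have Vle: "\<bar>V x\<bar> \<le> C * (x \<bullet> x) ^ N" if "R < norm x" for x
  proof -
    have n1: "1 \<le> norm x" using that assms(3) by linarith
    have "norm x powr M \<le> norm x powr (real (2 * N))"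
      by (rule powr_mono[OF _ n1]) (unfold N_def, linarith)
    also have "\<dots> = (x \<bullet> x) ^ N"
      using n1 by (subst powr_realpow) (auto simp: power_mult dot_square_norm)
    finally have "C * norm x powr M \<le> C * (x \<bullet> x) ^ N" using assms(4) by simp
    with assms(6)[OF that] show ?thesis by linarith
  qed
  have Yle: "\<bar>Y x\<bar> \<le> (C + lam) * (x \<bullet> x) ^ N" if "1 \<le> norm x" for x
  proof (cases "R < norm x")
    case True
    have "1 \<le> x \<bullet> x" using that by (simp add: dot_square_norm one_le_power)
    then have "1 \<le> (x \<bullet> x) ^ N" by (rule one_le_power)
    then have "lam * 1 \<le> lam * (x \<bullet> x) ^ N" using assms(8) by (rule mult_left_mono)
    with Vle[OF True] True assms(8) show ?thesis by (simp add: Y_def distrib_right)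
  next
    case False
    then show ?thesis using assms(4,8) by (simp add: Y_def)
  qed
  have Vc: "continuous_on {x. R < norm x} V"
    by (rule locally_lipschitz_on_continuous[OF assms(5) open_norm_greater])
  have Ym: "Y \<in> borel_measurable borel"
  proof -
    have "(\<lambda>x. indicator {x. R < norm x} x *\<^sub>R (V x + lam)) \<in> borel_measurable borel"
      by (rule borel_measurable_continuous_on_indicator) (auto intro!: continuous_intros Vc borel_open open_norm_greater)
    moreover have "(\<lambda>x. indicator {x. R < norm x} x *\<^sub>R (V x + lam)) = Y" by (auto simp: Y_def)
    ultimately show ?thesis by simp
  qed
  have Yb: "bounded_borel_on_cball r Y" for r
    unfolding bounded_borel_on_cball_def
  proof (intro conjI Ym exI allI impI)
    fix x :: "real^'n" assume x: "norm x \<le> r"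
    show "\<bar>Y x\<bar> \<le> (C + lam) * (r\<^sup>2) ^ N"
    proof (cases "R < norm x")
      case True
      have "x \<bullet> x \<le> r\<^sup>2" using x by (simp add: dot_square_norm power_mono)
      then have "(C + lam) * (x \<bullet> x) ^ N \<le> (C + lam) * (r\<^sup>2) ^ N"
        using assms(4,8) by (intro mult_left_mono power_mono) auto
      moreover have "\<bar>Y x\<bar> \<le> (C + lam) * (x \<bullet> x) ^ N" by (rule Yle) (use True assms(3) in linarith)
      ultimately show ?thesis by linarith
    next
      case False
      then show ?thesis using assms(4,8) by (simp add: Y_def)
    qed
  qed
  have Ymono: "Y x \<le> t\<^sup>2 * Y (t *\<^sub>R x)" if x: "R < norm x" and t: "1 \<le> t" for x t
  proof -
    have "R < norm (t *\<^sub>R x)" using x t mult_right_mono[OF t norm_ge_zero[of x]] by simp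
    moreover have "V x \<le> t\<^sup>2 * V (t *\<^sub>R x)"
      by (rule radially_increasing[OF assms(5,7) _ x t]) (use assms(3) in simp)
    moreover have "lam * 1 \<le> lam * t\<^sup>2" using assms(8) t by (intro mult_left_mono) auto
    ultimately show ?thesis using x by (simp add: Y_def algebra_simps)
  qed
  have FY: "AE x in lborel. R < norm x \<longrightarrow> F x = Y x * w x"
    using VV' by eventually_elim (simp add: F_def P_def Y_def)
  have decay: "(\<lambda>\<sigma>::nat. (real \<sigma>) ^ p *
        (\<integral>x. indicator {x. real \<sigma> < norm x \<and> x \<bullet> x \<le> 2 * (real \<sigma>)\<^sup>2} x * (w x)\<^sup>2 \<partial>lborel)) \<longlonglongrightarrow> 0" for p
  proof -
    define I where "I \<sigma> = (\<integral>x. indicator {x. real \<sigma> < norm x \<and> x \<bullet> x \<le> 2 * (real \<sigma>)\<^sup>2} x * (w x)\<^sup>2 \<partial>lborel)" for \<sigma> :: nat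
    have I0: "0 \<le> I \<sigma>" for \<sigma> unfolding I_def by (intro integral_nonneg_AE AE_I2) simp
    have Ile: "ennreal (I \<sigma>) \<le> outer_mass u (real \<sigma>)" for \<sigma>
    proof -
      have [measurable]: "{x::real^'n. real \<sigma> < norm x \<and> x \<bullet> x \<le> 2 * (real \<sigma>)\<^sup>2} \<in> sets borel" by measurable
      have "integrable lborel (\<lambda>x. indicator {x. real \<sigma> < norm x \<and> x \<bullet> x \<le> 2 * (real \<sigma>)\<^sup>2} x * (w x)\<^sup>2)"
        by (rule integrable_indicator_sq[OF wL, of _ "2 * (real \<sigma>)\<^sup>2 + 1"]) (auto dest!: norm_le_of_sq_le)
      from nn_integral_eq_integral[OF this]
      have "ennreal (I \<sigma>) = (\<integral>\<^sup>+x. ennreal (indicator {x. real \<sigma> < norm x \<and> x \<bullet> x \<le> 2 * (real \<sigma>)\<^sup>2} x * (w x)\<^sup>2) \<partial>lborel)"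
        by (simp add: I_def)
      also have "\<dots> \<le> (\<integral>\<^sup>+x. ennreal (\<bar>u x\<bar>\<^sup>2) * indicator {x. real \<sigma> < norm x} x \<partial>lborel)"
      proof (rule nn_integral_mono_AE)
        show "AE x in lborel. ennreal (indicator {x. real \<sigma> < norm x \<and> x \<bullet> x \<le> 2 * (real \<sigma>)\<^sup>2} x * (w x)\<^sup>2)
          \<le> ennreal (\<bar>u x\<bar>\<^sup>2) * indicator {x. real \<sigma> < norm x} x"
          using uw by eventually_elim (auto simp: indicator_def)
      qed
      also have "\<dots> = outer_mass u (real \<sigma>)"
        unfolding outer_mass_def by (simp add: nn_integral_completion)
      finally show ?thesis .
    qed
    have lim0: "((\<lambda>\<sigma>::nat. ennreal (real \<sigma> powr real p) * outer_mass u (real \<sigma>)) \<longlongrightarrow> 0) sequentially"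
      by (rule filterlim_compose[OF assms(11) filterlim_real_sequentially]) simp
    have "(\<lambda>\<sigma>. ennreal (real \<sigma> ^ p * I \<sigma>)) \<longlonglongrightarrow> 0"
    proof (rule tendsto_sandwich[OF _ _ tendsto_const lim0])
      show "\<forall>\<^sub>F \<sigma> in sequentially. 0 \<le> ennreal (real \<sigma> ^ p * I \<sigma>)" by simp
      show "\<forall>\<^sub>F \<sigma> in sequentially. ennreal (real \<sigma> ^ p * I \<sigma>) \<le> ennreal (real \<sigma> powr real p) * outer_mass u (real \<sigma>)"
        using eventually_gt_at_top[of 0]
      proof eventually_elim
        case (elim \<sigma>)
        then have "real \<sigma> powr real p = real \<sigma> ^ p" by (simp add: powr_realpow)
        then show ?case using I0[of \<sigma>] by (simp add: ennreal_mult mult_left_mono[OF Ile])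
      qed
    qed
    then have "(\<lambda>\<sigma>. ennreal (real \<sigma> ^ p * I \<sigma>)) \<longlonglongrightarrow> ennreal 0" by simp
    then have "(\<lambda>\<sigma>. real \<sigma> ^ p * I \<sigma>) \<longlonglongrightarrow> 0"
      by (subst (asm) tendsto_ennreal_iff) (auto simp: I0)
    then show ?thesis unfolding I_def .
  qed
  have "AE x in lborel. (R + 1)\<^sup>2 + 2 \<le> x \<bullet> x \<longrightarrow> w x = 0"
    by (rule vanishing_near_infinity[OF wL FL weak _ Yb Ymono Yle _ FY decay]) (use assms(3,4,8) in auto)
  then have supp: "AE x in lborel. R + 3 < norm x \<longrightarrow> w x = 0"
  proof eventually_elim
    case (elim x)
    show ?case
    proof
      assume "R + 3 < norm x"
      then have "(R + 3)\<^sup>2 \<le> x \<bullet> x" using assms(3) by (simp add: dot_square_norm power_mono)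
      then have "(R + 1)\<^sup>2 + 2 \<le> x \<bullet> x" using assms(3) by (simp add: power2_eq_square algebra_simps)
      with elim show "w x = 0" by simp
    qed
  qed
  obtain K where K: "AE x in lborel. norm x \<le> R + 3 \<longrightarrow> \<bar>P x\<bar> \<le> K" using Pb by blast
  have "AE x in lborel. \<bar>F x\<bar> \<le> K * \<bar>w x\<bar>"
    using K supp
  proof eventually_elim
    case (elim x)
    show ?case
    proof (cases "norm x \<le> R + 3")
      case True
      then show ?thesis using elim by (simp add: F_def abs_mult mult_right_mono)
    next
      case False
      then show ?thesis using elim by (simp add: F_def)
    qed
  qed
  from vanishing_of_compactly_supported[OF wL FL weak supp _ this]
  have "AE x in lborel. w x = 0" using assms(3) by simp
  with uw have "AE x in lborel. u x = 0" by eventually_elim simp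
  then show ?thesis by (rule AE_completion)
qed

end
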